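(* Let $\Gamma$ be a compact metric tree with Dirichlet conditions on all external vertices and standard conditions at all other vertices, and let $\lambda_1<\lambda_2\le\lambda_3\le\dots$ be the eigenvalues of $-\Delta$ on $\Gamma$. Let $n\ge1$ and $z\in(\lambda_n,\lambda_{n+1}]$, and suppose that $f$ is a positive function on the set $\{\lambda_1,\dots,\lambda_n\}$ such that $f(\lambda_j)/(z-\lambda_j)^2$ is nondecreasing with $j$ (for $1\le j\le n$). Then $$\sum_{j=1}^n f(\lambda_j)\le 4\sum_{j=1}^n\frac{f(\lambda_j)}{z-\lambda_j}\,\lambda_j .$$
   Context: A compact metric tree is a connected compact metric graph (finitely many edges, each identified with a compact interval of positive length, glued at vertices) with no cycles. External vertices are the vertices of degree one. $-\Delta$ is the self-adjoint operator on $L^2(\Gamma)$ associated to the quadratic form $\|u'\|^2$ with domain $\{u\in H^1(\Gamma):u=0\text{ at all external vertices}\}$, where $H^1(\Gamma)$ consists of continuous functions on $\Gamma$ that are $H^1$ on each edge. Thus it acts as $-d^2/dx^2$ on edges, with Dirichlet conditions at external vertices and standard (Kirchhoff--Neumann) conditions at the others: continuity, and vanishing of the sum of outgoing derivatives. Eigenvalues are listed in ascending order with multiplicity. *)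

theory Defs
  imports
    "HOL-Analysis.Analysis"
    "HOL-Library.Function_Algebras"
    "Graph_Theory.Digraph_Component"
    "Graph_Theory.Arc_Walk"
begin

section \<open>Compact metric trees\<close>

text \<open>
  A compact metric graph is a finite multigraph \<open>G\<close> (loops and parallel edges are allowed)
  together with an edge length function \<open>len\<close>: the edge \<open>e\<close> is identified with the interval
  \<open>{0..len e}\<close>, its end \<open>0\<close> being glued to the vertex \<open>tail G e\<close> and its end \<open>len e\<close> to the
  vertex \<open>head G e\<close>. The direction of an arc of \<open>G\<close> only fixes this parametrisation. Undirected
  notions are expressed in the digraph below, in which every edge \<open>e\<close> occurs once in each
  direction, as \<open>(e, True)\<close> and as \<open>(e, False)\<close>.
\<close>

definition bidirected :: "('v, 'e) pre_digraph \<Rightarrow> ('v, 'e \<times> bool) pre_digraph" where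
  "bidirected G =
     \<lparr> verts = verts G,
       arcs = arcs G \<times> UNIV,
       tail = (\<lambda>(e, b). if b then tail G e else head G e),
       head = (\<lambda>(e, b). if b then head G e else tail G e) \<rparr>"

text \<open>
  Distinctness of the underlying edges excludes walking along an edge and straight back.
  A loop is a cycle of length one, a pair of parallel edges gives a cycle of length two.
\<close>

definition undirected_cycle :: "('v, 'e) pre_digraph \<Rightarrow> ('e \<times> bool) list \<Rightarrow> bool" where
  "undirected_cycle G p \<longleftrightarrow> pre_digraph.cycle (bidirected G) p \<and> distinct (map fst p)"

definition compact_metric_tree :: "('v, 'e) pre_digraph \<Rightarrow> ('e \<Rightarrow> real) \<Rightarrow> bool" where
  "compact_metric_tree G len \<longleftrightarrow>
     fin_digraph G \<and> (\<forall>e\<in>arcs G. 0 < len e) \<and>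
     strongly_connected (bidirected G) \<and> (\<nexists>p. undirected_cycle G p)"

text \<open>The out-degree in the bidirected digraph is the degree, with loops counted twice.\<close>

definition external_vertices :: "('v, 'e) pre_digraph \<Rightarrow> 'v set" where
  "external_vertices G = {v \<in> verts G. out_degree (bidirected G) v = 1}"


section \<open>Function spaces\<close>

text \<open>
  A real function on the metric graph is a family \<open>u\<close> of functions \<open>u e\<close> on the edges. The values
  \<open>u e x\<close> for \<open>e \<notin> arcs G\<close> or \<open>x \<notin> {0..len e}\<close> have no meaning; in \<open>H1\<close> they are
  normalised to \<open>0\<close>, so that equality in the type is equality of functions on the graph.
\<close>

definition L2_interval :: "real \<Rightarrow> (real \<Rightarrow> real) \<Rightarrow> bool" where
  "L2_interval l g \<longleftrightarrow> set_borel_measurable lborel {0..l} g \<and>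
     set_integrable lborel {0..l} (\<lambda>x. (g x)\<^sup>2)"

text \<open>
  \<open>u\<close> is the absolutely continuous representative of an element of \<open>H\<^sup>1(0, l)\<close> and \<open>g\<close> is (a
  representative of) its derivative.
\<close>

definition has_H1_derivative :: "real \<Rightarrow> (real \<Rightarrow> real) \<Rightarrow> (real \<Rightarrow> real) \<Rightarrow> bool" where
  "has_H1_derivative l u g \<longleftrightarrow>
     L2_interval l g \<and> (\<forall>x\<in>{0..l}. u x = u 0 + (LINT t:{0..x}|lborel. g t))"

text \<open>The choice is unique up to a null set, hence irrelevant under the integral.\<close>

definition H1_derivative :: "real \<Rightarrow> (real \<Rightarrow> real) \<Rightarrow> real \<Rightarrow> real" where
  "H1_derivative l u = (SOME g. has_H1_derivative l u g)"

definition L2 :: "('v, 'e) pre_digraph \<Rightarrow> ('e \<Rightarrow> real) \<Rightarrow> ('e \<Rightarrow> real \<Rightarrow> real) set" where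
  "L2 G len = {w. \<forall>e\<in>arcs G. L2_interval (len e) (w e)}"

definition L2_inner ::
  "('v, 'e) pre_digraph \<Rightarrow> ('e \<Rightarrow> real) \<Rightarrow> ('e \<Rightarrow> real \<Rightarrow> real) \<Rightarrow> ('e \<Rightarrow> real \<Rightarrow> real) \<Rightarrow> real" where
  "L2_inner G len u w = (\<Sum>e\<in>arcs G. LINT x:{0..len e}|lborel. u e x * w e x)"

definition has_vertex_values ::
  "('v, 'e) pre_digraph \<Rightarrow> ('e \<Rightarrow> real) \<Rightarrow> ('e \<Rightarrow> real \<Rightarrow> real) \<Rightarrow> ('v \<Rightarrow> real) \<Rightarrow> bool" where
  "has_vertex_values G len u \<phi> \<longleftrightarrow>
     (\<forall>e\<in>arcs G. u e 0 = \<phi> (tail G e) \<and> u e (len e) = \<phi> (head G e))"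

definition continuous_on_graph ::
  "('v, 'e) pre_digraph \<Rightarrow> ('e \<Rightarrow> real) \<Rightarrow> ('e \<Rightarrow> real \<Rightarrow> real) \<Rightarrow> bool" where
  "continuous_on_graph G len u \<longleftrightarrow>
     (\<forall>e\<in>arcs G. continuous_on {0..len e} (u e)) \<and> (\<exists>\<phi>. has_vertex_values G len u \<phi>)"

definition H1 :: "('v, 'e) pre_digraph \<Rightarrow> ('e \<Rightarrow> real) \<Rightarrow> ('e \<Rightarrow> real \<Rightarrow> real) set" where
  "H1 G len = {u. continuous_on_graph G len u \<and>
     (\<forall>e\<in>arcs G. \<exists>g. has_H1_derivative (len e) (u e) g) \<and>
     (\<forall>e x. \<not> (e \<in> arcs G \<and> x \<in> {0..len e}) \<longrightarrow> u e x = 0)}"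


section \<open>The Laplacian and its eigenvalues\<close>

definition form_domain :: "('v, 'e) pre_digraph \<Rightarrow> ('e \<Rightarrow> real) \<Rightarrow> ('e \<Rightarrow> real \<Rightarrow> real) set" where
  "form_domain G len = {u \<in> H1 G len.
     \<exists>\<phi>. has_vertex_values G len u \<phi> \<and> (\<forall>v\<in>external_vertices G. \<phi> v = 0)}"

text \<open>The symmetric bilinear form whose quadratic form is the squared norm of \<open>u'\<close>.\<close>

definition energy_form ::
  "('v, 'e) pre_digraph \<Rightarrow> ('e \<Rightarrow> real) \<Rightarrow> ('e \<Rightarrow> real \<Rightarrow> real) \<Rightarrow> ('e \<Rightarrow> real \<Rightarrow> real) \<Rightarrow> real" where
  "energy_form G len u v =
     L2_inner G len (\<lambda>e. H1_derivative (len e) (u e)) (\<lambda>e. H1_derivative (len e) (v e))"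

text \<open>
  The graph of the self-adjoint operator associated to the form. The second component is
  determined only up to null sets, as usual for elements of \<open>L\<^sup>2\<close>.
\<close>

definition neg_laplacian ::
  "('v, 'e) pre_digraph \<Rightarrow> ('e \<Rightarrow> real) \<Rightarrow> (('e \<Rightarrow> real \<Rightarrow> real) \<times> ('e \<Rightarrow> real \<Rightarrow> real)) set" where
  "neg_laplacian G len = {(u, w). u \<in> form_domain G len \<and> w \<in> L2 G len \<and>
     (\<forall>v\<in>form_domain G len. energy_form G len u v = L2_inner G len w v)}"

definition scale_fun :: "real \<Rightarrow> ('e \<Rightarrow> real \<Rightarrow> real) \<Rightarrow> 'e \<Rightarrow> real \<Rightarrow> real" where
  "scale_fun c u = (\<lambda>e x. c * u e x)"

interpretation graph_fun: vector_space scale_fun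
  by standard (auto simp: scale_fun_def fun_eq_iff algebra_simps)

definition eigenspace :: "('v, 'e) pre_digraph \<Rightarrow> ('e \<Rightarrow> real) \<Rightarrow> real \<Rightarrow> ('e \<Rightarrow> real \<Rightarrow> real) set" where
  "eigenspace G len \<mu> = {u. (u, scale_fun \<mu> u) \<in> neg_laplacian G len}"

text \<open>
  \<open>ev 1 \<le> ev 2 \<le> ...\<close> is the list of all eigenvalues: every real \<open>\<mu>\<close> occurs exactly as often as the
  dimension of its eigenspace (so not at all if it is no eigenvalue). The value \<open>ev 0\<close> is not
  used. A finite basis is required explicitly since \<open>graph_fun.dim\<close> is \<open>0\<close> in infinite dimension.
\<close>

definition lists_eigenvalues ::
  "('v, 'e) pre_digraph \<Rightarrow> ('e \<Rightarrow> real) \<Rightarrow> (nat \<Rightarrow> real) \<Rightarrow> bool" where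
  "lists_eigenvalues G len ev \<longleftrightarrow>
     mono_on {1..} ev \<and>
     (\<forall>\<mu>. finite {j. 1 \<le> j \<and> ev j = \<mu>} \<and>
       (\<exists>B. finite B \<and> graph_fun.independent B \<and> graph_fun.span B = eigenspace G len \<mu> \<and>
          card B = card {j. 1 \<le> j \<and> ev j = \<mu>}))"

end

theory Submission
  imports Defs "HOL-Complex_Analysis.Great_Picard"
begin

text \<open>
  The weights reduce to a single choice. Put \<open>h j = (z - ev j) * (z - 5 * ev j)\<close>. Since \<open>ev\<close> is
  nondecreasing and below \<open>z\<close>, the signs of \<open>h 1, ..., h n\<close> change at most once, from plus to minus.
  Multiplication by a nonnegative nondecreasing weight therefore keeps the sum of the \<open>h j\<close>
  nonpositive (\<open>weighted_sum_nonpos\<close>), so that it suffices to treat \<open>f (ev j) = (z - ev j)\<^sup>2\<close>. This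
  is Yang's inequality for the tree, \<open>tree_Yang_inequality\<close>.

  Yang's inequality comes from commuting the Laplacian with multiplication by a function that is
  affine on every edge. Let \<open>u i\<close> be orthonormal eigenfunctions for \<open>ev 1, ..., ev n\<close>, and let the
  multiplier be continuous on the tree with slopes \<open>\<gamma> e\<close> that add up to zero at every vertex which
  is not external. Then the commutator applied to \<open>u i\<close> is \<open>- 2 \<gamma> (u i)'\<close>, without contributions
  from the vertices (\<open>energy_commutator_balanced\<close>). The component of the product of multiplier and
  \<open>u i\<close> orthogonal to \<open>u 1, ..., u n\<close> is a test function whose Rayleigh quotient is at least
  \<open>ev (n + 1)\<close>, hence at least \<open>z\<close>. The Cauchy-Schwarz inequality, weighting with \<open>z - ev i\<close> and
  summing over \<open>i\<close>, where the matrix elements of the multiplier cancel by antisymmetry, give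
  the inequality with each edge weighted by \<open>(\<gamma> e)\<^sup>2\<close> (\<open>abstract_Yang_inequality\<close>,
  \<open>multiplier_Yang_inequality\<close>).

  To remove these weights, the tree is mapped to the complex plane so that every edge becomes a
  segment of its own length and at every vertex which is not external the unit vectors along the
  edges sum to zero (\<open>tree_planar_map\<close>). Such a map is built by adding one vertex at a time: at a new
  vertex of degree \<open>d\<close> the directions are rotated \<open>d\<close>-th roots of unity, and since there are no
  cycles exactly one of them is prescribed. The two coordinates are admissible multipliers, and the
  squares of their slopes add up to one on every edge.

  The lower bound on the Rayleigh quotient, \<open>Rayleigh_lower_bound\<close>, requires that a minimiser exists.
  Minimising sequences have subsequences that converge uniformly, by the theorem of Arzela and
  Ascoli (\<open>Rellich\<close>); by the parallelogram identity they are then Cauchy sequences in the form norm,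
  in which the form domain is complete (\<open>form_domain_complete\<close>).
\<close>


section \<open>Pairs of symmetric forms\<close>

lemma antisymmetric_double_sum:
  fixes g :: "'i \<Rightarrow> 'i \<Rightarrow> real"
  assumes "\<And>i j. i \<in> I \<Longrightarrow> j \<in> I \<Longrightarrow> g i j = - g j i"
  shows "(\<Sum>i\<in>I. \<Sum>j\<in>I. g i j) = 0"
proof -
  have "(\<Sum>i\<in>I. \<Sum>j\<in>I. g i j) = (\<Sum>i\<in>I. \<Sum>j\<in>I. - g j i)"
    by (intro sum.cong refl assms)
  also have "\<dots> = - (\<Sum>i\<in>I. \<Sum>j\<in>I. g j i)" by (simp add: sum_negf)
  also have "(\<Sum>i\<in>I. \<Sum>j\<in>I. g j i) = (\<Sum>i\<in>I. \<Sum>j\<in>I. g i j)" by (rule sum.swap)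
  finally show ?thesis by simp
qed

text \<open>
  A positive semidefinite symmetric bilinear form, required to be additive and homogeneous only on a
  subspace \<open>D\<close> of a real vector space. Functions on a graph carry no type class structure of a real
  vector space, which is why the scalar multiplication is a parameter.
\<close>

locale nonneg_form = vector_space scale
  for scale :: "real \<Rightarrow> 'a::ab_group_add \<Rightarrow> 'a" (infixr "*s" 75) +
  fixes D :: "'a set" and form :: "'a \<Rightarrow> 'a \<Rightarrow> real"
  assumes D: "subspace D"
    and add_left: "\<lbrakk>x \<in> D; y \<in> D; w \<in> D\<rbrakk> \<Longrightarrow> form (x + y) w = form x w + form y w"
    and scale_left: "\<lbrakk>x \<in> D; w \<in> D\<rbrakk> \<Longrightarrow> form (c *s x) w = c * form x w"
    and sym: "form x w = form w x"
    and nonneg: "x \<in> D \<Longrightarrow> 0 \<le> form x x"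
begin

lemmas D_intros = subspace_add[OF D] subspace_diff[OF D] subspace_scale[OF D] subspace_0[OF D]
  subspace_sum[OF D]

lemma add_right: "\<lbrakk>x \<in> D; y \<in> D; w \<in> D\<rbrakk> \<Longrightarrow> form w (x + y) = form w x + form w y"
  by (metis add_left sym)

lemma scale_right: "\<lbrakk>x \<in> D; w \<in> D\<rbrakk> \<Longrightarrow> form w (c *s x) = c * form w x"
  by (metis scale_left sym)

lemma diff_left:
  assumes "x \<in> D" "y \<in> D" "w \<in> D"
  shows "form (x - y) w = form x w - form y w"
  using add_left[of "x - y" y w] assms D_intros(2) by simp

lemma diff_right: "\<lbrakk>x \<in> D; y \<in> D; w \<in> D\<rbrakk> \<Longrightarrow> form w (x - y) = form w x - form w y"
  by (metis diff_left sym)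

lemma zero_left: "w \<in> D \<Longrightarrow> form 0 w = 0"
  using scale_left[of 0 w 0] D_intros(4) by simp

lemma zero_right: "w \<in> D \<Longrightarrow> form w 0 = 0"
  by (metis zero_left sym)

lemma sum_left:
  assumes "\<And>i. i \<in> I \<Longrightarrow> x i \<in> D" "w \<in> D"
  shows "form (\<Sum>i\<in>I. x i) w = (\<Sum>i\<in>I. form (x i) w)"
  using assms(1)
proof (induction I rule: infinite_finite_induct)
  case (insert i I)
  then show ?case using assms(2) by (simp add: add_left D_intros(5))
qed (simp_all add: zero_left assms(2))

lemma sum_right:
  assumes "\<And>i. i \<in> I \<Longrightarrow> x i \<in> D" "w \<in> D"
  shows "form w (\<Sum>i\<in>I. x i) = (\<Sum>i\<in>I. form w (x i))"
proof -
  have "form w (\<Sum>i\<in>I. x i) = (\<Sum>i\<in>I. form (x i) w)"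
    using sum_left[OF assms] by (simp only: sym[of w "\<Sum>i\<in>I. x i"])
  also have "\<dots> = (\<Sum>i\<in>I. form w (x i))" by (intro sum.cong refl sym)
  finally show ?thesis .
qed

lemmas bilinear = add_left add_right diff_left diff_right scale_left scale_right
  zero_left zero_right sum_left sum_right

lemma square_expand:
  assumes "x \<in> D" "y \<in> D"
  shows "form (x + t *s y) (x + t *s y) = form x x + 2 * t * form x y + t\<^sup>2 * form y y"
  using assms by (simp add: bilinear D_intros sym[of y x] power2_eq_square algebra_simps)

lemma Cauchy_Schwarz:
  assumes "x \<in> D" "y \<in> D"
  shows "(form x y)\<^sup>2 \<le> form x x * form y y"
proof -
  have q: "0 \<le> form x x + 2 * t * form x y + t\<^sup>2 * form y y" for t
    using nonneg[of "x + t *s y"] square_expand[OF assms] assms by (simp add: D_intros)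
  show ?thesis
  proof (cases "form y y = 0")
    case True
    have "form x y = 0"
    proof (rule ccontr)
      assume n: "form x y \<noteq> 0"
      have "2 * (- (form x x + 1) / (2 * form x y)) * form x y = - (form x x + 1)"
        using n by simp
      then show False using q[of "- (form x x + 1) / (2 * form x y)"] True by simp
    qed
    with True show ?thesis by simp
  next
    case False
    with nonneg[OF assms(2)] have p: "form y y > 0" by simp
    have "2 * (- form x y / form y y) * form x y + (- form x y / form y y)\<^sup>2 * form y y
        = - ((form x y)\<^sup>2 / form y y)"
      using p by (simp add: power2_eq_square divide_simps)
    with q[of "- form x y / form y y"] have "(form x y)\<^sup>2 / form y y \<le> form x x" by linarith
    with p show ?thesis by (simp add: pos_divide_le_eq)
  qed
qed

lemma parallelogram:
  assumes "x \<in> D" "y \<in> D"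
  shows "form (x + y) (x + y) + form (x - y) (x - y) = 2 * form x x + 2 * form y y"
  using assms by (simp add: bilinear D_intros)

lemma tendsto_right:
  assumes "\<And>k. v k \<in> D" "w \<in> D" "x \<in> D"
    and lim: "(\<lambda>k. form (v k - w) (v k - w)) \<longlonglongrightarrow> 0"
  shows "(\<lambda>k. form (v k) x) \<longlonglongrightarrow> form w x"
proof -
  have "norm (form (v k - w) x) \<le> sqrt (form (v k - w) (v k - w) * form x x)" for k
  proof -
    have "v k - w \<in> D" using assms(1,2) by (rule D_intros)
    from Cauchy_Schwarz[OF this assms(3)] show ?thesis
      by (simp add: real_le_rsqrt)
  qed
  moreover have "(\<lambda>k. sqrt (form (v k - w) (v k - w) * form x x)) \<longlonglongrightarrow> 0"
    using tendsto_real_sqrt[OF tendsto_mult_right[OF lim, of "form x x"]] by simp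
  ultimately have "(\<lambda>k. form (v k - w) x) \<longlonglongrightarrow> 0"
    by (rule Lim_null_comparison[OF always_eventually[OF allI]])
  moreover have "form (v k - w) x = form (v k) x - form w x" for k
    using assms(1-3) by (simp add: diff_left)
  ultimately show ?thesis by (simp add: LIM_zero_iff)
qed

lemma tendsto_square:
  assumes "\<And>k. v k \<in> D" "w \<in> D"
    and lim: "(\<lambda>k. form (v k - w) (v k - w)) \<longlonglongrightarrow> 0"
  shows "(\<lambda>k. form (v k) (v k)) \<longlonglongrightarrow> form w w"
proof -
  have "form (v k) (v k) = form (v k - w) (v k - w) + 2 * form (v k) w - form w w" for k
    using assms(1,2) by (simp add: bilinear D_intros(2) sym[of w "v k"])
  moreover have "(\<lambda>k. form (v k - w) (v k - w) + 2 * form (v k) w - form w w)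
      \<longlonglongrightarrow> 0 + 2 * form w w - form w w"
    by (intro tendsto_diff tendsto_add lim tendsto_mult_left tendsto_const)
      (rule tendsto_right[OF assms(1,2,2) lim])
  ultimately show ?thesis by simp
qed

end

text \<open>
  Two forms on a common domain: an inner product \<open>ip\<close> and an energy \<open>E\<close>.
\<close>

locale form_pair = vector_space scale + ip: nonneg_form scale D ip + E: nonneg_form scale D E
  for scale :: "real \<Rightarrow> 'a::ab_group_add \<Rightarrow> 'a" (infixr "*s" 75)
    and D :: "'a set" and ip E :: "'a \<Rightarrow> 'a \<Rightarrow> real" +
  assumes ip_pos: "\<lbrakk>x \<in> D; x \<noteq> 0\<rbrakk> \<Longrightarrow> 0 < ip x x"
begin

text \<open>
  The weak eigenvalue equation; the zero vector is not excluded.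
\<close>

definition eigenvector :: "real \<Rightarrow> 'a \<Rightarrow> bool" where
  "eigenvector \<mu> u \<longleftrightarrow> u \<in> D \<and> (\<forall>v\<in>D. E u v = \<mu> * ip u v)"

definition orthonormal :: "'i set \<Rightarrow> ('i \<Rightarrow> 'a) \<Rightarrow> bool" where
  "orthonormal I u \<longleftrightarrow> (\<forall>i\<in>I. u i \<in> D) \<and> (\<forall>i\<in>I. \<forall>j\<in>I. ip (u i) (u j) = of_bool (i = j))"

text \<open>
  The component of \<open>v\<close> orthogonal to the orthonormal family \<open>u\<close>.
\<close>

definition residual :: "'i set \<Rightarrow> ('i \<Rightarrow> 'a) \<Rightarrow> 'a \<Rightarrow> 'a" where
  "residual I u v = v - (\<Sum>i\<in>I. ip v (u i) *s u i)"

lemma orthonormalD: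
  assumes "orthonormal I u"
  shows "i \<in> I \<Longrightarrow> u i \<in> D" "i \<in> I \<Longrightarrow> j \<in> I \<Longrightarrow> ip (u i) (u j) = of_bool (i = j)"
  using assms by (auto simp: orthonormal_def)

lemma residual_in: "orthonormal I u \<Longrightarrow> v \<in> D \<Longrightarrow> residual I u v \<in> D"
  unfolding residual_def by (intro ip.D_intros) (auto dest: orthonormalD)

lemma residual_orthogonal:
  assumes "finite I" "orthonormal I u" "v \<in> D" "j \<in> I"
  shows "ip (residual I u v) (u j) = 0"
proof -
  have "ip (residual I u v) (u j) = ip v (u j) - (\<Sum>i\<in>I. ip v (u i) * ip (u i) (u j))"
    using assms unfolding residual_def
    by (simp add: ip.bilinear ip.D_intros orthonormalD(1)[OF assms(2)])
  also have "(\<Sum>i\<in>I. ip v (u i) * ip (u i) (u j)) = (\<Sum>i\<in>I. if i = j then ip v (u i) else 0)"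
    by (intro sum.cong) (auto simp: orthonormalD(2)[OF assms(2)] assms(4))
  finally show ?thesis using assms by simp
qed

text \<open>
  The orthonormal set \<open>C\<close> is regarded as a family indexed by itself.
\<close>

lemma gram_schmidt:
  assumes "finite B" "independent B" "B \<subseteq> D"
  obtains C where "finite C" "card C = card B" "span C = span B" "orthonormal C id"
proof -
  have "\<exists>C. finite C \<and> card C = card B \<and> span C = span B \<and> orthonormal C id"
    using assms
  proof (induction B)
    case empty
    then show ?case by (intro exI[of _ "{}"]) (auto simp: orthonormal_def)
  next
    case (insert b B)
    have "independent B" "B \<subseteq> D"
      using insert.prems by (auto simp: independent_insert split: if_splits)
    with insert.IH obtain C
      where C: "finite C" "card C = card B" "span C = span B" "orthonormal C id" by blast
    have b: "b \<in> D" "b \<notin> span B"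
      using insert by (auto simp: independent_insert split: if_splits)
    define r where "r = residual C id b"
    have rD: "r \<in> D" using residual_in C b by (auto simp: r_def)
    have S: "(\<Sum>i\<in>C. ip b (id i) *s id i) \<in> span C"
      by (intro span_sum span_scale) (auto intro: span_base)
    have r_notin: "r \<notin> span C"
    proof
      assume "r \<in> span C"
      then have "r + (\<Sum>i\<in>C. ip b (id i) *s id i) \<in> span C" using S by (rule span_add)
      then show False using b C by (simp add: r_def residual_def)
    qed
    then have "r \<noteq> 0" using span_zero by metis
    with rD ip_pos have p: "0 < ip r r" by auto
    define c where "c = inverse (sqrt (ip r r)) *s r"
    have cD: "c \<in> D" unfolding c_def by (intro ip.D_intros rD)
    have c1: "ip c c = 1"
      using p rD by (simp add: c_def ip.bilinear ip.D_intros) (simp add: field_simps)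
    have co: "ip c x = 0" "ip x c = 0" if "x \<in> C" for x
    proof -
      show "ip c x = 0"
        using residual_orthogonal[OF C(1,4) b(1) that] orthonormalD(1)[OF C(4) that] rD
        by (simp add: c_def r_def[symmetric] ip.bilinear)
      then show "ip x c = 0" by (simp add: ip.sym)
    qed
    have "c \<notin> C" using co(1)[of c] c1 by auto
    have "c \<in> span (insert b C)"
    proof -
      have "span C \<subseteq> span (insert b C)" by (intro span_mono) auto
      then show ?thesis unfolding c_def r_def residual_def using S
        by (intro span_scale span_diff) (auto intro: span_base)
    qed
    moreover have "b \<in> span (insert c C)"
    proof -
      have "r = sqrt (ip r r) *s c" using p by (simp add: c_def)
      then have "r \<in> span (insert c C)" by (metis span_scale span_base insertI1)
      moreover have "span C \<subseteq> span (insert c C)" by (intro span_mono) auto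
      ultimately have "r + (\<Sum>i\<in>C. ip b (id i) *s id i) \<in> span (insert c C)"
        using S by (intro span_add) auto
      then show ?thesis by (simp add: r_def residual_def)
    qed
    ultimately have "span (insert c C) = span (insert b C)"
      by (intro subset_antisym span_minimal subspace_span; simp add: subset_iff span_base)
    also have "\<dots> = span (insert b B)"
      by (simp only: span_insert C(3))
    finally have "span (insert c C) = span (insert b B)" .
    moreover have "orthonormal (insert c C) id"
      using C(4) cD c1 co \<open>c \<notin> C\<close> unfolding orthonormal_def id_apply ball_simps by fastforce
    moreover have "finite (insert c C)" "card (insert c C) = card (insert b B)"
      using C(1,2) \<open>c \<notin> C\<close> insert.hyps by simp_all
    ultimately show ?case by blast
  qed
  then show ?thesis by (elim exE conjE) (rule that)
qed

lemma eigenvectors_orthogonal: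
  assumes "eigenvector \<mu> u" "eigenvector \<nu> v" "\<mu> \<noteq> \<nu>"
  shows "ip u v = 0"
proof -
  have "\<mu> * ip u v = \<nu> * ip u v"
    using assms E.sym[of u v] ip.sym[of u v] by (auto simp: eigenvector_def)
  with assms show ?thesis by simp
qed

text \<open>
  If each \<open>\<mu>\<close> occurs in the list \<open>ev\<close> as often as the dimension of its eigenspace, then the list is
  realised by an orthonormal family of eigenvectors. The last property says that within each
  eigenspace the family is maximal.
\<close>

lemma orthonormal_eigenvectors:
  fixes ev :: "'i \<Rightarrow> real"
  assumes fin: "\<And>\<mu>. finite {j\<in>J. ev j = \<mu>}"
    and basis: "\<And>\<mu>. \<exists>B. finite B \<and> independent B \<and> span B = {u. eigenvector \<mu> u} \<and>
      card B = card {j\<in>J. ev j = \<mu>}"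
  obtains u where "orthonormal J u" "\<And>j. j \<in> J \<Longrightarrow> eigenvector (ev j) (u j)"
    "\<And>\<mu> w. eigenvector \<mu> w \<Longrightarrow> (\<And>j. j \<in> J \<Longrightarrow> ev j = \<mu> \<Longrightarrow> ip w (u j) = 0) \<Longrightarrow> w = 0"
proof -
  have "\<forall>\<mu>. \<exists>C h. orthonormal C id \<and> finite C \<and> span C = {u. eigenvector \<mu> u} \<and>
      bij_betw h {j\<in>J. ev j = \<mu>} C"
  proof
    fix \<mu>
    obtain B where B: "finite B" "independent B" "span B = {u. eigenvector \<mu> u}"
      "card B = card {j\<in>J. ev j = \<mu>}"
      using basis by blast
    have BD: "B \<subseteq> D"
    proof
      fix x assume "x \<in> B"
      then have "x \<in> span B" by (rule span_base)
      then show "x \<in> D" unfolding B(3) by (simp add: eigenvector_def)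
    qed
    obtain C where C: "finite C" "card C = card B" "span C = span B" "orthonormal C id"
      by (rule gram_schmidt[OF B(1,2) BD])
    obtain h where "bij_betw h {j\<in>J. ev j = \<mu>} C"
      using finite_same_card_bij[OF fin C(1)] C(2) B(4) by auto
    moreover have "span C = {u. eigenvector \<mu> u}" using C(3) B(3) by (rule trans)
    ultimately show "\<exists>C h. orthonormal C id \<and> finite C \<and> span C = {u. eigenvector \<mu> u} \<and>
      bij_betw h {j\<in>J. ev j = \<mu>} C" using C(1,4) by blast
  qed
  from choice[OF this] obtain C where "\<forall>\<mu>. \<exists>h. orthonormal (C \<mu>) id \<and> finite (C \<mu>) \<and>
      span (C \<mu>) = {u. eigenvector \<mu> u} \<and> bij_betw h {j\<in>J. ev j = \<mu>} (C \<mu>)" ..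
  from choice[OF this] obtain h where "\<forall>\<mu>. orthonormal (C \<mu>) id \<and> finite (C \<mu>) \<and>
      span (C \<mu>) = {u. eigenvector \<mu> u} \<and> bij_betw (h \<mu>) {j\<in>J. ev j = \<mu>} (C \<mu>)" ..
  then have C: "\<And>\<mu>. orthonormal (C \<mu>) id" "\<And>\<mu>. finite (C \<mu>)"
      "\<And>\<mu>. span (C \<mu>) = {u. eigenvector \<mu> u}"
    and h: "\<And>\<mu>. bij_betw (h \<mu>) {j\<in>J. ev j = \<mu>} (C \<mu>)"
    by blast+
  define u where "u = (\<lambda>j. h (ev j) j)"
  have uC: "u j \<in> C (ev j)" if "j \<in> J" for j
    using h[of "ev j"] that by (auto simp: u_def bij_betw_def)
  have ue: "eigenvector (ev j) (u j)" if "j \<in> J" for j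
    using uC[OF that] C(3) span_base by blast
  have uo: "ip (u i) (u j) = of_bool (i = j)" if "i \<in> J" "j \<in> J" for i j
  proof (cases "ev i = ev j")
    case True
    have "u i = u j \<longleftrightarrow> i = j"
      using h[of "ev j"] that True by (auto simp: u_def bij_betw_def inj_on_def)
    then show ?thesis using orthonormalD(2)[OF C(1)] uC[OF that(1)] uC[OF that(2)] True by force
  next
    case False
    then show ?thesis using eigenvectors_orthogonal ue that by force
  qed
  have "w = 0" if w: "eigenvector \<mu> w" and o: "\<And>j. j \<in> J \<Longrightarrow> ev j = \<mu> \<Longrightarrow> ip w (u j) = 0" for \<mu> w
  proof -
    have oC: "ip w c = 0" if c: "c \<in> C \<mu>" for c
    proof -
      obtain j where "j \<in> J" "ev j = \<mu>" "c = h \<mu> j"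
        using c h[of \<mu>] by (auto simp: bij_betw_def)
      then show ?thesis using o[of j] by (auto simp: u_def)
    qed
    have CD: "c \<in> D" if "c \<in> C \<mu>" for c using orthonormalD(1)[OF C(1) that] by simp
    have wD: "w \<in> D" using w by (simp add: eigenvector_def)
    have "w \<in> span (C \<mu>)" unfolding C(3) using w by simp
    then obtain a where a: "w = (\<Sum>c\<in>C \<mu>. a c *s c)"
      unfolding span_finite[OF C(2)] by blast
    have "ip w w = ip w (\<Sum>c\<in>C \<mu>. a c *s c)" by (rule arg_cong[OF a])
    also have "\<dots> = (\<Sum>c\<in>C \<mu>. a c * ip w c)"
      using CD wD by (simp add: ip.sum_right ip.scale_right ip.D_intros(3))
    also have "\<dots> = 0" using oC by simp
    finally show ?thesis using ip_pos[OF wD] by (cases "w = 0") simp_all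
  qed
  moreover have "orthonormal J u"
    using ue uo unfolding orthonormal_def eigenvector_def by blast
  ultimately show ?thesis using ue by (intro that) blast+
qed

lemma residual_decomp: "v = residual I u v + (\<Sum>i\<in>I. ip v (u i) *s u i)"
  by (simp add: residual_def)

text \<open>
  The estimate for a single eigenvector with eigenvalue \<open>l\<close>, where \<open>m\<close> stands for the product of the
  multiplier with it. The linear functional \<open>v \<mapsto> l * ip m v - E m v\<close> is assumed to be bounded with
  respect to \<open>ip\<close>.
\<close>

lemma commutator_bound:
  assumes I: "finite I" "orthonormal I u" "\<And>i. i \<in> I \<Longrightarrow> eigenvector (lam i) (u i)"
    and bound: "\<And>v. v \<in> D \<Longrightarrow> (\<And>i. i \<in> I \<Longrightarrow> ip v (u i) = 0) \<Longrightarrow> z * ip v v \<le> E v v"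
    and M: "m \<in> D"
    and bd: "\<And>v. v \<in> D \<Longrightarrow> (l * ip m v - E m v)\<^sup>2 \<le> 4 * Q * ip v v"
    and l: "l < z" and Q: "0 \<le> Q"
  defines "a \<equiv> \<lambda>j. ip m (u j)"
  shows "(z - l) * (E m m - l * ip m m + (\<Sum>j\<in>I. (l - lam j) * (a j)\<^sup>2))
    + (\<Sum>j\<in>I. (l - lam j)\<^sup>2 * (a j)\<^sup>2) \<le> 4 * Q"
proof -
  have uD: "u i \<in> D" if "i \<in> I" for i using orthonormalD(1)[OF I(2) that] .
  define R where "R = (\<lambda>v. l * ip m v - E m v)"
  define f where "f = residual I u m"
  have fD: "f \<in> D" unfolding f_def by (rule residual_in[OF I(2) M])
  have f_orth: "ip f (u i) = 0" if "i \<in> I" for i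
    unfolding f_def by (rule residual_orthogonal[OF I(1,2) M that])
  have E_u: "E (u i) v = lam i * ip (u i) v" if "i \<in> I" "v \<in> D" for i v
    using I(3)[OF that(1)] that(2) by (simp add: eigenvector_def)
  have m: "m = f + (\<Sum>i\<in>I. a i *s u i)"
    unfolding f_def a_def by (rule residual_decomp)
  have sD: "(\<Sum>i\<in>I. c i *s u i) \<in> D" for c
    by (intro ip.D_intros(5) ip.D_intros(3) uD)
  have ip_sum: "ip (\<Sum>i\<in>I. c i *s u i) v = (\<Sum>i\<in>I. c i * ip (u i) v)" if "v \<in> D" for c v
    using that uD by (simp add: ip.sum_left ip.scale_left ip.D_intros(3))
  have E_sum: "E (\<Sum>i\<in>I. c i *s u i) v = (\<Sum>i\<in>I. c i * (lam i * ip (u i) v))" if "v \<in> D" for c v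
    using that uD by (simp add: E.sum_left E.scale_left E.D_intros(3) E_u)
  have f_orth': "ip (u i) f = 0" if "i \<in> I" for i
    using f_orth[OF that] ip.sym[of f "u i"] by simp
  have ip_mf: "ip m f = ip f f"
    by (subst m) (simp add: ip.add_left[OF fD sD fD] ip_sum[OF fD] f_orth')
  have E_mf: "E m f = E f f"
    by (subst m) (simp add: E.add_left[OF fD sD fD] E_sum[OF fD] f_orth')
  have R_u: "R (u i) = (l - lam i) * a i" if "i \<in> I" for i
    using E_u[OF that M] ip.sym[of m "u i"] E.sym[of m "u i"]
    by (simp add: R_def a_def left_diff_distrib)
  have R_add: "R (x + y) = R x + R y" if "x \<in> D" "y \<in> D" for x y
    using that M by (simp add: R_def ip.add_right E.add_right algebra_simps)
  have R_scale: "R (c *s x) = c * R x" if "x \<in> D" for c x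
    using that M by (simp add: R_def ip.scale_right E.scale_right algebra_simps)
  have R_sum: "R (\<Sum>i\<in>I. c i *s u i) = (\<Sum>i\<in>I. c i * R (u i))" for c
    using M uD by (simp add: R_def ip.sum_right E.sum_right ip.scale_right E.scale_right
        ip.D_intros(3) sum_distrib_left sum_subtractf algebra_simps)
  define S where "S = (\<Sum>j\<in>I. (l - lam j)\<^sup>2 * (a j)\<^sup>2)"
  define T where "T = E f f - l * ip f f"
  have RT: "R f = - T" by (simp add: R_def T_def ip_mf E_mf)
  have R_sq: "(\<Sum>i\<in>I. a i * R (u i)) = (\<Sum>i\<in>I. (l - lam i) * (a i)\<^sup>2)"
    by (intro sum.cong refl) (simp add: R_u power2_eq_square)
  have "R m = R f + (\<Sum>i\<in>I. a i * R (u i))"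
    by (subst m) (simp add: R_add[OF fD sD] R_sum)
  then have T_eq: "T = E m m - l * ip m m + (\<Sum>j\<in>I. (l - lam j) * (a j)\<^sup>2)"
    unfolding RT R_sq by (simp add: R_def)
  define N where "N = ip f f"
  have N0: "0 \<le> N" unfolding N_def by (rule ip.nonneg[OF fD])
  have TN: "(z - l) * N \<le> T"
    using bound[OF fD f_orth] by (simp add: T_def N_def left_diff_distrib)
  have S0: "0 \<le> S" unfolding S_def by (intro sum_nonneg) simp
  \<comment> \<open>The bound on \<open>R\<close> is applied to \<open>s f\<close> plus the sum of all \<open>R (u i) u i\<close>; the optimal \<open>s\<close> is \<open>- T / N\<close>.\<close>
  have key: "(- s * T + S)\<^sup>2 \<le> 4 * Q * (s\<^sup>2 * N + S)" for s
  proof -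
    let ?b = "\<lambda>i. (l - lam i) * a i"
    let ?w = "\<Sum>i\<in>I. ?b i *s u i"
    have wu: "ip ?w (u j) = ?b j" if "j \<in> I" for j
    proof -
      have "ip ?w (u j) = (\<Sum>i\<in>I. if i = j then ?b i else 0)"
        unfolding ip_sum[OF uD[OF that]]
        by (intro sum.cong) (simp_all add: orthonormalD(2)[OF I(2) _ that])
      also have "\<dots> = ?b j" using that I(1) by simp
      finally show ?thesis .
    qed
    have "ip ?w ?w = (\<Sum>i\<in>I. ?b i * ip (u i) ?w)" by (rule ip_sum[OF sD])
    also have "\<dots> = (\<Sum>i\<in>I. ?b i * ?b i)"
      using wu by (intro sum.cong refl) (simp add: ip.sym[of "u _" ?w])
    finally have ww: "ip ?w ?w = S" by (simp add: S_def power2_eq_square ac_simps)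
    have wf: "ip ?w f = 0" unfolding ip_sum[OF fD] using f_orth' by simp
    have "ip (?w + s *s f) (?w + s *s f) = s\<^sup>2 * N + S"
      using ip.square_expand[OF sD fD, of ?b s] by (simp add: ww wf N_def)
    moreover have "R (?w + s *s f) = - s * T + S"
    proof -
      have "R ?w = (\<Sum>i\<in>I. ?b i * ?b i)"
        unfolding R_sum by (intro sum.cong refl) (simp add: R_u)
      also have "\<dots> = S" by (simp add: S_def power2_eq_square ac_simps)
      finally show ?thesis by (simp add: R_add[OF sD ip.D_intros(3)[OF fD]] R_scale[OF fD] RT)
    qed
    moreover have "(R (?w + s *s f))\<^sup>2 \<le> 4 * Q * ip (?w + s *s f) (?w + s *s f)"
      unfolding R_def by (rule bd[OF ip.D_intros(1)[OF sD ip.D_intros(3)[OF fD]]])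
    ultimately show ?thesis by (simp only:)
  qed
  have cancel: "x \<le> 4 * Q" if sq: "x\<^sup>2 \<le> 4 * Q * x" "0 \<le> x" for x
  proof (cases "x = 0")
    case False
    with sq(2) have "0 < x" by simp
    moreover have "x * x \<le> (4 * Q) * x" using sq(1) by (simp only: power2_eq_square)
    ultimately show ?thesis by (simp only: mult_le_cancel_right_pos)
  qed (use Q in simp)
  have "(z - l) * T + S \<le> 4 * Q"
  proof (cases "N = 0")
    case True
    then have "f = 0" using ip_pos[OF fD] by (auto simp: N_def)
    then have "T = 0" using ip.zero_left[OF fD] E.zero_left[OF fD] by (simp add: T_def)
    then show ?thesis using key[of 0] cancel[of S] S0 by simp
  next
    case False
    with N0 have p: "0 < N" by simp
    define x where "x = T\<^sup>2 / N + S"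
    have "- (- T / N) * T + S = x" by (simp add: x_def power2_eq_square)
    moreover have "(- T / N)\<^sup>2 * N + S = x"
      using False by (simp add: x_def power_divide power2_eq_square)
    ultimately have "x\<^sup>2 \<le> 4 * Q * x" using key[of "- T / N"] by (simp only:)
    moreover have "0 \<le> x" using p S0 by (simp add: x_def)
    ultimately have "x \<le> 4 * Q" by (rule cancel)
    moreover have "(z - l) * T \<le> T\<^sup>2 / N"
    proof -
      have "0 \<le> (z - l) * N" using p l by (intro mult_nonneg_nonneg) simp_all
      then have "0 \<le> T" using TN by (rule order_trans)
      then have "((z - l) * N) * T \<le> T * T" using TN by (intro mult_right_mono)
      then show ?thesis using p by (simp add: pos_le_divide_eq[OF p] power2_eq_square mult.commute mult.left_commute)
    qed
    ultimately show ?thesis by (simp add: x_def)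
  qed
  then show ?thesis unfolding T_eq S_def .
qed

text \<open>
  Multiplying \<open>commutator_bound\<close> for each \<open>i\<close> by \<open>z - lam i\<close> and summing, the terms with matrix elements
  \<open>ip (m i) (u j)\<close> combine to the antisymmetric expression \<open>g i j\<close> and disappear.
\<close>

lemma abstract_Yang_inequality:
  assumes I: "finite I" "orthonormal I u" "\<And>i. i \<in> I \<Longrightarrow> eigenvector (lam i) (u i)"
    and bound: "\<And>v. v \<in> D \<Longrightarrow> (\<And>i. i \<in> I \<Longrightarrow> ip v (u i) = 0) \<Longrightarrow> z * ip v v \<le> E v v"
    and lt: "\<And>i. i \<in> I \<Longrightarrow> lam i < z"
    and M: "\<And>i. i \<in> I \<Longrightarrow> m i \<in> D"
    and Msym: "\<And>i j. i \<in> I \<Longrightarrow> j \<in> I \<Longrightarrow> ip (m i) (u j) = ip (m j) (u i)"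
    and bd: "\<And>i v. i \<in> I \<Longrightarrow> v \<in> D \<Longrightarrow> (lam i * ip (m i) v - E (m i) v)\<^sup>2 \<le> 4 * Q i * ip v v"
    and Q: "\<And>i. i \<in> I \<Longrightarrow> 0 \<le> Q i"
  shows "(\<Sum>i\<in>I. (z - lam i)\<^sup>2 * (E (m i) (m i) - lam i * ip (m i) (m i)))
    \<le> 4 * (\<Sum>i\<in>I. (z - lam i) * Q i)"
proof -
  define a where "a = (\<lambda>i j. ip (m i) (u j))"
  define p where "p = (\<lambda>i. E (m i) (m i) - lam i * ip (m i) (m i))"
  define g where "g = (\<lambda>i j. (z - lam i) * (z - lam j) * (lam i - lam j) * (a i j)\<^sup>2)"
  have weighted: "(z - lam i)\<^sup>2 * p i + (\<Sum>j\<in>I. g i j) \<le> 4 * ((z - lam i) * Q i)" if i: "i \<in> I" for i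
  proof -
    have "(z - lam i) * (p i + (\<Sum>j\<in>I. (lam i - lam j) * (a i j)\<^sup>2))
        + (\<Sum>j\<in>I. (lam i - lam j)\<^sup>2 * (a i j)\<^sup>2) \<le> 4 * Q i"
      unfolding p_def a_def
      by (rule commutator_bound[OF I bound M[OF i] bd[OF i] lt[OF i] Q[OF i]])
    then have "(z - lam i) * ((z - lam i) * (p i + (\<Sum>j\<in>I. (lam i - lam j) * (a i j)\<^sup>2))
        + (\<Sum>j\<in>I. (lam i - lam j)\<^sup>2 * (a i j)\<^sup>2)) \<le> (z - lam i) * (4 * Q i)"
      using lt[OF i] by (intro mult_left_mono) auto
    moreover have "(\<Sum>j\<in>I. g i j) = (z - lam i) * ((z - lam i) * (\<Sum>j\<in>I. (lam i - lam j) * (a i j)\<^sup>2)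
        + (\<Sum>j\<in>I. (lam i - lam j)\<^sup>2 * (a i j)\<^sup>2))"
      unfolding sum_distrib_left sum.distrib[symmetric] g_def
      by (intro sum.cong refl) (simp add: power2_eq_square algebra_simps)
    ultimately show ?thesis by (simp add: power2_eq_square algebra_simps)
  qed
  have "(\<Sum>i\<in>I. \<Sum>j\<in>I. g i j) = 0"
  proof (intro antisymmetric_double_sum)
    fix i j assume "i \<in> I" "j \<in> I"
    then have "a j i = a i j" unfolding a_def by (intro Msym)
    then show "g i j = - g j i" unfolding g_def by (simp add: algebra_simps)
  qed
  moreover have "(\<Sum>i\<in>I. (z - lam i)\<^sup>2 * p i + (\<Sum>j\<in>I. g i j)) \<le> (\<Sum>i\<in>I. 4 * ((z - lam i) * Q i))"
    by (intro sum_mono weighted)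
  ultimately show ?thesis by (simp add: sum.distrib sum_distrib_left p_def)
qed

end

text \<open>
  The domain is complete in the norm given by \<open>ip + E\<close>, and embeds compactly into its completion
  with respect to \<open>ip\<close>.
\<close>

locale compact_form_pair = form_pair +
  assumes compact: "\<lbrakk>\<And>k. v k \<in> D; \<And>k. ip (v k) (v k) \<le> C; \<And>k. E (v k) (v k) \<le> C\<rbrakk> \<Longrightarrow>
      \<exists>r::nat \<Rightarrow> nat. strict_mono r \<and> (\<forall>e>0. \<exists>N. \<forall>k\<ge>N. \<forall>l\<ge>N.
        ip (v (r k) - v (r l)) (v (r k) - v (r l)) < e)"
    and complete: "\<lbrakk>\<And>k. v k \<in> D;
      \<And>e. 0 < e \<Longrightarrow> \<exists>N. \<forall>k\<ge>N. \<forall>l\<ge>N. ip (v k - v l) (v k - v l) < e;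
      \<And>e. 0 < e \<Longrightarrow> \<exists>N. \<forall>k\<ge>N. \<forall>l\<ge>N. E (v k - v l) (v k - v l) < e\<rbrakk> \<Longrightarrow>
      \<exists>w\<in>D. (\<lambda>k::nat. ip (v k - w) (v k - w)) \<longlonglongrightarrow> 0 \<and> (\<lambda>k. E (v k - w) (v k - w)) \<longlonglongrightarrow> 0"
begin

lemma minimiser_exists:
  assumes V: "subspace V" "V \<subseteq> D"
    and closed: "\<And>v w. (\<And>k::nat. v k \<in> V) \<Longrightarrow> w \<in> D \<Longrightarrow> (\<lambda>k. ip (v k - w) (v k - w)) \<longlonglongrightarrow> 0 \<Longrightarrow> w \<in> V"
    and lower: "\<And>v. v \<in> V \<Longrightarrow> m * ip v v \<le> E v v"
    and m: "0 \<le> m"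
    and seq: "\<And>k. x k \<in> V" "\<And>k. ip (x k) (x k) = 1" "\<And>k. E (x k) (x k) < m + 1 / Suc k"
  obtains w where "w \<in> V" "ip w w = 1" "E w w = m"
proof -
  have xD: "x k \<in> D" for k using seq(1) V(2) by blast
  have "E (x k) (x k) \<le> m + 1" for k
  proof -
    have "(1::real) / Suc k \<le> 1" by simp
    with seq(3)[of k] show ?thesis by linarith
  qed
  moreover have "ip (x k) (x k) \<le> m + 1" for k using seq(2) m by simp
  ultimately obtain r :: "nat \<Rightarrow> nat" where r: "strict_mono r" and
    cip: "\<forall>e>0. \<exists>N. \<forall>k\<ge>N. \<forall>l\<ge>N. ip (x (r k) - x (r l)) (x (r k) - x (r l)) < e"
    using compact[of x "m + 1", OF xD] by blast
  define y where "y = (\<lambda>k. x (r k))"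
  have yV: "y k \<in> V" and yD: "y k \<in> D" and y1: "ip (y k) (y k) = 1" for k
    unfolding y_def by (rule seq(1), rule xD, rule seq(2))
  have yE: "E (y k) (y k) < m + 1 / Suc k" for k
  proof -
    have "k \<le> r k" using r by (rule strict_mono_imp_increasing)
    then have "(1::real) / Suc (r k) \<le> 1 / Suc k" by (intro divide_left_mono) simp_all
    with seq(3)[of "r k"] show ?thesis unfolding y_def by linarith
  qed
  \<comment> \<open>The parallelogram identity turns convergence with respect to \<open>ip\<close> into convergence with respect to \<open>E\<close>.\<close>
  have diff: "E (y k - y l) (y k - y l) \<le> 2 / Suc k + 2 / Suc l + m * ip (y k - y l) (y k - y l)" for k l
  proof -
    have "m * ip (y k + y l) (y k + y l) \<le> E (y k + y l) (y k + y l)"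
      by (intro lower subspace_add V(1) yV)
    moreover have "ip (y k + y l) (y k + y l) = 4 - ip (y k - y l) (y k - y l)"
      using ip.parallelogram[OF yD yD, of k l] y1 by simp
    ultimately have "4 * m - m * ip (y k - y l) (y k - y l) \<le> E (y k + y l) (y k + y l)"
      by (simp add: right_diff_distrib)
    then show ?thesis using E.parallelogram[OF yD yD, of k l] yE[of k] yE[of l] by simp
  qed
  have cip': "\<exists>N. \<forall>k\<ge>N. \<forall>l\<ge>N. ip (y k - y l) (y k - y l) < e" if "0 < e" for e
    using cip that unfolding y_def by blast
  have cE: "\<exists>N. \<forall>k\<ge>N. \<forall>l\<ge>N. E (y k - y l) (y k - y l) < e" if e: "0 < e" for e
  proof -
    obtain N where N: "\<And>k l. N \<le> k \<Longrightarrow> N \<le> l \<Longrightarrow> ip (y k - y l) (y k - y l) < e / (2 * (m + 1))"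
      using cip'[of "e / (2 * (m + 1))"] e m by auto
    obtain n where n: "8 / e < real n" using reals_Archimedean2 by blast
    have "E (y k - y l) (y k - y l) < e" if kl: "max N n \<le> k" "max N n \<le> l" for k l
    proof -
      have small: "2 / real (Suc j) < e / 4" if "n \<le> j" for j
      proof -
        have "8 / e < real (Suc j)" using n that by linarith
        then have "8 < real (Suc j) * e" using e by (simp only: pos_divide_less_eq)
        then have "2 < (e / 4) * real (Suc j)" by (simp add: mult.commute)
        then show ?thesis by (subst pos_divide_less_eq) simp_all
      qed
      have "ip (y k - y l) (y k - y l) < e / (2 * (m + 1))" using N kl by simp
      then have "m * ip (y k - y l) (y k - y l) \<le> m * (e / (2 * (m + 1)))"
        using m by (intro mult_left_mono) simp_all
      also have "\<dots> \<le> e / 2" using m e by (simp add: field_simps)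
      finally show ?thesis using diff[of k l] small[of k] small[of l] kl by simp
    qed
    then show ?thesis by blast
  qed
  obtain w where w: "w \<in> D" "(\<lambda>k. ip (y k - w) (y k - w)) \<longlonglongrightarrow> 0" "(\<lambda>k. E (y k - w) (y k - w)) \<longlonglongrightarrow> 0"
    using complete[OF yD cip' cE] by blast
  have "w \<in> V" using closed[OF yV w(1,2)] .
  moreover have ip1: "ip w w = 1"
    using ip.tendsto_square[OF yD w(1,2)] unfolding y1 by (rule LIMSEQ_unique[OF _ tendsto_const])
  moreover have "E w w = m"
  proof (rule antisym)
    have "(\<lambda>k. m + 1 / real (Suc k)) \<longlonglongrightarrow> m + 0"
      by (intro tendsto_add tendsto_const LIMSEQ_Suc[OF lim_1_over_n])
    then show "E w w \<le> m"
      using LIMSEQ_le[OF E.tendsto_square[OF yD w(1,3)]] yE by (simp add: less_imp_le)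
    show "m \<le> E w w" using lower[OF \<open>w \<in> V\<close>] ip1 by simp
  qed
  ultimately show ?thesis by (rule that)
qed

text \<open>
  A minimiser of the Rayleigh quotient on the orthogonal complement of the \<open>u i\<close> is an eigenvector; if
  its eigenvalue were below \<open>\<mu>0\<close>, it would be zero by the maximality of the family.
\<close>

lemma Rayleigh_lower_bound:
  assumes I: "finite I" "orthonormal I u" "\<And>i. i \<in> I \<Longrightarrow> eigenvector (lam i) (u i)"
    and maximal: "\<And>\<mu> w. \<mu> < \<mu>0 \<Longrightarrow> eigenvector \<mu> w \<Longrightarrow> (\<And>i. i \<in> I \<Longrightarrow> ip w (u i) = 0) \<Longrightarrow> w = 0"
    and v: "v \<in> D" "\<And>i. i \<in> I \<Longrightarrow> ip v (u i) = 0"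
  shows "\<mu>0 * ip v v \<le> E v v"
proof (rule ccontr)
  assume neg: "\<not> \<mu>0 * ip v v \<le> E v v"
  have uD: "u i \<in> D" if "i \<in> I" for i using orthonormalD(1)[OF I(2) that] .
  define V where "V = {v \<in> D. \<forall>i\<in>I. ip v (u i) = 0}"
  have V: "subspace V" "V \<subseteq> D"
    unfolding V_def subspace_def
    by (auto simp: ip.D_intros ip.zero_left ip.add_left ip.scale_left uD)
  have v0: "v \<noteq> 0"
  proof
    assume "v = 0"
    then show False using neg ip.zero_left[OF v(1)] E.zero_left[OF v(1)] by simp
  qed
  have vV: "v \<in> V" unfolding V_def using v by simp
  define X where "X = {E y y | y. y \<in> V \<and> ip y y = 1}"
  define m where "m = Inf X"
  have normalise: "E y y / ip y y \<in> X" if "y \<in> V" "y \<noteq> 0" for y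
  proof -
    have yD: "y \<in> D" using that V by blast
    have p: "0 < ip y y" using ip_pos[OF yD that(2)] .
    let ?c = "inverse (sqrt (ip y y))"
    have c: "?c * ?c = inverse (ip y y)"
      using p by (simp only: inverse_mult_distrib[symmetric]) simp
    have "ip (?c *s y) (?c *s y) = (?c * ?c) * ip y y" "E (?c *s y) (?c *s y) = (?c * ?c) * E y y"
      by (simp_all only: ip.scale_left ip.scale_right E.scale_left E.scale_right yD ip.D_intros(3) mult.assoc)
    then have "ip (?c *s y) (?c *s y) = 1" "E (?c *s y) (?c *s y) = E y y / ip y y"
      unfolding c using p by (simp_all add: divide_inverse)
    moreover have "?c *s y \<in> V" by (intro subspace_scale V that)
    ultimately show ?thesis unfolding X_def by force
  qed
  have X_nonneg: "0 \<le> x" if "x \<in> X" for x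
    using that V(2) E.nonneg unfolding X_def by blast
  have X_ne: "X \<noteq> {}" using normalise[OF vV v0] by blast
  have X_bdd: "bdd_below X" using X_nonneg by (rule bdd_belowI)
  have m0: "0 \<le> m" unfolding m_def using X_ne X_nonneg by (rule cInf_greatest)
  have lower: "m * ip y y \<le> E y y" if "y \<in> V" for y
  proof (cases "y = 0")
    case True
    then show ?thesis
      using ip.zero_left[OF ip.D_intros(4)] E.zero_left[OF ip.D_intros(4)] by simp
  next
    case False
    from normalise[OF that False] X_bdd have "m \<le> E y y / ip y y"
      unfolding m_def by (rule cInf_lower)
    moreover have "0 < ip y y" using subsetD[OF V(2) that] False by (rule ip_pos)
    ultimately show ?thesis by (simp only: pos_le_divide_eq)
  qed
  have "m < \<mu>0"
  proof -
    have "m * ip v v < \<mu>0 * ip v v" using lower[OF vV] neg by simp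
    then show ?thesis using ip_pos[OF v(1) v0] by (simp only: mult_less_cancel_right_pos)
  qed
  have "\<exists>y. y \<in> V \<and> ip y y = 1 \<and> E y y < m + 1 / Suc k" for k
  proof -
    have "Inf X < m + 1 / Suc k" unfolding m_def by simp
    then obtain x where "x \<in> X" "x < m + 1 / Suc k"
      unfolding cInf_less_iff[OF X_ne X_bdd] by blast
    then show ?thesis unfolding X_def by blast
  qed
  then have "\<forall>k. \<exists>y. y \<in> V \<and> ip y y = 1 \<and> E y y < m + 1 / Suc k" ..
  from choice[OF this] obtain x where x: "\<And>k. x k \<in> V" "\<And>k. ip (x k) (x k) = 1" "\<And>k. E (x k) (x k) < m + 1 / Suc k"
    by blast
  have closed: "w \<in> V" if y: "\<And>k. y k \<in> V" "w \<in> D" "(\<lambda>k. ip (y k - w) (y k - w)) \<longlonglongrightarrow> 0"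
    for w and y :: "nat \<Rightarrow> 'a"
  proof -
    have "ip w (u i) = 0" if i: "i \<in> I" for i
    proof (rule LIMSEQ_unique)
      show "(\<lambda>k. ip (y k) (u i)) \<longlonglongrightarrow> ip w (u i)"
        using subsetD[OF V(2) y(1)] y(2) uD[OF i] y(3) by (rule ip.tendsto_right)
      have "ip (y k) (u i) = 0" for k using y(1) i unfolding V_def by blast
      then show "(\<lambda>k. ip (y k) (u i)) \<longlonglongrightarrow> 0" by simp
    qed
    then show ?thesis using y(2) unfolding V_def by simp
  qed
  obtain w where w: "w \<in> V" "ip w w = 1" "E w w = m"
    by (rule minimiser_exists[OF V closed lower m0 x])
  have wD: "w \<in> D" using w V by blast
  \<comment> \<open>The first variation of the Rayleigh quotient vanishes at \<open>w\<close> in the directions of \<open>V\<close>.\<close>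
  have crit: "E w y = m * ip w y" if y: "y \<in> V" for y
  proof -
    have yD: "y \<in> D" using y V by blast
    define b where "b = E w y - m * ip w y"
    define c where "c = E y y - m * ip y y"
    have c0: "0 \<le> c" unfolding c_def using lower[OF y] by simp
    have q: "0 \<le> 2 * t * b + t\<^sup>2 * c" for t
    proof -
      have "w + t *s y \<in> V" by (intro subspace_add subspace_scale V w y)
      from lower[OF this] show ?thesis
        unfolding ip.square_expand[OF wD yD] E.square_expand[OF wD yD] w b_def c_def
        by (simp add: algebra_simps)
    qed
    have "b = 0"
    proof (rule ccontr)
      assume "b \<noteq> 0"
      define t where "t = - b / (c + 1)"
      have t: "t * (c + 1) = - b" unfolding t_def using c0 by simp
      have "2 * t * b + t\<^sup>2 * c = t * (2 * b + t * (c + 1)) - t\<^sup>2"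
        by (simp add: power2_eq_square algebra_simps)
      also have "\<dots> = t * b - t\<^sup>2" unfolding t by simp
      also have "t * b = - (t\<^sup>2 * (c + 1))" using t by (simp add: power2_eq_square) (simp add: algebra_simps)
      finally have "2 * t * b + t\<^sup>2 * c = - (t\<^sup>2 * (c + 2))" by (simp add: algebra_simps)
      moreover have "0 < t\<^sup>2 * (c + 2)" using \<open>b \<noteq> 0\<close> c0 unfolding t_def by (intro mult_pos_pos) simp_all
      ultimately show False using q[of t] by simp
    qed
    then show ?thesis by (simp add: b_def)
  qed
  have wu: "ip (u i) w = 0" if "i \<in> I" for i
    using w(1) that ip.sym[of "u i" w] unfolding V_def by simp
  have "eigenvector m w"
    unfolding eigenvector_def
  proof (intro conjI ballI wD)
    fix y assume y: "y \<in> D"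
    let ?s = "\<Sum>i\<in>I. ip y (u i) *s u i"
    have rV: "residual I u y \<in> V"
      unfolding V_def using residual_in[OF I(2) y] residual_orthogonal[OF I(1,2) y] by simp
    then have rD: "residual I u y \<in> D" using V by blast
    have sD: "?s \<in> D" by (intro ip.D_intros(5) ip.D_intros(3) uD)
    have "E (u i) w = 0" if "i \<in> I" for i
      using I(3)[OF that] wD wu[OF that] by (simp add: eigenvector_def)
    then have "E ?s w = 0"
      using uD wD by (simp add: E.sum_left E.scale_left E.D_intros(3))
    moreover have "ip ?s w = 0"
      using uD wD wu by (simp add: ip.sum_left ip.scale_left ip.D_intros(3))
    moreover have "E (residual I u y) w = m * ip (residual I u y) w"
      using crit[OF rV] by (simp only: E.sym[of "residual I u y" w] ip.sym[of "residual I u y" w])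
    ultimately have "E (residual I u y + ?s) w = m * ip (residual I u y + ?s) w"
      by (simp add: E.add_left[OF rD sD wD] ip.add_left[OF rD sD wD])
    then have "E y w = m * ip y w" by (simp only: residual_decomp[symmetric])
    then show "E w y = m * ip w y" by (simp only: E.sym[of w y] ip.sym[of w y])
  qed
  moreover have "ip w (u i) = 0" if "i \<in> I" for i
    using w(1) that unfolding V_def by blast
  ultimately have "w = 0" by (rule maximal[OF \<open>m < \<mu>0\<close>])
  then show False using w(2) ip.zero_left[OF wD] by simp
qed

end


section \<open>Balanced planar maps of metric trees\<close>

text \<open>
  Reversal of an oriented edge.
\<close>

definition flip :: "'e \<times> bool \<Rightarrow> 'e \<times> bool" where
  "flip x = (fst x, \<not> snd x)"

lemma flip_simps [simp]:
  "flip (flip x) = x" "fst (flip x) = fst x" "flip x \<noteq> x"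
  "tail (bidirected G) (flip x) = head (bidirected G) x"
  "head (bidirected G) (flip x) = tail (bidirected G) x"
  "flip x \<in> arcs (bidirected G) \<longleftrightarrow> x \<in> arcs (bidirected G)"
  by (cases x; auto simp: flip_def bidirected_def)+

lemma same_edge_cases: "fst x = fst y \<Longrightarrow> x = y \<or> x = flip y"
  by (cases x; cases y) (auto simp: flip_def)

lemma arcs_bidirected: "arcs (bidirected G) = arcs G \<times> UNIV"
  and verts_bidirected: "verts (bidirected G) = verts G"
  by (simp_all add: bidirected_def)

lemma fin_digraph_bidirected:
  assumes "fin_digraph G"
  shows "fin_digraph (bidirected G)"
proof -
  interpret fin_digraph G by fact
  show ?thesis by standard (auto simp: bidirected_def)
qed

text \<open>
  The part of \<open>compact_metric_tree\<close> that does not involve lengths or connectedness.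
\<close>

definition edge_acyclic :: "('v, 'e) pre_digraph \<Rightarrow> bool" where
  "edge_acyclic G \<longleftrightarrow> fin_digraph G \<and> (\<nexists>p. undirected_cycle G p)"

context
  fixes G :: "('v, 'e) pre_digraph"
  assumes acyclic: "edge_acyclic G"
begin

interpretation fin_digraph "bidirected G"
  using acyclic fin_digraph_bidirected unfolding edge_acyclic_def by blast

lemma no_undirected_cycle:
  assumes "awalk u p u" "distinct (tl (awalk_verts u p))" "p \<noteq> []" "distinct (map fst p)"
  shows False
proof -
  have "cycle p" unfolding cycle_def using assms by (intro exI[of _ u] conjI)
  with assms(4) acyclic show False unfolding edge_acyclic_def undirected_cycle_def by simp
qed

lemma no_loop:
  assumes "x \<in> arcs (bidirected G)"
  shows "tail (bidirected G) x \<noteq> head (bidirected G) x"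
proof
  assume eq: "tail (bidirected G) x = head (bidirected G) x"
  show False
  proof (rule no_undirected_cycle)
    show "awalk (tail (bidirected G) x) [x] (tail (bidirected G) x)"
      using arc_implies_awalk[OF assms] eq by simp
  qed simp_all
qed

lemma arc_ends_in_walk:
  assumes "awalk u p v" "y \<in> set p"
  shows "tail (bidirected G) y \<in> set (awalk_verts u p)" "head (bidirected G) y \<in> set (awalk_verts u p)"
  using awalk_verts_arc1[OF assms(2)] awalk_verts_arc2[OF assms] .

lemma apath_distinct_edges: "apath u p v \<Longrightarrow> distinct (map fst p)"
proof (induction p arbitrary: u)
  case (Cons x p)
  then have x: "tail (bidirected G) x = u" and p: "apath (head (bidirected G) x) p v"
    and u: "u \<notin> set (awalk_verts (head (bidirected G) x) p)"
    unfolding apath_Cons_iff by blast+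
  have walk: "awalk (head (bidirected G) x) p v" using p unfolding apath_def by (rule conjunct1)
  have "fst x \<noteq> fst y" if y: "y \<in> set p" for y
  proof
    assume "fst x = fst y"
    then have "x = y \<or> x = flip y" by (rule same_edge_cases)
    then have "tail (bidirected G) x \<in> {tail (bidirected G) y, head (bidirected G) y}"
      by (elim disjE) simp_all
    then show False using arc_ends_in_walk[OF walk y] u unfolding x by (elim insertE) simp_all
  qed
  then have "fst x \<notin> fst ` set p" by blast
  then show ?case using Cons.IH[OF p] by simp
qed simp

text \<open>
  Any two vertices of \<open>S\<close> are joined by a path inside \<open>S\<close>.
\<close>

definition linked :: "'v set \<Rightarrow> bool" where
  "linked S \<longleftrightarrow> (\<forall>s\<in>S. \<forall>t\<in>S. \<exists>p. apath s p t \<and> set (awalk_verts s p) \<subseteq> S)"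

text \<open>
  Two different oriented edges from \<open>S\<close> to \<open>w\<close> would close up a path inside \<open>S\<close> to an undirected cycle.
\<close>

lemma unique_crossing:
  assumes S: "linked S" and x: "x \<in> arcs (bidirected G)" "tail (bidirected G) x \<in> S"
    and y: "y \<in> arcs (bidirected G)" "tail (bidirected G) y \<in> S"
    and w: "head (bidirected G) x = w" "head (bidirected G) y = w" "w \<notin> S"
  shows "x = y"
proof (rule ccontr)
  assume "x \<noteq> y"
  moreover have "x \<noteq> flip y" using x(2) w by auto
  ultimately have edges: "fst x \<noteq> fst y" using same_edge_cases by blast
  obtain p where p: "apath (tail (bidirected G) x) p (tail (bidirected G) y)"
    "set (awalk_verts (tail (bidirected G) x) p) \<subseteq> S"
    using S x(2) y(2) unfolding linked_def by blast
  let ?s = "tail (bidirected G) x"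
  have ap: "awalk ?s p (tail (bidirected G) y)" "distinct (awalk_verts ?s p)"
    using p(1) unfolding apath_def by (rule conjunct1, rule conjunct2)
  have aq: "awalk (tail (bidirected G) y) [y, flip x] ?s"
    using x(1) y(1) w tail_in_verts[OF x(1)] by (simp add: awalk_Cons_iff awalk_Nil_iff)
  have walk: "awalk ?s (p @ [y, flip x]) ?s" using ap(1) aq by (rule awalk_appendI)
  have last: "awlast ?s p = tail (bidirected G) y" using ap(1) by simp
  have verts: "awalk_verts ?s (p @ [y, flip x]) = awalk_verts ?s p @ [w, ?s]"
    using awalk_verts_append[OF walk] w by (simp add: last)
  have hd: "hd (awalk_verts ?s p) = ?s" using ap(1) by simp
  have ne: "awalk_verts ?s p \<noteq> []" by simp
  show False
  proof (rule no_undirected_cycle[OF walk])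
    have "awalk_verts ?s p = ?s # tl (awalk_verts ?s p)" using hd ne by (metis list.collapse)
    then have "distinct (?s # tl (awalk_verts ?s p))" using ap(2) by simp
    moreover have "set (tl (awalk_verts ?s p)) \<subseteq> S" using p(2) list.set_sel(2)[OF ne] by blast
    ultimately show "distinct (tl (awalk_verts ?s (p @ [y, flip x])))"
      unfolding verts using w(3) x(2) ne by auto
    have nS: "fst z \<noteq> fst x" "fst z \<noteq> fst y" if z: "z \<in> set p" for z
    proof -
      have zS: "tail (bidirected G) z \<in> S" "head (bidirected G) z \<in> S"
        using arc_ends_in_walk[OF ap(1) z] p(2) by (simp_all only: subset_iff)
      have ne: "head (bidirected G) z \<noteq> w" "tail (bidirected G) z \<noteq> w"
        using zS w(3) by blast+
      have "x \<noteq> z" "x \<noteq> flip z" "y \<noteq> z" "y \<noteq> flip z"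
        using ne w(1,2) flip_simps(5)[of G z] by metis+
      then show "fst z \<noteq> fst x" "fst z \<noteq> fst y"
        using same_edge_cases[of x z] same_edge_cases[of y z] by metis+
    qed
    have "fst x \<notin> fst ` set p" "fst y \<notin> fst ` set p" using nS by force+
    then show "distinct (map fst (p @ [y, flip x]))"
      using apath_distinct_edges[OF p(1)] edges by auto
  qed simp
qed

lemma linked_insert:
  assumes S: "linked S" and x: "x \<in> arcs (bidirected G)" "tail (bidirected G) x \<in> S"
    and w: "head (bidirected G) x = w" "w \<notin> S"
  shows "linked (insert w S)"
proof -
  have to_w: "\<exists>p. apath s p w \<and> set (awalk_verts s p) \<subseteq> insert w S" if s: "s \<in> S" for s
  proof -
    obtain p where p: "apath s p (tail (bidirected G) x)" "set (awalk_verts s p) \<subseteq> S"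
      using S s x(2) unfolding linked_def by blast
    have ap: "awalk s p (tail (bidirected G) x)" using p(1) by (simp add: apath_def)
    have walk: "awalk s (p @ [x]) w"
      using ap arc_implies_awalk[OF x(1)] unfolding w(1) by (rule awalk_appendI)
    have "awalk_verts s (p @ [x]) = awalk_verts s p @ [w]"
      using awalk_verts_append[OF walk] w ap by simp
    moreover have "distinct (awalk_verts s p)" using p(1) unfolding apath_def by (rule conjunct2)
    ultimately have "apath s (p @ [x]) w" "set (awalk_verts s (p @ [x])) \<subseteq> insert w S"
      using walk p(2) w(2) unfolding apath_def by auto
    then show ?thesis by blast
  qed
  have from_w: "\<exists>p. apath w p s \<and> set (awalk_verts w p) \<subseteq> insert w S" if s: "s \<in> S" for s
  proof -
    obtain p where p: "apath (tail (bidirected G) x) p s" "set (awalk_verts (tail (bidirected G) x) p) \<subseteq> S"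
      using S s x(2) unfolding linked_def by blast
    have "apath w (flip x # p) s"
      using p w x unfolding apath_Cons_iff by (simp add: subset_iff) blast
    moreover have "set (awalk_verts w (flip x # p)) \<subseteq> insert w S"
      using p(2) w(1) by (simp add: subset_insertI2)
    ultimately show ?thesis by blast
  qed
  have "w \<in> verts (bidirected G)" using head_in_verts[OF x(1)] unfolding w(1) .
  then have "apath w [] w \<and> set (awalk_verts w []) \<subseteq> insert w S"
    by (simp add: apath_Nil_iff)
  then have ww: "\<exists>p. apath w p w \<and> set (awalk_verts w p) \<subseteq> insert w S" by blast
  have "\<exists>p. apath s p t \<and> set (awalk_verts s p) \<subseteq> insert w S" if "s \<in> S" "t \<in> S" for s t
    using S that unfolding linked_def by blast
  with to_w from_w ww show ?thesis unfolding linked_def by blast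
qed

lemma crossing_arc:
  assumes "awalk s p t" "s \<in> S" "t \<notin> S"
  shows "\<exists>x\<in>arcs (bidirected G). tail (bidirected G) x \<in> S \<and> head (bidirected G) x \<notin> S"
  using assms
proof (induction p arbitrary: s)
  case (Cons x p)
  then show ?case by (cases "head (bidirected G) x \<in> S") (auto simp: awalk_Cons_iff)
qed (simp add: awalk_Nil_iff)

end

text \<open>
  The vectors are the roots of unity of order \<open>card A\<close>, rotated so that one of them becomes \<open>c0\<close>.
\<close>

lemma balanced_unit_vectors:
  fixes A :: "'a set" and c0 :: complex
  assumes A: "finite A" "card A \<noteq> 1 \<or> ext" and x0: "x0 \<in> A" and c0: "cmod c0 = 1"
  obtains c where "\<And>x. x \<in> A \<Longrightarrow> cmod (c x) = 1" "c x0 = c0" "\<not> ext \<Longrightarrow> sum c A = 0"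
proof (cases "card A = 1")
  case True
  with A show ?thesis using c0 by (intro that[of "\<lambda>_. c0"]) auto
next
  case False
  define d where "d = card A"
  have "d \<noteq> 0" using A x0 unfolding d_def by auto
  with False have d: "1 < d" unfolding d_def by linarith
  have "card {z::complex. z ^ d = 1} = d" using d by (intro card_roots_unity_eq) simp
  moreover have "finite {z::complex. z ^ d = 1}" using d by (intro finite_roots_unity) simp
  ultimately obtain h where h: "bij_betw h A {z::complex. z ^ d = 1}"
    using finite_same_card_bij[OF A(1)] unfolding d_def by metis
  have unit: "cmod (h x) = 1" if "x \<in> A" for x
  proof -
    have "h x ^ d = 1" using h that by (auto simp: bij_betw_def)
    then have "cmod (h x) ^ d = 1" by (metis norm_one norm_power)
    then show ?thesis using power_eq_imp_eq_base[of "cmod (h x)" d 1] d by simp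
  qed
  have sum0: "sum h A = 0"
    using sum.reindex_bij_betw[OF h, of "\<lambda>z. z"] sum_roots_unity[OF d] by simp
  show ?thesis
  proof (rule that[of "\<lambda>x. c0 / h x0 * h x"])
    show "cmod (c0 / h x0 * h x) = 1" if "x \<in> A" for x
      using unit[OF that] unit[OF x0] c0 by (simp add: norm_mult norm_divide)
    have "h x0 \<noteq> 0" using unit[OF x0] by auto
    then show "c0 / h x0 * h x0 = c0" by simp
    show "(\<Sum>x\<in>A. c0 / h x0 * h x) = 0"
      by (simp only: sum_distrib_left[symmetric] sum0 mult_zero_right)
  qed
qed

text \<open>
  Directions \<open>c\<close> and vertex positions \<open>g\<close> in the complex plane. The directions are constrained only
  on the oriented edges that start or end in \<open>S\<close>. There they are unit vectors, opposite for opposite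
  orientations, and they sum to zero at every vertex of \<open>S\<close> that is not external. The positions are
  constrained only on \<open>S\<close>.
\<close>

definition balanced_drawing ::
  "('v, 'e) pre_digraph \<Rightarrow> ('e \<Rightarrow> real) \<Rightarrow> 'v set \<Rightarrow> ('e \<times> bool \<Rightarrow> complex) \<Rightarrow> ('v \<Rightarrow> complex) \<Rightarrow> bool"
where
  "balanced_drawing G len S c g \<longleftrightarrow>
    (\<forall>x\<in>arcs (bidirected G). tail (bidirected G) x \<in> S \<longrightarrow> cmod (c x) = 1 \<and> c (flip x) = - c x) \<and>
    (\<forall>s\<in>S. s \<notin> external_vertices G \<longrightarrow> (\<Sum>x\<in>out_arcs (bidirected G) s. c x) = 0) \<and>
    (\<forall>x\<in>arcs (bidirected G). tail (bidirected G) x \<in> S \<longrightarrow> head (bidirected G) x \<in> S \<longrightarrow>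
      g (head (bidirected G) x) - g (tail (bidirected G) x) = len (fst x) * c x)"

text \<open>
  Only the edge \<open>x\<close> connects \<open>w\<close> with \<open>S\<close>, so the directions at \<open>w\<close> are free except for the one of
  \<open>flip x\<close>, and the position of \<open>w\<close> is forced by \<open>x\<close> alone.
\<close>

lemma balanced_drawing_insert:
  assumes G: "edge_acyclic G" and S: "linked G S" "balanced_drawing G len S c g"
    and x: "x \<in> arcs (bidirected G)" "tail (bidirected G) x \<in> S"
    and w: "head (bidirected G) x = w" "w \<notin> S"
  shows "\<exists>c' g'. balanced_drawing G len (insert w S) c' g'"
proof -
  let ?t = "tail (bidirected G)" and ?h = "head (bidirected G)" and ?A = "arcs (bidirected G)"
  interpret B: fin_digraph "bidirected G"
    using G fin_digraph_bidirected unfolding edge_acyclic_def by blast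
  have c: "cmod (c y) = 1" "c (flip y) = - c y" if "y \<in> ?A" "?t y \<in> S" for y
    using S(2) that unfolding balanced_drawing_def by blast+
  have kirchhoff: "(\<Sum>x\<in>out_arcs (bidirected G) s. c x) = 0" if "s \<in> S" "s \<notin> external_vertices G" for s
    using S(2) that unfolding balanced_drawing_def by blast
  have g: "g (?h y) - g (?t y) = len (fst y) * c y" if "y \<in> ?A" "?t y \<in> S" "?h y \<in> S" for y
    using S(2) that unfolding balanced_drawing_def by blast
  have noloop: "?t y \<noteq> ?h y" if "y \<in> ?A" for y using no_loop[OF G that] .
  have unique: "y = x" if "y \<in> ?A" "?t y \<in> S" "?h y = w" for y
    using unique_crossing[OF G S(1) that(1,2) x that(3) w] .
  have fx: "flip x \<in> out_arcs (bidirected G) w" using x(1) w by (simp add: out_arcs_def)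
  have wV: "w \<in> verts G" using B.head_in_verts[OF x(1)] unfolding w(1) verts_bidirected .
  have "card (out_arcs (bidirected G) w) \<noteq> 1 \<or> w \<in> external_vertices G"
    using wV unfolding external_vertices_def out_degree_def by blast
  moreover have "cmod (- c x) = 1" using c(1)[OF x] by simp
  ultimately obtain a where a: "\<And>y. y \<in> out_arcs (bidirected G) w \<Longrightarrow> cmod (a y) = 1"
    "a (flip x) = - c x" "w \<notin> external_vertices G \<Longrightarrow> sum a (out_arcs (bidirected G) w) = 0"
    using balanced_unit_vectors[OF B.finite_out_arcs _ fx, of "w \<in> external_vertices G" "- c x"] by blast
  \<comment> \<open>Edges at \<open>w\<close> get their new directions; on edges at \<open>S\<close> nothing changes, because \<open>a (flip x) = - c x\<close>.\<close>
  define c' where "c' = (\<lambda>y. if ?t y = w then a y else if ?h y = w then - a (flip y) else c y)"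
  define g' where "g' = g(w := g (?t x) + len (fst x) * c x)"
  have c'_S: "c' y = c y" if y: "y \<in> ?A" "?t y \<in> S" for y
  proof (cases "?h y = w")
    case True
    then have "y = x" using unique y by blast
    then show ?thesis using a(2) w x(2) by (auto simp: c'_def)
  next
    case False
    then show ?thesis using y w(2) by (auto simp: c'_def)
  qed
  have c'_w: "c' y = a y" if "?t y = w" for y
    using that by (simp add: c'_def)
  have flip_c': "c' (flip y) = - c' y" if y: "y \<in> ?A" "?t y \<in> insert w S" for y
  proof (cases "?t y = w \<or> ?h y = w")
    case True
    then show ?thesis using noloop[OF y(1)] by (auto simp: c'_def)
  next
    case False
    then show ?thesis using c(2)[of y] y by (simp add: c'_def)
  qed
  have "balanced_drawing G len (insert w S) c' g'"
    unfolding balanced_drawing_def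
  proof (intro conjI ballI impI)
    fix y assume y: "y \<in> ?A" "?t y \<in> insert w S"
    show "c' (flip y) = - c' y" using flip_c'[OF y] .
    show "cmod (c' y) = 1"
    proof (cases "?t y = w")
      case True
      then show ?thesis using a(1)[of y] y(1) c'_w by (simp add: out_arcs_def)
    next
      case False
      then show ?thesis using c(1)[of y] c'_S[of y] y by simp
    qed
  next
    fix s assume s: "s \<in> insert w S" "s \<notin> external_vertices G"
    show "(\<Sum>y\<in>out_arcs (bidirected G) s. c' y) = 0"
    proof (cases "s = w")
      case True
      then have "(\<Sum>y\<in>out_arcs (bidirected G) s. c' y) = sum a (out_arcs (bidirected G) w)"
        using c'_w by (intro sum.cong) (auto simp: out_arcs_def)
      then show ?thesis using a(3) s True by simp
    next
      case False
      then have "(\<Sum>y\<in>out_arcs (bidirected G) s. c' y) = (\<Sum>y\<in>out_arcs (bidirected G) s. c y)"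
        using c'_S s by (intro sum.cong) (auto simp: out_arcs_def)
      then show ?thesis using kirchhoff s False by simp
    qed
  next
    fix y assume y: "y \<in> ?A" "?t y \<in> insert w S" "?h y \<in> insert w S"
    consider "?t y = w" | "?h y = w" | "?t y \<in> S" "?h y \<in> S" using y by blast
    then show "g' (?h y) - g' (?t y) = len (fst y) * c' y"
    proof cases
      case 1
      then have "?h y \<in> S" using noloop[OF y(1)] y(3) by simp
      then have fy: "flip y = x" using unique[of "flip y"] y(1) 1 by simp
      then have y_eq: "y = flip x" by (metis flip_simps(1))
      have "c' y = - c x" using a(2) c'_w[OF 1] y_eq by simp
      then show ?thesis using w x(2) unfolding y_eq g'_def by (auto simp: algebra_simps)
    next
      case 2
      then have "?t y \<in> S" using noloop[OF y(1)] y(2) by simp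
      then have "y = x" using unique y(1) 2 by blast
      then show ?thesis using w x c'_S[OF x] unfolding g'_def by auto
    next
      case 3
      then have "g' (?h y) = g (?h y)" "g' (?t y) = g (?t y)" using w(2) unfolding g'_def by auto
      then show ?thesis using g[OF y(1) 3] c'_S[OF y(1) 3(1)] by simp
    qed
  qed
  then show ?thesis by blast
qed

lemma balanced_drawing_singleton:
  assumes G: "edge_acyclic G" and r: "r \<in> verts G"
  shows "\<exists>c g. balanced_drawing G len {r} c g"
proof -
  let ?t = "tail (bidirected G)" and ?h = "head (bidirected G)" and ?A = "arcs (bidirected G)"
  interpret B: fin_digraph "bidirected G"
    using G fin_digraph_bidirected unfolding edge_acyclic_def by blast
  have noloop: "?t y \<noteq> ?h y" if "y \<in> ?A" for y using no_loop[OF G that] .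
  have "card (out_arcs (bidirected G) r) \<noteq> 1 \<or> r \<in> external_vertices G"
    using r unfolding external_vertices_def out_degree_def by blast
  then have "\<exists>a. (\<forall>y\<in>out_arcs (bidirected G) r. cmod (a y) = 1) \<and>
    (r \<notin> external_vertices G \<longrightarrow> sum a (out_arcs (bidirected G) r) = 0)"
  proof (cases "out_arcs (bidirected G) r = {}")
    case False
    then obtain x where "x \<in> out_arcs (bidirected G) r" by blast
    with balanced_unit_vectors[OF B.finite_out_arcs _ this, of "r \<in> external_vertices G" 1]
      \<open>card _ \<noteq> 1 \<or> _\<close> show ?thesis by (metis norm_one)
  qed simp
  then obtain a where a: "\<And>y. y \<in> out_arcs (bidirected G) r \<Longrightarrow> cmod (a y) = 1"
    "r \<notin> external_vertices G \<Longrightarrow> sum a (out_arcs (bidirected G) r) = 0" by blast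
  define c where "c = (\<lambda>y. if ?t y = r then a y else - a (flip y))"
  have c_r: "c y = a y" if "?t y = r" for y using that by (simp add: c_def)
  have "balanced_drawing G len {r} c (\<lambda>_. 0)"
    unfolding balanced_drawing_def
  proof (intro conjI ballI impI)
    fix y assume y: "y \<in> ?A" "?t y \<in> {r}"
    show "c (flip y) = - c y" using y noloop[OF y(1)] by (auto simp: c_def)
    show "cmod (c y) = 1" using y a(1)[of y] by (simp add: c_def out_arcs_def)
  next
    fix s assume s: "s \<in> {r}" "s \<notin> external_vertices G"
    have "(\<Sum>y\<in>out_arcs (bidirected G) r. c y) = sum a (out_arcs (bidirected G) r)"
      using c_r by (intro sum.cong) (auto simp: out_arcs_def)
    then show "(\<Sum>y\<in>out_arcs (bidirected G) s. c y) = 0" using a(2) s by simp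
  next
    fix y assume "y \<in> ?A" "?t y \<in> {r}" "?h y \<in> {r}"
    then show "(0::complex) - 0 = len (fst y) * c y" using noloop[of y] by simp
  qed
  then show ?thesis by blast
qed

text \<open>
  A maximal linked set of vertices with a balanced drawing contains all vertices, since otherwise
  some edge leaves it.
\<close>

lemma tree_balanced_drawing:
  assumes T: "compact_metric_tree G len"
  shows "\<exists>c g. balanced_drawing G len (verts G) c g"
proof -
  have G: "edge_acyclic G" using T unfolding compact_metric_tree_def edge_acyclic_def by blast
  interpret B: fin_digraph "bidirected G"
    using G fin_digraph_bidirected unfolding edge_acyclic_def by blast
  have conn: "strongly_connected (bidirected G)" using T unfolding compact_metric_tree_def by blast
  then obtain r where r: "r \<in> verts G" unfolding strongly_connected_def verts_bidirected by blast
  define good where "good = {S. S \<subseteq> verts G \<and> S \<noteq> {} \<and> linked G S \<and> (\<exists>c g. balanced_drawing G len S c g)}"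
  have finV: "finite (verts G)" using B.finite_verts unfolding verts_bidirected .
  have "good \<subseteq> Pow (verts G)" unfolding good_def by (intro subsetI) simp
  then have fin: "finite good" by (rule finite_subset) (simp add: finV)
  have "linked G {r}"
  proof -
    have "B.apath r [] r" using r by (simp add: B.apath_Nil_iff verts_bidirected)
    moreover have "set (B.awalk_verts r []) \<subseteq> {r}" by simp
    ultimately show ?thesis unfolding linked_def[OF G] by blast
  qed
  then have "{r} \<in> good" using r balanced_drawing_singleton[OF G r] unfolding good_def by simp
  then obtain S where S: "S \<in> good" "\<And>S'. S' \<in> good \<Longrightarrow> S \<subseteq> S' \<Longrightarrow> S = S'"
    using finite_has_maximal[OF fin] by (metis emptyE)
  have "S = verts G"
  proof (rule ccontr)
    assume "S \<noteq> verts G"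
    then obtain s t where st: "s \<in> S" "t \<in> verts G" "t \<notin> S" "s \<in> verts G"
      using S(1) unfolding good_def by auto
    then have "s \<rightarrow>\<^sup>*\<^bsub>bidirected G\<^esub> t"
      using conn unfolding strongly_connected_def verts_bidirected by blast
    then obtain p where "B.awalk s p t" unfolding B.reachable_awalk by blast
    from crossing_arc[OF G this st(1,3)] obtain x where x: "x \<in> arcs (bidirected G)"
      "tail (bidirected G) x \<in> S" "head (bidirected G) x \<notin> S" by blast
    let ?w = "head (bidirected G) x"
    obtain c g where "balanced_drawing G len S c g" and L: "linked G S" "S \<subseteq> verts G"
      using S(1) unfolding good_def by blast
    then have "\<exists>c g. balanced_drawing G len (insert ?w S) c g"
      using balanced_drawing_insert[OF G L(1) _ x(1,2) refl x(3)] by blast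
    moreover have "linked G (insert ?w S)" using linked_insert[OF G L(1) x(1,2) refl x(3)] .
    moreover have "?w \<in> verts G" using B.head_in_verts[OF x(1)] unfolding verts_bidirected .
    ultimately have "insert ?w S \<in> good" using L(2) unfolding good_def by simp
    then show False using S(2)[of "insert ?w S"] x(3) by blast
  qed
  then show ?thesis using S(1) unfolding good_def by blast
qed

text \<open>
  The balance condition is stated in summed form: it is tested against functions \<open>\<phi>\<close> on the vertices
  that vanish at the external ones.
\<close>

lemma tree_planar_map:
  fixes G :: "('v, 'e) pre_digraph"
  assumes T: "compact_metric_tree G len"
  shows "\<exists>(c :: 'e \<Rightarrow> complex) (g :: 'v \<Rightarrow> complex).
    (\<forall>e\<in>arcs G. cmod (c e) = 1 \<and> g (head G e) - g (tail G e) = len e * c e) \<and>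
    (\<forall>\<phi>. (\<forall>v\<in>external_vertices G. \<phi> v = 0) \<longrightarrow>
      (\<Sum>e\<in>arcs G. c e * of_real (\<phi> (head G e) - \<phi> (tail G e))) = 0)"
proof -
  obtain c g where d: "balanced_drawing G len (verts G) c g"
    using tree_balanced_drawing[OF T] by blast
  interpret G: fin_digraph G using T unfolding compact_metric_tree_def by blast
  interpret B: fin_digraph "bidirected G" by (rule fin_digraph_bidirected) unfold_locales
  have arc: "(e, b) \<in> arcs (bidirected G)" if "e \<in> arcs G" for e b
    using that by (simp add: arcs_bidirected)
  have ends: "tail (bidirected G) (e, True) = tail G e" "head (bidirected G) (e, True) = head G e"
    "tail (bidirected G) (e, False) = head G e" for e
    by (simp_all add: bidirected_def)
  have c1: "cmod (c (e, True)) = 1" and cf: "c (e, False) = - c (e, True)"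
    and gd: "g (head G e) - g (tail G e) = len e * c (e, True)" if e: "e \<in> arcs G" for e
    using d arc[OF e, of True] G.tail_in_verts[OF e] G.head_in_verts[OF e]
    unfolding balanced_drawing_def by (auto simp: ends flip_def dest!: bspec[of _ _ "(e, True)"])
  show ?thesis
  proof (intro exI[of _ "\<lambda>e. c (e, True)"] exI[of _ g] conjI allI impI ballI)
    fix \<phi> :: "'v \<Rightarrow> real" assume \<phi>: "\<forall>v\<in>external_vertices G. \<phi> v = 0"
    have "(\<Sum>v\<in>verts G. \<Sum>x\<in>out_arcs (bidirected G) v. c x * of_real (\<phi> v)) = 0"
    proof (rule sum.neutral, rule ballI)
      fix v assume v: "v \<in> verts G"
      show "(\<Sum>x\<in>out_arcs (bidirected G) v. c x * of_real (\<phi> v)) = 0"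
      proof (cases "v \<in> external_vertices G")
        case False
        then have "(\<Sum>x\<in>out_arcs (bidirected G) v. c x) = 0"
          using d v unfolding balanced_drawing_def by blast
        then show ?thesis by (simp only: sum_distrib_right[symmetric] mult_zero_left)
      qed (simp add: \<phi>)
    qed
    also have "(\<Sum>v\<in>verts G. \<Sum>x\<in>out_arcs (bidirected G) v. c x * of_real (\<phi> v))
        = (\<Sum>v\<in>verts G. \<Sum>x\<in>{x \<in> arcs (bidirected G). tail (bidirected G) x = v}.
            c x * of_real (\<phi> (tail (bidirected G) x)))"
      by (intro sum.cong) (auto simp: out_arcs_def)
    also have "\<dots> = (\<Sum>x\<in>arcs (bidirected G). c x * of_real (\<phi> (tail (bidirected G) x)))"
      using B.tail_in_verts by (intro sum.group) (auto simp: verts_bidirected)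
    also have "\<dots> = (\<Sum>e\<in>arcs G. \<Sum>b\<in>UNIV. c (e, b) * of_real (\<phi> (tail (bidirected G) (e, b))))"
      unfolding arcs_bidirected by (simp add: sum.cartesian_product)
    also have "\<dots> = (\<Sum>e\<in>arcs G. - (c (e, True) * of_real (\<phi> (head G e) - \<phi> (tail G e))))"
      by (intro sum.cong refl) (simp add: UNIV_bool ends cf algebra_simps)
    finally show "(\<Sum>e\<in>arcs G. c (e, True) * of_real (\<phi> (head G e) - \<phi> (tail G e))) = 0"
      by (simp add: sum_negf)
  qed (simp_all add: c1 gd)
qed


section \<open>Square-integrable functions\<close>

text \<open>
  Square integrability with respect to an arbitrary measure, for functions and not for classes of
  functions equal almost everywhere.
\<close>

definition square_integrable :: "'a measure \<Rightarrow> ('a \<Rightarrow> real) \<Rightarrow> bool" where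
  "square_integrable M g \<longleftrightarrow> g \<in> borel_measurable M \<and> integrable M (\<lambda>x. (g x)\<^sup>2)"

lemma square_integrable_measurable: "square_integrable M g \<Longrightarrow> g \<in> borel_measurable M"
  by (simp add: square_integrable_def)

lemma square_integrable_prod:
  assumes "square_integrable M g" "square_integrable M h"
  shows "integrable M (\<lambda>x. g x * h x)"
proof (rule Bochner_Integration.integrable_bound)
  show "integrable M (\<lambda>x. (g x)\<^sup>2 + (h x)\<^sup>2)"
    using assms by (simp add: square_integrable_def)
  show "(\<lambda>x. g x * h x) \<in> borel_measurable M"
    using assms by (intro borel_measurable_times square_integrable_measurable)
  have "\<bar>a * b\<bar> \<le> a\<^sup>2 + b\<^sup>2" for a b :: real
  proof -
    have "0 \<le> (\<bar>a\<bar> - \<bar>b\<bar>)\<^sup>2" by simp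
    then have "2 * \<bar>a * b\<bar> \<le> a\<^sup>2 + b\<^sup>2" by (simp add: power2_diff abs_mult)
    then show ?thesis by linarith
  qed
  then show "AE x in M. norm (g x * h x) \<le> norm ((g x)\<^sup>2 + (h x)\<^sup>2)" by simp
qed

lemma square_integrable_add:
  assumes "square_integrable M g" "square_integrable M h"
  shows "square_integrable M (\<lambda>x. g x + h x)"
proof -
  have "integrable M (\<lambda>x. (g x)\<^sup>2 + 2 * (g x * h x) + (h x)\<^sup>2)"
    using assms square_integrable_prod[OF assms] by (simp add: square_integrable_def)
  then have "integrable M (\<lambda>x. (g x + h x)\<^sup>2)" by (simp add: power2_sum ac_simps)
  moreover have "(\<lambda>x. g x + h x) \<in> borel_measurable M"
    using assms by (intro borel_measurable_add square_integrable_measurable)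
  ultimately show ?thesis by (simp add: square_integrable_def)
qed

lemma square_integrable_scale:
  assumes "square_integrable M g"
  shows "square_integrable M (\<lambda>x. c * g x)"
  using assms unfolding square_integrable_def
  by (auto simp: power_mult_distrib intro!: borel_measurable_times)

lemma square_integrable_diff:
  assumes "square_integrable M g" "square_integrable M h"
  shows "square_integrable M (\<lambda>x. g x - h x)"
  using square_integrable_add[OF assms(1) square_integrable_scale[OF assms(2), of "-1"]] by simp

lemma square_integrable_zero: "square_integrable M (\<lambda>x. 0)"
  by (simp add: square_integrable_def)

lemma square_integrable_mult_bounded:
  assumes "square_integrable M g" "b \<in> borel_measurable M" "\<And>x. x \<in> space M \<Longrightarrow> \<bar>b x\<bar> \<le> C"
  shows "square_integrable M (\<lambda>x. g x * b x)"
proof -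
  have "integrable M (\<lambda>x. (g x * b x)\<^sup>2)"
  proof (rule Bochner_Integration.integrable_bound)
    show "integrable M (\<lambda>x. C\<^sup>2 * (g x)\<^sup>2)" using assms(1) by (simp add: square_integrable_def)
    show "(\<lambda>x. (g x * b x)\<^sup>2) \<in> borel_measurable M"
      using assms(2) square_integrable_measurable[OF assms(1)] by measurable
    show "AE x in M. norm ((g x * b x)\<^sup>2) \<le> norm (C\<^sup>2 * (g x)\<^sup>2)"
    proof (rule AE_I2)
      fix x assume "x \<in> space M"
      then have "\<bar>b x\<bar>\<^sup>2 \<le> C\<^sup>2" using assms(3) by (intro power_mono) simp_all
      then have "(b x)\<^sup>2 * (g x)\<^sup>2 \<le> C\<^sup>2 * (g x)\<^sup>2" by (intro mult_right_mono) simp_all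
      then show "norm ((g x * b x)\<^sup>2) \<le> norm (C\<^sup>2 * (g x)\<^sup>2)"
        by (simp add: power_mult_distrib mult.commute)
    qed
  qed
  moreover have "(\<lambda>x. g x * b x) \<in> borel_measurable M"
    using assms(2) square_integrable_measurable[OF assms(1)] by measurable
  ultimately show ?thesis by (simp add: square_integrable_def)
qed

lemma square_integrable_bounded:
  assumes "finite_measure M" "b \<in> borel_measurable M" "\<And>x. x \<in> space M \<Longrightarrow> \<bar>b x\<bar> \<le> C"
  shows "square_integrable M b"
proof -
  interpret finite_measure M by fact
  have "square_integrable M (\<lambda>x. 1)" by (simp add: square_integrable_def)
  from square_integrable_mult_bounded[OF this assms(2,3)] show ?thesis by simp
qed

lemma square_integrable_integrable:
  assumes "finite_measure M" "square_integrable M g"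
  shows "integrable M g"
proof -
  interpret finite_measure M by fact
  have "square_integrable M (\<lambda>x. 1)" by (simp add: square_integrable_def)
  from square_integrable_prod[OF assms(2) this] show ?thesis by simp
qed

lemma integral_Cauchy_Schwarz:
  assumes g: "square_integrable M g" and h: "square_integrable M h"
  shows "(\<integral>x. g x * h x \<partial>M)\<^sup>2 \<le> (\<integral>x. (g x)\<^sup>2 \<partial>M) * (\<integral>x. (h x)\<^sup>2 \<partial>M)"
proof -
  interpret V: vector_space "\<lambda>(c::real) (f::'a \<Rightarrow> real) x. c * f x"
    by standard (simp_all add: fun_eq_iff algebra_simps)
  interpret N: nonneg_form "\<lambda>(c::real) (f::'a \<Rightarrow> real) x. c * f x" "{f. square_integrable M f}"
    "\<lambda>f g. \<integral>x. f x * g x \<partial>M"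
  proof
    show "V.subspace {f. square_integrable M f}"
      using square_integrable_add square_integrable_scale square_integrable_zero
      by (auto simp: V.subspace_def plus_fun_def zero_fun_def)
    fix x y w :: "'a \<Rightarrow> real" and c :: real
    assume D: "x \<in> {f. square_integrable M f}" "w \<in> {f. square_integrable M f}"
    then show "(\<integral>t. c * x t * w t \<partial>M) = c * (\<integral>t. x t * w t \<partial>M)"
      by (simp add: mult.assoc)
    assume "y \<in> {f. square_integrable M f}"
    then show "(\<integral>t. (x + y) t * w t \<partial>M) = (\<integral>t. x t * w t \<partial>M) + (\<integral>t. y t * w t \<partial>M)"
      using D by (simp add: distrib_right square_integrable_prod)
  qed (simp_all add: mult.commute)
  show ?thesis using N.Cauchy_Schwarz[of g h] g h by (simp add: power2_eq_square)
qed

text \<open>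
  A Cauchy sequence in \<open>L\<^sup>2\<close> of a finite measure has a subsequence that converges almost everywhere; by
  Fatou's lemma the whole sequence converges to its limit in \<open>L\<^sup>2\<close>.
\<close>

lemma square_integrable_complete:
  fixes g :: "nat \<Rightarrow> 'a \<Rightarrow> real"
  assumes M: "finite_measure M" and g: "\<And>k. square_integrable M (g k)"
    and cauchy: "\<And>e. 0 < e \<Longrightarrow> \<exists>N. \<forall>k\<ge>N. \<forall>l\<ge>N. (\<integral>x. (g k x - g l x)\<^sup>2 \<partial>M) < e"
  obtains h where "square_integrable M h" "(\<lambda>k. \<integral>x. (g k x - h x)\<^sup>2 \<partial>M) \<longlonglongrightarrow> 0"
proof -
  interpret finite_measure M by fact
  note [measurable] = square_integrable_measurable[OF g]
  have gd: "square_integrable M (\<lambda>x. g k x - g l x)" for k l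
    by (intro square_integrable_diff g)
  have gi: "integrable M (g k)" for k by (rule square_integrable_integrable[OF M g])
  have L1: "(\<integral>x. norm (g k x - g l x) \<partial>M)\<^sup>2 \<le> (\<integral>x. (g k x - g l x)\<^sup>2 \<partial>M) * measure M (space M)" for k l
  proof -
    have "square_integrable M (\<lambda>x. \<bar>g k x - g l x\<bar>)"
      using gd[of k l] by (auto simp: square_integrable_def)
    moreover have "square_integrable M (\<lambda>x. 1)" by (simp add: square_integrable_def)
    ultimately show ?thesis using integral_Cauchy_Schwarz[of M "\<lambda>x. \<bar>g k x - g l x\<bar>" "\<lambda>x. 1"] by simp
  qed
  have L1_cauchy: "\<exists>N. \<forall>k\<ge>N. \<forall>l\<ge>N. (\<integral>x. norm (g k x - g l x) \<partial>M) < e" if e: "0 < e" for e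
  proof -
    define m where "m = measure M (space M) + 1"
    have m: "0 < m" "measure M (space M) \<le> m" unfolding m_def by (simp_all add: add_nonneg_pos)
    obtain N where N: "\<And>k l. N \<le> k \<Longrightarrow> N \<le> l \<Longrightarrow> (\<integral>x. (g k x - g l x)\<^sup>2 \<partial>M) < e\<^sup>2 / m"
      using cauchy[of "e\<^sup>2 / m"] zero_less_power[OF e] m(1) divide_pos_pos by blast
    have "(\<integral>x. norm (g k x - g l x) \<partial>M) < e" if "N \<le> k" "N \<le> l" for k l
    proof -
      have "(\<integral>x. (g k x - g l x)\<^sup>2 \<partial>M) * measure M (space M) \<le> (\<integral>x. (g k x - g l x)\<^sup>2 \<partial>M) * m"
        by (intro mult_left_mono m) simp
      also have "\<dots> < e\<^sup>2" using N[OF that] m by (simp only: pos_less_divide_eq)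
      finally have "(\<integral>x. norm (g k x - g l x) \<partial>M)\<^sup>2 < e\<^sup>2" using L1[of k l] by linarith
      then show ?thesis by (rule power_less_imp_less_base) (use e in simp)
    qed
    then show ?thesis by blast
  qed
  obtain r where r: "strict_mono r" and ae: "AE x in M. Cauchy (\<lambda>i. g (r i) x)"
    by (rule cauchy_L1_AE_cauchy_subseq[OF gi L1_cauchy])
  define h where "h = (\<lambda>x. lim (\<lambda>i. g (r i) x))"
  have hm [measurable]: "h \<in> borel_measurable M" unfolding h_def by measurable
  have conv: "AE x in M. (\<lambda>i. g (r i) x) \<longlonglongrightarrow> h x"
    using ae unfolding h_def Cauchy_convergent_iff convergent_LIMSEQ_iff .
  have fatou: "(\<integral>\<^sup>+x. ennreal ((g k x - h x)\<^sup>2) \<partial>M) \<le> ennreal e"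
    if e: "0 < e" and k: "\<And>l. N \<le> l \<Longrightarrow> (\<integral>x. (g k x - g l x)\<^sup>2 \<partial>M) < e" for k N e
  proof -
    have "(\<integral>\<^sup>+x. ennreal ((g k x - h x)\<^sup>2) \<partial>M) = (\<integral>\<^sup>+x. liminf (\<lambda>i. ennreal ((g k x - g (r i) x)\<^sup>2)) \<partial>M)"
    proof (rule nn_integral_cong_AE)
      show "AE x in M. ennreal ((g k x - h x)\<^sup>2) = liminf (\<lambda>i. ennreal ((g k x - g (r i) x)\<^sup>2))"
        using conv
      proof eventually_elim
        case (elim x)
        then have "(\<lambda>i. ennreal ((g k x - g (r i) x)\<^sup>2)) \<longlonglongrightarrow> ennreal ((g k x - h x)\<^sup>2)"
          by (intro tendsto_ennrealI tendsto_power tendsto_diff tendsto_const)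
        then show ?case by (intro lim_imp_Liminf[symmetric]) simp_all
      qed
    qed
    also have "\<dots> \<le> liminf (\<lambda>i. \<integral>\<^sup>+x. ennreal ((g k x - g (r i) x)\<^sup>2) \<partial>M)"
      by (intro nn_integral_liminf) measurable
    also have "\<dots> \<le> ennreal e"
    proof (rule Liminf_le)
      have "(\<integral>\<^sup>+x. ennreal ((g k x - g (r i) x)\<^sup>2) \<partial>M) \<le> ennreal e" if "N \<le> i" for i
      proof -
        have "N \<le> r i" using that strict_mono_imp_increasing[OF r, of i] by linarith
        then have "(\<integral>x. (g k x - g (r i) x)\<^sup>2 \<partial>M) < e" by (rule k)
        moreover have "(\<integral>\<^sup>+x. ennreal ((g k x - g (r i) x)\<^sup>2) \<partial>M) = ennreal (\<integral>x. (g k x - g (r i) x)\<^sup>2 \<partial>M)"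
          using gd[of k "r i"] by (intro nn_integral_eq_integral) (simp_all add: square_integrable_def)
        ultimately show ?thesis by (simp add: ennreal_leI)
      qed
      then show "\<forall>\<^sub>F i in sequentially. (\<integral>\<^sup>+x. ennreal ((g k x - g (r i) x)\<^sup>2) \<partial>M) \<le> ennreal e"
        by (rule eventually_sequentiallyI)
    qed simp
    finally show ?thesis .
  qed
  have near: "\<exists>N. \<forall>k\<ge>N. square_integrable M (\<lambda>x. g k x - h x) \<and> (\<integral>x. (g k x - h x)\<^sup>2 \<partial>M) \<le> e"
    if e: "0 < e" for e
  proof -
    obtain N where N: "\<And>k l. N \<le> k \<Longrightarrow> N \<le> l \<Longrightarrow> (\<integral>x. (g k x - g l x)\<^sup>2 \<partial>M) < e"
      using cauchy[OF e] by blast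
    have "square_integrable M (\<lambda>x. g k x - h x) \<and> (\<integral>x. (g k x - h x)\<^sup>2 \<partial>M) \<le> e" if k: "N \<le> k" for k
    proof -
      have le: "(\<integral>\<^sup>+x. ennreal ((g k x - h x)\<^sup>2) \<partial>M) \<le> ennreal e"
        by (rule fatou[OF e N[OF k]])
      have int: "integrable M (\<lambda>x. (g k x - h x)\<^sup>2)"
      proof (rule integrableI_bounded)
        show "(\<integral>\<^sup>+x. ennreal (norm ((g k x - h x)\<^sup>2)) \<partial>M) < \<infinity>"
          using le le_less_trans[OF le ennreal_less_top] by simp
      qed measurable
      moreover have "(\<lambda>x. g k x - h x) \<in> borel_measurable M" by measurable
      moreover have "ennreal (\<integral>x. (g k x - h x)\<^sup>2 \<partial>M) \<le> ennreal e"
        using le nn_integral_eq_integral[OF int] by simp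
      then have "(\<integral>x. (g k x - h x)\<^sup>2 \<partial>M) \<le> e" using e by simp
      ultimately show ?thesis by (simp add: square_integrable_def)
    qed
    then show ?thesis by blast
  qed
  show ?thesis
  proof (rule that)
    obtain N where "square_integrable M (\<lambda>x. g N x - h x)" using near[of 1] by auto
    from square_integrable_diff[OF g[of N] this] show "square_integrable M h" by simp
    show "(\<lambda>k. \<integral>x. (g k x - h x)\<^sup>2 \<partial>M) \<longlonglongrightarrow> 0"
    proof (rule LIMSEQ_I)
      fix e :: real assume e: "0 < e"
      then obtain N where "\<forall>k\<ge>N. (\<integral>x. (g k x - h x)\<^sup>2 \<partial>M) \<le> e / 2" using near[of "e / 2"] by auto
      then show "\<exists>N. \<forall>k\<ge>N. norm ((\<integral>x. (g k x - h x)\<^sup>2 \<partial>M) - 0) < e"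
        using e by (intro exI[of _ N]) force
    qed
  qed
qed


section \<open>Absolutely continuous functions on an interval\<close>

text \<open>
  Lebesgue measure on \<open>{0..l}\<close>.
\<close>

definition lborel_ivl :: "real \<Rightarrow> real measure" where
  "lborel_ivl l = restrict_space lborel {0..l}"

lemma space_lborel_ivl [simp]: "space (lborel_ivl l) = {0..l}"
  by (simp add: lborel_ivl_def space_restrict_space)

lemma finite_measure_interval [simp]: "finite_measure (lborel_ivl l)"
proof (rule finite_measureI)
  have "emeasure (lborel_ivl l) {0..l} = emeasure lborel {0..l}"
    unfolding lborel_ivl_def by (rule emeasure_restrict_space) simp_all
  then show "emeasure (lborel_ivl l) (space (lborel_ivl l)) \<noteq> \<infinity>"
    by (cases "0 \<le> l") (simp_all add: space_lborel_ivl)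
qed

lemma measurable_interval:
  "f \<in> borel_measurable borel \<Longrightarrow> f \<in> borel_measurable (lborel_ivl l)"
  unfolding lborel_ivl_def by (rule measurable_restrict_space1) simp

lemma set_integral_interval:
  fixes f :: "real \<Rightarrow> real"
  shows "(LINT x:{0..l}|lborel. f x) = (\<integral>x. f x \<partial>lborel_ivl l)"
  unfolding lborel_ivl_def set_lebesgue_integral_def
  by (rule integral_restrict_space[symmetric]) simp

lemma set_integral_subinterval:
  fixes f :: "real \<Rightarrow> real"
  assumes "x \<le> l"
  shows "(LINT t:{0..x}|lborel. f t) = (\<integral>t. indicator {0..x} t * f t \<partial>lborel_ivl l)"
proof -
  have "(\<integral>t. indicator {0..x} t * f t \<partial>lborel_ivl l)
      = (LINT t:{0..l}|lborel. indicator {0..x} t * f t)"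
    by (rule set_integral_interval[symmetric])
  also have "\<dots> = (LINT t:{0..x}|lborel. f t)"
    unfolding set_lebesgue_integral_def using assms
    by (intro Bochner_Integration.integral_cong refl) (auto simp: indicator_def)
  finally show ?thesis by simp
qed

lemma L2_interval_iff: "L2_interval l g \<longleftrightarrow> square_integrable (lborel_ivl l) g"
proof -
  have "g \<in> borel_measurable (lborel_ivl l) \<longleftrightarrow> set_borel_measurable lborel {0..l} g"
    unfolding lborel_ivl_def set_borel_measurable_def
    by (subst borel_measurable_restrict_space_iff) (simp_all add: mult.commute)
  moreover have "integrable (lborel_ivl l) (\<lambda>x. (g x)\<^sup>2) \<longleftrightarrow> set_integrable lborel {0..l} (\<lambda>x. (g x)\<^sup>2)"
    unfolding lborel_ivl_def set_integrable_def
    by (subst integrable_restrict_space) simp_all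
  ultimately show ?thesis unfolding L2_interval_def square_integrable_def by blast
qed

lemma has_H1_derivative_iff:
  "has_H1_derivative l u g \<longleftrightarrow> square_integrable (lborel_ivl l) g \<and>
    (\<forall>x\<in>{0..l}. u x = u 0 + (\<integral>t. indicator {0..x} t * g t \<partial>lborel_ivl l))"
  unfolding has_H1_derivative_def L2_interval_iff
proof (intro conj_cong ball_cong refl)
  fix x assume "x \<in> {0..l}"
  then have "x \<le> l" by simp
  show "(u x = u 0 + (LINT t:{0..x}|lborel. g t)) =
      (u x = u 0 + (\<integral>t. indicator {0..x} t * g t \<partial>lborel_ivl l))"
    unfolding set_integral_subinterval[OF \<open>x \<le> l\<close>] ..
qed

lemma has_H1_derivativeD:
  assumes "has_H1_derivative l u g"
  shows "square_integrable (lborel_ivl l) g"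
    "x \<in> {0..l} \<Longrightarrow> u x = u 0 + (\<integral>t. indicator {0..x} t * g t \<partial>lborel_ivl l)"
  using assms by (simp_all only: has_H1_derivative_iff)

lemma integrable_indicator_mult:
  fixes g :: "real \<Rightarrow> real"
  assumes "integrable (lborel_ivl l) g" "A \<in> sets borel"
  shows "integrable (lborel_ivl l) (\<lambda>t. indicator A t * g t)"
proof (rule Bochner_Integration.integrable_bound[OF assms(1)])
  have "indicator A \<in> borel_measurable (lborel_ivl l)"
    using assms(2) by (intro measurable_interval borel_measurable_indicator)
  then show "(\<lambda>t. indicator A t * g t) \<in> borel_measurable (lborel_ivl l)"
    using borel_measurable_integrable[OF assms(1)] by (rule borel_measurable_times)
  show "AE t in lborel_ivl l. norm (indicator A t * g t) \<le> norm (g t)"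
    by (rule AE_I2) (simp add: indicator_def)
qed

lemma has_H1_derivative_increment:
  assumes u: "has_H1_derivative l u g" and xy: "0 \<le> x" "x \<le> y" "y \<le> l"
  shows "u y - u x = (\<integral>t. g t * indicator {x<..y} t \<partial>lborel_ivl l)"
proof -
  have gi: "integrable (lborel_ivl l) g"
    using has_H1_derivativeD(1)[OF u] by (rule square_integrable_integrable[rotated]) simp
  have "u y - u x = (\<integral>t. indicator {0..y} t * g t \<partial>lborel_ivl l)
      - (\<integral>t. indicator {0..x} t * g t \<partial>lborel_ivl l)"
    using has_H1_derivativeD(2)[OF u, of x] has_H1_derivativeD(2)[OF u, of y] xy by simp
  also have "\<dots> = (\<integral>t. indicator {0..y} t * g t - indicator {0..x} t * g t \<partial>lborel_ivl l)"
    by (rule Bochner_Integration.integral_diff[symmetric])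
      (rule integrable_indicator_mult[OF gi], simp)+
  also have "\<dots> = (\<integral>t. g t * indicator {x<..y} t \<partial>lborel_ivl l)"
    using xy by (intro Bochner_Integration.integral_cong refl) (auto simp: indicator_def)
  finally show ?thesis .
qed

lemma integral_indicator_interval:
  assumes "0 \<le> x" "x \<le> y" "y \<le> l"
  shows "(\<integral>t. (indicat_real {x<..y} t)\<^sup>2 \<partial>lborel_ivl l) = y - x"
proof -
  have "(\<integral>t. (indicat_real {x<..y} t)\<^sup>2 \<partial>lborel_ivl l) = (LINT t:{0..l}|lborel. (indicat_real {x<..y} t)\<^sup>2)"
    by (rule set_integral_interval[symmetric])
  also have "\<dots> = (\<integral>t. indicat_real {x<..y} t \<partial>lborel)"
    unfolding set_lebesgue_integral_def using assms
    by (intro Bochner_Integration.integral_cong[OF refl]) (auto simp: indicator_def)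
  also have "\<dots> = y - x" using assms by simp
  finally show ?thesis .
qed

lemma H1_Hoelder_le:
  assumes u: "has_H1_derivative l u g" and xy: "0 \<le> x" "x \<le> y" "y \<le> l"
  shows "(u y - u x)\<^sup>2 \<le> (y - x) * (\<integral>t. (g t)\<^sup>2 \<partial>lborel_ivl l)"
proof -
  have "square_integrable (lborel_ivl l) (indicator {x<..y} :: real \<Rightarrow> real)"
    by (rule square_integrable_bounded[of _ _ 1])
      (simp_all add: measurable_interval indicator_def)
  from integral_Cauchy_Schwarz[OF has_H1_derivativeD(1)[OF u] this]
  show ?thesis
    unfolding has_H1_derivative_increment[OF assms] integral_indicator_interval[OF xy]
    by (simp only: mult.commute)
qed

text \<open>
  Functions in \<open>H\<^sup>1\<close> are Hoelder continuous with exponent one half, which supplies the equicontinuity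
  needed for compactness.
\<close>

lemma H1_Hoelder:
  assumes u: "has_H1_derivative l u g" and xy: "x \<in> {0..l}" "y \<in> {0..l}"
  shows "(u y - u x)\<^sup>2 \<le> \<bar>y - x\<bar> * (\<integral>t. (g t)\<^sup>2 \<partial>lborel_ivl l)"
proof (cases "x \<le> y")
  case True
  then show ?thesis using H1_Hoelder_le[OF u, of x y] xy by simp
next
  case False
  then show ?thesis using H1_Hoelder_le[OF u, of y x] xy by (simp add: power2_commute)
qed

lemma H1_continuous:
  assumes u: "has_H1_derivative l u g"
  shows "continuous_on {0..l} u"
  unfolding continuous_on_def
proof
  fix x assume x: "x \<in> {0..l}"
  define C where "C = (\<integral>t. (g t)\<^sup>2 \<partial>lborel_ivl l)"
  have "norm (u y - u x) \<le> sqrt (\<bar>y - x\<bar> * C)" if "y \<in> {0..l}" for y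
    using H1_Hoelder[OF u x that] unfolding C_def[symmetric] real_norm_def
    by (metis real_sqrt_abs real_sqrt_le_iff)
  then have "\<forall>\<^sub>F y in at x within {0..l}. norm (u y - u x) \<le> sqrt (\<bar>y - x\<bar> * C)"
    unfolding eventually_at_filter by (intro always_eventually allI impI)
  moreover have "((\<lambda>y. sqrt (\<bar>y - x\<bar> * C)) \<longlongrightarrow> 0) (at x within {0..l})"
  proof -
    have "continuous (at x within {0..l}) (\<lambda>y. sqrt (\<bar>y - x\<bar> * C))"
      by (intro continuous_intros)
    then show ?thesis unfolding continuous_within by simp
  qed
  ultimately have "((\<lambda>y. u y - u x) \<longlongrightarrow> 0) (at x within {0..l})"
    by (rule Lim_null_comparison)
  then show "(u \<longlongrightarrow> u x) (at x within {0..l})" by (rule LIM_zero_cancel)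
qed

lemma continuous_measurable_interval:
  fixes u :: "real \<Rightarrow> real"
  assumes "continuous_on {0..l} u"
  shows "u \<in> borel_measurable (lborel_ivl l)"
proof -
  have "u \<in> borel_measurable (restrict_space borel {0..l})"
    using assms by (rule borel_measurable_continuous_on_restrict)
  then show ?thesis
    unfolding lborel_ivl_def by (simp cong: measurable_cong_sets add: sets_restrict_space)
qed

lemma continuous_bounded_interval:
  fixes u :: "real \<Rightarrow> real"
  assumes "continuous_on {0..l} u"
  shows "\<exists>C. \<forall>x\<in>{0..l}. \<bar>u x\<bar> \<le> C"
proof -
  have "compact (u ` {0..l})" using assms by (intro compact_continuous_image) simp_all
  then have "bounded (u ` {0..l})" by (rule compact_imp_bounded)
  then obtain C where "\<forall>y\<in>u ` {0..l}. norm y \<le> C" unfolding bounded_iff by blast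
  then show ?thesis by (intro exI[of _ C]) simp
qed

lemma square_integrable_mult_continuous:
  assumes "square_integrable (lborel_ivl l) g" "continuous_on {0..l} u"
  shows "square_integrable (lborel_ivl l) (\<lambda>x. g x * u x)"
proof -
  obtain C where "\<forall>x\<in>{0..l}. \<bar>u x\<bar> \<le> C"
    using continuous_bounded_interval[OF assms(2)] ..
  then show ?thesis
    by (intro square_integrable_mult_bounded[OF assms(1) continuous_measurable_interval[OF assms(2)], of C]) simp
qed

lemma square_integrable_continuous:
  assumes "continuous_on {0..l} u"
  shows "square_integrable (lborel_ivl l) u"
proof -
  obtain C where "\<forall>x\<in>{0..l}. \<bar>u x\<bar> \<le> C"
    using continuous_bounded_interval[OF assms] ..
  then show ?thesis
    by (intro square_integrable_bounded[OF _ continuous_measurable_interval[OF assms], of C]) simp_all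
qed

lemma integral_const_interval: "0 \<le> l \<Longrightarrow> (\<integral>t. c \<partial>lborel_ivl l) = c * l"
proof -
  assume l: "0 \<le> l"
  have "(\<integral>t. c \<partial>lborel_ivl l) = (LINT t:{0..l}|lborel. c)"
    by (rule set_integral_interval[symmetric])
  then show ?thesis using l by (simp add: set_lebesgue_integral_def)
qed

text \<open>
  The pointwise bound by the \<open>H\<^sup>1\<close> norm, obtained by averaging the Hoelder estimate over the interval.
\<close>

lemma H1_sup_bound:
  assumes u: "has_H1_derivative l u g" and x: "x \<in> {0..l}"
  shows "l * (u x)\<^sup>2 \<le> 2 * (\<integral>t. (u t)\<^sup>2 \<partial>lborel_ivl l) + 2 * l\<^sup>2 * (\<integral>t. (g t)\<^sup>2 \<partial>lborel_ivl l)"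
proof -
  interpret finite_measure "lborel_ivl l" by simp
  define C where "C = (\<integral>t. (g t)\<^sup>2 \<partial>lborel_ivl l)"
  have C: "0 \<le> C" unfolding C_def by simp
  have l: "0 \<le> l" using x by simp
  have ui: "integrable (lborel_ivl l) (\<lambda>t. (u t)\<^sup>2)"
    using square_integrable_continuous[OF H1_continuous[OF u]] by (simp add: square_integrable_def)
  have "(u x)\<^sup>2 \<le> 2 * (u y)\<^sup>2 + 2 * (l * C)" if y: "y \<in> {0..l}" for y
  proof -
    have "(u x - u y)\<^sup>2 \<le> \<bar>x - y\<bar> * C" unfolding C_def by (rule H1_Hoelder[OF u y x])
    also have "\<dots> \<le> l * C" using x y C by (intro mult_right_mono) auto
    finally have a: "(u x - u y)\<^sup>2 \<le> l * C" .
    have "0 \<le> (u x - 2 * u y)\<^sup>2" by simp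
    then have "(u x)\<^sup>2 \<le> 2 * (u y)\<^sup>2 + 2 * (u x - u y)\<^sup>2"
      by (simp add: power2_eq_square algebra_simps)
    then show ?thesis using a by linarith
  qed
  then have "(\<integral>t. (u x)\<^sup>2 \<partial>lborel_ivl l) \<le> (\<integral>t. 2 * (u t)\<^sup>2 + 2 * (l * C) \<partial>lborel_ivl l)"
    using ui by (intro integral_mono) simp_all
  also have "\<dots> = 2 * (\<integral>t. (u t)\<^sup>2 \<partial>lborel_ivl l) + 2 * (l * C) * l"
    using ui integral_const_interval[OF l, of "2 * (l * C)"] by simp
  finally show ?thesis unfolding integral_const_interval[OF l] C_def
    by (simp add: power2_eq_square mult.commute mult.left_commute)
qed

lemma has_H1_derivative_add:
  assumes u: "has_H1_derivative l u g" and v: "has_H1_derivative l v h"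
  shows "has_H1_derivative l (\<lambda>x. u x + v x) (\<lambda>x. g x + h x)"
  unfolding has_H1_derivative_iff
proof (intro conjI ballI)
  have gi: "integrable (lborel_ivl l) g" "integrable (lborel_ivl l) h"
    using has_H1_derivativeD(1)[OF u] has_H1_derivativeD(1)[OF v]
    by (auto intro: square_integrable_integrable[rotated])
  show "square_integrable (lborel_ivl l) (\<lambda>x. g x + h x)"
    by (intro square_integrable_add has_H1_derivativeD(1)[OF u] has_H1_derivativeD(1)[OF v])
  fix x assume x: "x \<in> {0..l}"
  have "(\<integral>t. indicator {0..x} t * (g t + h t) \<partial>lborel_ivl l)
    = (\<integral>t. indicator {0..x} t * g t \<partial>lborel_ivl l) + (\<integral>t. indicator {0..x} t * h t \<partial>lborel_ivl l)"
    unfolding distrib_left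
    by (rule Bochner_Integration.integral_add)
      (rule integrable_indicator_mult, rule gi, simp)+
  then show "u x + v x = u 0 + v 0 + (\<integral>t. indicator {0..x} t * (g t + h t) \<partial>lborel_ivl l)"
    using has_H1_derivativeD(2)[OF u x] has_H1_derivativeD(2)[OF v x] by simp
qed

lemma has_H1_derivative_scale:
  assumes u: "has_H1_derivative l u g"
  shows "has_H1_derivative l (\<lambda>x. c * u x) (\<lambda>x. c * g x)"
  unfolding has_H1_derivative_iff
proof (intro conjI ballI)
  show "square_integrable (lborel_ivl l) (\<lambda>x. c * g x)"
    by (intro square_integrable_scale has_H1_derivativeD(1)[OF u])
  fix x assume x: "x \<in> {0..l}"
  have "(\<integral>t. indicator {0..x} t * (c * g t) \<partial>lborel_ivl l)
    = c * (\<integral>t. indicator {0..x} t * g t \<partial>lborel_ivl l)"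
    unfolding mult.left_commute[of _ c] by (rule integral_mult_right_zero)
  then show "c * u x = c * u 0 + (\<integral>t. indicator {0..x} t * (c * g t) \<partial>lborel_ivl l)"
    using has_H1_derivativeD(2)[OF u x] by (simp add: distrib_left)
qed

lemma has_H1_derivative_affine: "has_H1_derivative l (\<lambda>x. a + b * x) (\<lambda>x. b)"
  unfolding has_H1_derivative_def L2_interval_iff
proof (intro conjI ballI)
  show "square_integrable (lborel_ivl l) (\<lambda>x. b)"
    by (rule square_integrable_continuous) simp
  fix x :: real assume "x \<in> {0..l}"
  then show "a + b * x = a + b * 0 + (LINT t:{0..x}|lborel. b)"
    by (simp add: set_lebesgue_integral_def)
qed

text \<open>
  The difference of two derivatives, extended by zero, integrates to zero over all half-lines, hence over all Borel sets.
\<close>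

lemma H1_derivative_AE_unique:
  assumes g: "has_H1_derivative l u g" and h: "has_H1_derivative l u h"
  shows "AE x in lborel_ivl l. g x = h x"
proof -
  define d where "d = (\<lambda>x. g x - h x)"
  define f where "f = (\<lambda>x. indicator {0..l} x * d x)"
  have d: "integrable (lborel_ivl l) d"
    unfolding d_def
    by (intro square_integrable_integrable square_integrable_diff has_H1_derivativeD(1)[OF g]
        has_H1_derivativeD(1)[OF h]) simp
  then have f: "integrable lborel f"
    unfolding f_def lborel_ivl_def by (subst (asm) integrable_restrict_space) simp_all
  have gi: "integrable (lborel_ivl l) g" "integrable (lborel_ivl l) h"
    by (rule square_integrable_integrable[OF _ has_H1_derivativeD(1)[OF g]], simp)
      (rule square_integrable_integrable[OF _ has_H1_derivativeD(1)[OF h]], simp)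
  have zero: "(\<integral>x. indicator {0..a} x * d x \<partial>lborel_ivl l) = 0" if a: "a \<in> {0..l}" for a
  proof -
    have "(\<integral>x. indicator {0..a} x * d x \<partial>lborel_ivl l)
      = (\<integral>x. indicator {0..a} x * g x - indicator {0..a} x * h x \<partial>lborel_ivl l)"
      unfolding d_def right_diff_distrib ..
    also have "\<dots> = (\<integral>x. indicator {0..a} x * g x \<partial>lborel_ivl l)
        - (\<integral>x. indicator {0..a} x * h x \<partial>lborel_ivl l)"
      by (rule Bochner_Integration.integral_diff) (rule integrable_indicator_mult, rule gi, simp)+
    also have "\<dots> = 0"
      using has_H1_derivativeD(2)[OF g a] has_H1_derivativeD(2)[OF h a] by simp
    finally show ?thesis .
  qed
  have atMost: "set_lebesgue_integral lborel {..a} f = 0" for a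
  proof -
    have "set_lebesgue_integral lborel {..a} f = (LINT x:{0..l}|lborel. indicator {..a} x * d x)"
      unfolding set_lebesgue_integral_def f_def by (simp add: mult.left_commute)
    also have "\<dots> = (\<integral>x. indicator {..a} x * d x \<partial>lborel_ivl l)"
      by (rule set_integral_interval)
    also have "\<dots> = 0"
    proof (cases "0 \<le> a \<and> 0 \<le> l")
      case True
      have "(\<integral>x. indicator {..a} x * d x \<partial>lborel_ivl l)
          = (\<integral>x. indicator {0..min a l} x * d x \<partial>lborel_ivl l)"
        by (intro Bochner_Integration.integral_cong refl) (auto simp: indicator_def)
      also have "\<dots> = 0" using True by (intro zero) simp
      finally show ?thesis .
    next
      case False
      then have "(\<integral>x. indicator {..a} x * d x \<partial>lborel_ivl l) = (\<integral>x. 0 \<partial>lborel_ivl l)"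
        by (intro Bochner_Integration.integral_cong refl) (auto simp: indicator_def)
      then show ?thesis by simp
    qed
    finally show ?thesis .
  qed
  have total: "set_lebesgue_integral lborel UNIV f = 0"
  proof -
    have "set_lebesgue_integral lborel UNIV f = set_lebesgue_integral lborel {..l} f"
      unfolding set_lebesgue_integral_def f_def
      by (intro Bochner_Integration.integral_cong refl) (auto simp: indicator_def)
    then show ?thesis using atMost by simp
  qed
  have si: "set_integrable lborel A f" if "A \<in> sets borel" for A
    unfolding set_integrable_def using that f by (intro integrable_mult_indicator) simp_all
  have borel: "sets borel = sigma_sets UNIV (range (\<lambda>a::real. {..a}))"
    unfolding borel_eq_atMost by (rule sets_measure_of) simp
  have all: "set_lebesgue_integral lborel A f = 0" if A: "A \<in> sigma_sets UNIV (range (\<lambda>a::real. {..a}))" for A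
    using _ _ A
  proof (rule sigma_sets_induct_disjoint)
    show "Int_stable (range (\<lambda>a::real. {..a}))"
    proof (rule Int_stableI)
      fix X Y assume "X \<in> range (\<lambda>a::real. {..a})" "Y \<in> range (\<lambda>a::real. {..a})"
      then obtain a b where "X = {..a}" "Y = {..b}" by blast
      then have "X \<inter> Y = {..min a b}" by auto
      then show "X \<inter> Y \<in> range (\<lambda>a::real. {..a})" by blast
    qed
    fix X :: "real set"
    show "set_lebesgue_integral lborel X f = 0" if "X \<in> range (\<lambda>a::real. {..a})"
      using that atMost by blast
    show "set_lebesgue_integral lborel (UNIV - X) f = 0"
      if X: "X \<in> sigma_sets UNIV (range (\<lambda>a::real. {..a}))" "set_lebesgue_integral lborel X f = 0"
    proof -
      have XB: "X \<in> sets borel" "UNIV - X \<in> sets borel" using X(1) unfolding borel[symmetric] by auto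
      have "set_lebesgue_integral lborel (X \<union> (UNIV - X)) f
          = set_lebesgue_integral lborel X f + set_lebesgue_integral lborel (UNIV - X) f"
        using si[OF XB(1)] si[OF XB(2)] by (intro set_integral_Un) auto
      moreover have "X \<union> (UNIV - X) = UNIV" by blast
      ultimately show ?thesis using total X(2) by simp
    qed
  next
    fix A :: "nat \<Rightarrow> real set"
    assume A: "disjoint_family A" "range A \<subseteq> sigma_sets UNIV (range (\<lambda>a::real. {..a}))"
      "\<And>i. set_lebesgue_integral lborel (A i) f = 0"
    have AB: "A i \<in> sets borel" for i using A(2) unfolding borel[symmetric] by blast
    have "set_lebesgue_integral lborel (\<Union>(range A)) f = (\<Sum>i. set_lebesgue_integral lborel (A i) f)"
    proof (rule lebesgue_integral_countable_add)
      show "A i \<in> sets lborel" for i using AB by simp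
      show "A i \<inter> A j = {}" if "i \<noteq> j" for i j
        using A(1) that unfolding disjoint_family_on_def by blast
      show "set_integrable lborel (\<Union>(range A)) f" using AB by (intro si) blast
    qed
    then show "set_lebesgue_integral lborel (\<Union>(range A)) f = 0" using A(3) by simp
  qed (simp_all add: set_lebesgue_integral_def)
  have "AE x in lborel. f x = 0"
  proof (rule density_unique_real[OF f])
    fix A :: "real set" assume "A \<in> sets lborel"
    then show "set_lebesgue_integral lborel A f = set_lebesgue_integral lborel A (\<lambda>x. 0)"
      using all unfolding borel[symmetric] by (simp add: set_lebesgue_integral_def)
  qed simp
  then have "AE x in lborel. x \<in> {0..l} \<longrightarrow> g x = h x"
    by eventually_elim (auto simp: f_def d_def indicator_def)
  then show ?thesis unfolding lborel_ivl_def by (subst AE_restrict_space_iff) simp_all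
qed

lemma H1_limit:
  fixes g :: "nat \<Rightarrow> real \<Rightarrow> real"
  assumes u: "\<And>k. has_H1_derivative l (u k) (g k)"
    and h: "square_integrable (lborel_ivl l) h"
    and lim: "(\<lambda>k. \<integral>x. (g k x - h x)\<^sup>2 \<partial>lborel_ivl l) \<longlonglongrightarrow> 0"
    and v: "\<And>x. x \<in> {0..l} \<Longrightarrow> (\<lambda>k. u k x) \<longlonglongrightarrow> v x"
  shows "has_H1_derivative l v h"
  unfolding has_H1_derivative_iff
proof (intro conjI ballI h)
  fix x assume x: "x \<in> {0..l}"
  let ?M = "lborel_ivl l"
  let ?i = "indicat_real {0..x}"
  define S where "S = (\<integral>t. (?i t)\<^sup>2 \<partial>?M)"
  have isq: "square_integrable ?M ?i"
    by (rule square_integrable_bounded[of _ _ 1]) (simp_all add: measurable_interval indicator_def)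
  have gs: "square_integrable ?M (g k)" for k by (rule has_H1_derivativeD(1)[OF u])
  have prod: "integrable ?M (\<lambda>t. g k t * ?i t)" "integrable ?M (\<lambda>t. h t * ?i t)" for k
    by (rule square_integrable_prod[OF gs isq], rule square_integrable_prod[OF h isq])
  have bound: "norm ((\<integral>t. g k t * ?i t \<partial>?M) - (\<integral>t. h t * ?i t \<partial>?M))
      \<le> sqrt ((\<integral>t. (g k t - h t)\<^sup>2 \<partial>?M) * S)" for k
  proof -
    have "(\<integral>t. g k t * ?i t \<partial>?M) - (\<integral>t. h t * ?i t \<partial>?M) = (\<integral>t. (g k t - h t) * ?i t \<partial>?M)"
      unfolding left_diff_distrib by (rule Bochner_Integration.integral_diff[symmetric, OF prod])
    moreover have "(\<integral>t. (g k t - h t) * ?i t \<partial>?M)\<^sup>2 \<le> (\<integral>t. (g k t - h t)\<^sup>2 \<partial>?M) * S"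
      unfolding S_def by (rule integral_Cauchy_Schwarz[OF square_integrable_diff[OF gs h] isq])
    ultimately show ?thesis unfolding real_norm_def
      by (metis real_sqrt_abs real_sqrt_le_iff)
  qed
  have "(\<lambda>k. sqrt ((\<integral>t. (g k t - h t)\<^sup>2 \<partial>?M) * S)) \<longlonglongrightarrow> 0"
    using tendsto_real_sqrt[OF tendsto_mult_right[OF lim, of S]] by simp
  with bound have "(\<lambda>k. (\<integral>t. g k t * ?i t \<partial>?M) - (\<integral>t. h t * ?i t \<partial>?M)) \<longlonglongrightarrow> 0"
    by (rule Lim_null_comparison[OF always_eventually[OF allI]])
  then have A: "(\<lambda>k. \<integral>t. g k t * ?i t \<partial>?M) \<longlonglongrightarrow> (\<integral>t. h t * ?i t \<partial>?M)"
    by (rule LIM_zero_cancel)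
  have "0 \<in> {0..l}" using x by simp
  then have "(\<lambda>k. u k 0 + (\<integral>t. g k t * ?i t \<partial>?M)) \<longlonglongrightarrow> v 0 + (\<integral>t. h t * ?i t \<partial>?M)"
    by (intro tendsto_add v A)
  moreover have "u k x = u k 0 + (\<integral>t. g k t * ?i t \<partial>?M)" for k
    using has_H1_derivativeD(2)[OF u x] by (simp only: mult.commute)
  ultimately have "(\<lambda>k. u k x) \<longlonglongrightarrow> v 0 + (\<integral>t. h t * ?i t \<partial>?M)" by simp
  then show "v x = v 0 + (\<integral>t. ?i t * h t \<partial>?M)"
    using LIMSEQ_unique[OF v[OF x]] by (simp only: mult.commute)
qed

text \<open>
  Fubini's theorem on the square, which is cut along the diagonal into two triangles.
\<close>

lemma product_of_primitives:
  fixes G H :: "real \<Rightarrow> real"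
  assumes G: "integrable (lborel_ivl l) G" and H: "integrable (lborel_ivl l) H"
  shows "(\<integral>s. G s \<partial>lborel_ivl l) * (\<integral>t. H t \<partial>lborel_ivl l) =
    (\<integral>s. G s * (\<integral>t. indicator {0..s} t * H t \<partial>lborel_ivl l) \<partial>lborel_ivl l) +
    (\<integral>t. H t * (\<integral>s. indicator {0..t} s * G s \<partial>lborel_ivl l) \<partial>lborel_ivl l)"
proof -
  let ?M = "lborel_ivl l"
  interpret finite_measure ?M by simp
  interpret P: pair_sigma_finite ?M ?M by unfold_locales
  note [measurable] = borel_measurable_integrable[OF G] borel_measurable_integrable[OF H]
  have id [measurable]: "(\<lambda>x. x) \<in> borel_measurable ?M" by (intro measurable_interval) simp
  have GH: "integrable (?M \<Otimes>\<^sub>M ?M) (\<lambda>(s, t). G s * H t)"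
  proof (rule P.Fubini_integrable)
    have "(\<integral>t. norm (G s * H t) \<partial>?M) = \<bar>G s\<bar> * (\<integral>t. \<bar>H t\<bar> \<partial>?M)" for s
      by (simp add: abs_mult)
    then show "integrable ?M (\<lambda>s. \<integral>t. norm (case (s, t) of (s, t) \<Rightarrow> G s * H t) \<partial>?M)"
      using G by simp
    show "AE s in ?M. integrable ?M (\<lambda>t. case (s, t) of (s, t) \<Rightarrow> G s * H t)"
      using H by simp
  qed measurable
  have upper: "integrable (?M \<Otimes>\<^sub>M ?M) (\<lambda>(s, t). G s * H t * of_bool (s < t))"
  proof (rule Bochner_Integration.integrable_bound[OF GH])
    show "(\<lambda>(s, t). G s * H t * of_bool (s < t)) \<in> borel_measurable (?M \<Otimes>\<^sub>M ?M)"
    proof -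
      have "(\<lambda>p. G (fst p) * H (snd p) * of_bool (fst p < snd p)) \<in> borel_measurable (?M \<Otimes>\<^sub>M ?M)"
        using measurable_compose[OF measurable_fst id] measurable_compose[OF measurable_snd id]
        by measurable
      then show ?thesis by (simp add: case_prod_beta)
    qed
    show "AE p in ?M \<Otimes>\<^sub>M ?M. norm (case p of (s, t) \<Rightarrow> G s * H t * of_bool (s < t))
        \<le> norm (case p of (s, t) \<Rightarrow> G s * H t)"
      by (rule AE_I2) (simp add: case_prod_beta)
  qed
  have le: "integrable ?M (\<lambda>t. indicator {0..s} t * H t)" for s
    by (rule integrable_indicator_mult[OF H]) simp
  have gt: "integrable ?M (\<lambda>t. indicator {s<..} t * H t)" for s
    by (rule integrable_indicator_mult[OF H]) simp
  have split: "(\<integral>t. H t \<partial>?M) = (\<integral>t. indicator {0..s} t * H t \<partial>?M) + (\<integral>t. indicator {s<..} t * H t \<partial>?M)"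
    if "0 \<le> s" for s
  proof -
    have "(\<integral>t. H t \<partial>?M) = (\<integral>t. indicator {0..s} t * H t + indicator {s<..} t * H t \<partial>?M)"
      using that by (intro Bochner_Integration.integral_cong refl) (auto simp: indicator_def)
    then show ?thesis using le gt by simp
  qed
  have pull: "(\<integral>t. G s * H t * of_bool (s < t) \<partial>?M) = G s * (\<integral>t. indicator {s<..} t * H t \<partial>?M)" for s
  proof -
    have "G s * H t * of_bool (s < t) = G s * (indicator {s<..} t * H t)" for t
      by (simp add: indicator_def)
    then show ?thesis by (simp only: integral_mult_right_zero)
  qed
  have primH: "integrable ?M (\<lambda>s. G s * (\<integral>t. indicator {s<..} t * H t \<partial>?M))"
  proof -
    have "integrable ?M (\<lambda>s. \<integral>t. (case (s, t) of (s, t) \<Rightarrow> G s * H t * of_bool (s < t)) \<partial>?M)"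
      by (rule P.integrable_fst'[OF upper])
    then show ?thesis by (simp only: prod.case pull)
  qed
  have swap: "(\<integral>s. G s * (\<integral>t. indicator {s<..} t * H t \<partial>?M) \<partial>?M)
      = (\<integral>t. H t * (\<integral>s. indicator {0..t} s * G s \<partial>?M) \<partial>?M)"
  proof -
    have "(\<integral>s. G s * (\<integral>t. indicator {s<..} t * H t \<partial>?M) \<partial>?M)
        = (\<integral>s. \<integral>t. G s * H t * of_bool (s < t) \<partial>?M \<partial>?M)"
      by (simp only: pull)
    also have "\<dots> = (\<integral>t. \<integral>s. G s * H t * of_bool (s < t) \<partial>?M \<partial>?M)"
      by (rule P.Fubini_integral[OF upper, symmetric])
    also have "\<dots> = (\<integral>t. H t * (\<integral>s. indicator {0..t} s * G s \<partial>?M) \<partial>?M)"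
    proof (intro Bochner_Integration.integral_cong refl)
      fix t
      have "AE s in ?M. s \<noteq> t"
        unfolding lborel_ivl_def using AE_lborel_singleton[of t]
        by (subst AE_restrict_space_iff) (auto elim: eventually_mono)
      then have "AE s in ?M. G s * H t * of_bool (s < t) = H t * (indicator {0..t} s * G s)"
        using AE_space by eventually_elim (auto simp: indicator_def)
      then have "(\<integral>s. G s * H t * of_bool (s < t) \<partial>?M) = (\<integral>s. H t * (indicator {0..t} s * G s) \<partial>?M)"
        by (intro integral_cong_AE) measurable
      then show "(\<integral>s. G s * H t * of_bool (s < t) \<partial>?M) = H t * (\<integral>s. indicator {0..t} s * G s \<partial>?M)"
        by simp
    qed
    finally show ?thesis .
  qed
  have "(\<integral>s. G s * (\<integral>t. indicator {0..s} t * H t \<partial>?M) \<partial>?M)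
      = (\<integral>s. G s * (\<integral>t. H t \<partial>?M) - G s * (\<integral>t. indicator {s<..} t * H t \<partial>?M) \<partial>?M)"
  proof (intro Bochner_Integration.integral_cong refl)
    fix s assume "s \<in> space ?M"
    then have "0 \<le> s" by simp
    show "G s * (\<integral>t. indicator {0..s} t * H t \<partial>?M)
        = G s * (\<integral>t. H t \<partial>?M) - G s * (\<integral>t. indicator {s<..} t * H t \<partial>?M)"
      unfolding split[OF \<open>0 \<le> s\<close>] distrib_left by simp
  qed
  also have "\<dots> = (\<integral>s. G s \<partial>?M) * (\<integral>t. H t \<partial>?M) - (\<integral>s. G s * (\<integral>t. indicator {s<..} t * H t \<partial>?M) \<partial>?M)"
    using G primH by simp
  finally show ?thesis unfolding swap by simp
qed

text \<open>
  The Leibniz rule. The derivatives are merely square-integrable, so \<open>product_of_primitives\<close> takes the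
  place of the fundamental theorem of calculus.
\<close>

lemma has_H1_derivative_mult:
  assumes u: "has_H1_derivative l u g" and v: "has_H1_derivative l v h"
  shows "has_H1_derivative l (\<lambda>x. u x * v x) (\<lambda>x. g x * v x + h x * u x)"
  unfolding has_H1_derivative_iff
proof (intro conjI ballI)
  let ?M = "lborel_ivl l"
  have gv: "square_integrable ?M (\<lambda>x. g x * v x)" and hu: "square_integrable ?M (\<lambda>x. h x * u x)"
    by (rule square_integrable_mult_continuous[OF has_H1_derivativeD(1)[OF u] H1_continuous[OF v]])
      (rule square_integrable_mult_continuous[OF has_H1_derivativeD(1)[OF v] H1_continuous[OF u]])
  show "square_integrable ?M (\<lambda>x. g x * v x + h x * u x)"
    using gv hu by (rule square_integrable_add)
  have ints: "integrable ?M g" "integrable ?M h" "integrable ?M (\<lambda>x. g x * v x)" "integrable ?M (\<lambda>x. h x * u x)"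
    by (rule square_integrable_integrable, simp, rule has_H1_derivativeD(1)[OF u] has_H1_derivativeD(1)[OF v] gv hu)+
  fix x assume x: "x \<in> {0..l}"
  define G where "G = (\<lambda>t. indicator {0..x} t * g t)"
  define H where "H = (\<lambda>t. indicator {0..x} t * h t)"
  have G: "integrable ?M G" and H: "integrable ?M H"
    unfolding G_def H_def by (rule integrable_indicator_mult, rule ints, simp)+
  have uG: "(\<integral>t. G t \<partial>?M) = u x - u 0" and vH: "(\<integral>t. H t \<partial>?M) = v x - v 0"
    unfolding G_def H_def using has_H1_derivativeD(2)[OF u x] has_H1_derivativeD(2)[OF v x] by simp_all
  have inner: "(\<integral>t. indicator {0..s} t * (indicator {0..x} t * k t) \<partial>?M) = w s - w 0"
    if w: "has_H1_derivative l w k" and s: "0 \<le> s" "s \<le> x" for w k s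
  proof -
    have "(\<integral>t. indicator {0..s} t * (indicator {0..x} t * k t) \<partial>?M) = (\<integral>t. indicator {0..s} t * k t \<partial>?M)"
      using s by (intro Bochner_Integration.integral_cong refl) (auto simp: indicator_def)
    then show ?thesis using has_H1_derivativeD(2)[OF w, of s] s x by simp
  qed
  have "(\<integral>s. G s * (\<integral>t. indicator {0..s} t * H t \<partial>?M) \<partial>?M) = (\<integral>s. indicator {0..x} s * (g s * v s) - v 0 * G s \<partial>?M)"
  proof (intro Bochner_Integration.integral_cong refl)
    fix s assume "s \<in> space ?M"
    then show "G s * (\<integral>t. indicator {0..s} t * H t \<partial>?M) = indicator {0..x} s * (g s * v s) - v 0 * G s"
    proof (cases "s \<le> x")
      case True
      then have "(\<integral>t. indicator {0..s} t * H t \<partial>?M) = v s - v 0"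
        unfolding H_def using \<open>s \<in> space ?M\<close> by (intro inner[OF v]) simp_all
      then show ?thesis
        using True \<open>s \<in> space ?M\<close> by (simp add: G_def right_diff_distrib mult.commute)
    qed (simp add: G_def)
  qed
  also have "\<dots> = (\<integral>s. indicator {0..x} s * (g s * v s) \<partial>?M) - v 0 * (u x - u 0)"
    using integrable_indicator_mult[OF ints(3), of "{0..x}"] G uG by simp
  finally have 1: "(\<integral>s. G s * (\<integral>t. indicator {0..s} t * H t \<partial>?M) \<partial>?M)
      = (\<integral>s. indicator {0..x} s * (g s * v s) \<partial>?M) - v 0 * (u x - u 0)" .
  have "(\<integral>s. H s * (\<integral>t. indicator {0..s} t * G t \<partial>?M) \<partial>?M) = (\<integral>s. indicator {0..x} s * (h s * u s) - u 0 * H s \<partial>?M)"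
  proof (intro Bochner_Integration.integral_cong refl)
    fix s assume "s \<in> space ?M"
    then show "H s * (\<integral>t. indicator {0..s} t * G t \<partial>?M) = indicator {0..x} s * (h s * u s) - u 0 * H s"
    proof (cases "s \<le> x")
      case True
      then have "(\<integral>t. indicator {0..s} t * G t \<partial>?M) = u s - u 0"
        unfolding G_def using \<open>s \<in> space ?M\<close> by (intro inner[OF u]) simp_all
      then show ?thesis
        using True \<open>s \<in> space ?M\<close> by (simp add: H_def right_diff_distrib mult.commute)
    qed (simp add: H_def)
  qed
  also have "\<dots> = (\<integral>s. indicator {0..x} s * (h s * u s) \<partial>?M) - u 0 * (v x - v 0)"
    using integrable_indicator_mult[OF ints(4), of "{0..x}"] H vH by simp
  finally have 2: "(\<integral>s. H s * (\<integral>t. indicator {0..s} t * G t \<partial>?M) \<partial>?M)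
      = (\<integral>s. indicator {0..x} s * (h s * u s) \<partial>?M) - u 0 * (v x - v 0)" .
  have 3: "(\<integral>t. indicator {0..x} t * (g t * v t + h t * u t) \<partial>?M) =
      (\<integral>s. indicator {0..x} s * (g s * v s) \<partial>?M) + (\<integral>s. indicator {0..x} s * (h s * u s) \<partial>?M)"
    unfolding distrib_left by (rule Bochner_Integration.integral_add) (rule integrable_indicator_mult, rule ints, simp)+
  have "(u x - u 0) * (v x - v 0) =
      (\<integral>s. indicator {0..x} s * (g s * v s) \<partial>?M) - v 0 * (u x - u 0)
      + ((\<integral>s. indicator {0..x} s * (h s * u s) \<partial>?M) - u 0 * (v x - v 0))"
    using product_of_primitives[OF G H] unfolding uG vH 1 2 .
  then show "u x * v x = u 0 * v 0 + (\<integral>t. indicator {0..x} t * (g t * v t + h t * u t) \<partial>?M)"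
    unfolding 3 by (simp add: algebra_simps)
qed

lemma has_H1_derivative_diff:
  assumes u: "has_H1_derivative l u g" and v: "has_H1_derivative l v h"
  shows "has_H1_derivative l (\<lambda>x. u x - v x) (\<lambda>x. g x - h x)"
  using has_H1_derivative_add[OF u has_H1_derivative_scale[OF v, of "-1"]] by simp

lemma continuous_integral_square_pos:
  fixes u :: "real \<Rightarrow> real"
  assumes u: "continuous_on {0..l} u" and l: "0 < l" and t: "t \<in> {0..l}" "u t \<noteq> 0"
  shows "0 < (\<integral>x. (u x)\<^sup>2 \<partial>lborel_ivl l)"
proof -
  have si: "set_integrable lborel {0..l} (\<lambda>x. (u x)\<^sup>2)"
    using square_integrable_continuous[OF u] unfolding L2_interval_iff[symmetric] L2_interval_def by blast
  have eq: "(\<integral>x. (u x)\<^sup>2 \<partial>lborel_ivl l) = integral {0..l} (\<lambda>x. (u x)\<^sup>2)"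
    unfolding set_integral_interval[symmetric] by (rule set_borel_integral_eq_integral(2)[OF si])
  have "integral (cbox 0 l) (\<lambda>x. (u x)\<^sup>2) \<noteq> 0"
  proof
    assume "integral (cbox 0 l) (\<lambda>x. (u x)\<^sup>2) = 0"
    moreover have "continuous_on (cbox 0 l) (\<lambda>x. (u x)\<^sup>2)"
      using u by (intro continuous_on_power) simp
    moreover have "box 0 l \<noteq> {}" using l by simp
    ultimately have "\<forall>x\<in>cbox 0 l. (u x)\<^sup>2 = 0"
      using integral_cbox_eq_0_iff[of 0 l "\<lambda>x. (u x)\<^sup>2"] by simp
    then show False using t by auto
  qed
  then have "(\<integral>x. (u x)\<^sup>2 \<partial>lborel_ivl l) \<noteq> 0" unfolding eq by simp
  moreover have "0 \<le> (\<integral>x. (u x)\<^sup>2 \<partial>lborel_ivl l)" by simp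
  ultimately show ?thesis by linarith
qed

lemma H1_bounded_subsequence:
  fixes u g :: "nat \<Rightarrow> real \<Rightarrow> real"
  assumes l: "0 < l" and u: "\<And>k. has_H1_derivative l (u k) (g k)"
    and C: "\<And>k. (\<integral>x. (u k x)\<^sup>2 \<partial>lborel_ivl l) \<le> C" "\<And>k. (\<integral>x. (g k x)\<^sup>2 \<partial>lborel_ivl l) \<le> C"
  shows "\<exists>r::nat \<Rightarrow> nat. strict_mono r \<and>
    (\<forall>e>0. \<exists>N. \<forall>k\<ge>N. \<forall>m\<ge>N. \<forall>x\<in>{0..l}. \<bar>u (r k) x - u (r m) x\<bar> < e)"
proof -
  define B where "B = (2 * C + 2 * l\<^sup>2 * C) / l"
  have C0: "0 \<le> C"
    using C(1)[of 0] by (rule order_trans[rotated]) simp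
  have bound: "norm (u k x) \<le> sqrt B" if "x \<in> {0..l}" for k x
  proof -
    have "l * (u k x)\<^sup>2 \<le> 2 * (\<integral>t. (u k t)\<^sup>2 \<partial>lborel_ivl l) + 2 * l\<^sup>2 * (\<integral>t. (g k t)\<^sup>2 \<partial>lborel_ivl l)"
      by (rule H1_sup_bound[OF u that])
    also have "\<dots> \<le> 2 * C + 2 * l\<^sup>2 * C"
      by (intro add_mono mult_left_mono C) simp_all
    finally have "(u k x)\<^sup>2 \<le> B" unfolding B_def using l by (simp add: pos_le_divide_eq mult.commute)
    then show ?thesis by (metis real_norm_def real_sqrt_abs real_sqrt_le_iff)
  qed
  have hold: "norm (u k x - u k y) \<le> sqrt (\<bar>x - y\<bar> * C)" if "x \<in> {0..l}" "y \<in> {0..l}" for k x y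
  proof -
    have "(u k x - u k y)\<^sup>2 \<le> \<bar>x - y\<bar> * (\<integral>t. (g k t)\<^sup>2 \<partial>lborel_ivl l)"
      by (rule H1_Hoelder[OF u that(2,1)])
    also have "\<dots> \<le> \<bar>x - y\<bar> * C" by (intro mult_left_mono C) simp
    finally show ?thesis by (metis real_norm_def real_sqrt_abs real_sqrt_le_iff)
  qed
  have equi: "\<exists>d>0. \<forall>k y. y \<in> {0..l} \<and> norm (x - y) < d \<longrightarrow> norm (u k x - u k y) < e"
    if x: "x \<in> {0..l}" and e: "0 < e" for x e
  proof (intro exI[of _ "e\<^sup>2 / (C + 1)"] conjI allI impI)
    show "0 < e\<^sup>2 / (C + 1)" using e C0 by simp
    fix k y assume y: "y \<in> {0..l} \<and> norm (x - y) < e\<^sup>2 / (C + 1)"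
    have "\<bar>x - y\<bar> * C \<le> \<bar>x - y\<bar> * (C + 1)" by (intro mult_left_mono) simp_all
    also have "\<dots> < e\<^sup>2" using y C0 by (simp add: pos_less_divide_eq)
    finally have "sqrt (\<bar>x - y\<bar> * C) < sqrt (e\<^sup>2)" by (rule real_sqrt_less_mono)
    then show "norm (u k x - u k y) < e" using hold[OF x, of y k] y e by simp
  qed
  have "\<exists>f r. strict_mono (r::nat \<Rightarrow> nat) \<and>
      (\<forall>e>0. \<exists>N. \<forall>n x. N \<le> n \<and> x \<in> {0..l} \<longrightarrow> norm (u (r n) x - f x) < e)"
  proof (rule Arzela_Ascoli[OF compact_Icc bound equi])
    fix f and r :: "nat \<Rightarrow> nat"
    assume "strict_mono r" and
      lim: "\<And>e. 0 < e \<Longrightarrow> \<exists>N. \<forall>n x. N \<le> n \<and> x \<in> {0..l} \<longrightarrow> norm (u (r n) x - f x) < e"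
    then show "\<exists>f r. strict_mono (r::nat \<Rightarrow> nat) \<and>
      (\<forall>e>0. \<exists>N. \<forall>n x. N \<le> n \<and> x \<in> {0..l} \<longrightarrow> norm (u (r n) x - f x) < e)"
      by (intro exI[of _ f] exI[of _ r] conjI allI impI)
  qed
  then obtain f and r :: "nat \<Rightarrow> nat" where r: "strict_mono r"
    and lim: "\<And>e. 0 < e \<Longrightarrow> \<exists>N. \<forall>n x. N \<le> n \<and> x \<in> {0..l} \<longrightarrow> norm (u (r n) x - f x) < e"
    by blast
  have "\<exists>N. \<forall>k\<ge>N. \<forall>m\<ge>N. \<forall>x\<in>{0..l}. \<bar>u (r k) x - u (r m) x\<bar> < e" if e: "0 < e" for e
  proof -
    obtain N where N: "\<And>n x. N \<le> n \<Longrightarrow> x \<in> {0..l} \<Longrightarrow> norm (u (r n) x - f x) < e / 2"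
      using lim[of "e / 2"] e by auto
    have "\<bar>u (r k) x - u (r m) x\<bar> < e" if "N \<le> k" "N \<le> m" "x \<in> {0..l}" for k m x
      using N[OF that(1,3)] N[OF that(2,3)] unfolding real_norm_def by linarith
    then show ?thesis by blast
  qed
  with r show ?thesis by blast
qed

text \<open>
  The \<open>L\<^sup>2\<close> limit of the sequence is represented by the pointwise limit, which makes the boundary values
  converge as well.
\<close>

lemma H1_complete:
  fixes u g :: "nat \<Rightarrow> real \<Rightarrow> real"
  assumes l: "0 < l" and u: "\<And>k. has_H1_derivative l (u k) (g k)"
    and cu: "\<And>e. 0 < e \<Longrightarrow> \<exists>N. \<forall>k\<ge>N. \<forall>m\<ge>N. (\<integral>x. (u k x - u m x)\<^sup>2 \<partial>lborel_ivl l) < e"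
    and cg: "\<And>e. 0 < e \<Longrightarrow> \<exists>N. \<forall>k\<ge>N. \<forall>m\<ge>N. (\<integral>x. (g k x - g m x)\<^sup>2 \<partial>lborel_ivl l) < e"
  defines "w \<equiv> \<lambda>x. lim (\<lambda>k. u k x)"
  shows "\<exists>h. has_H1_derivative l w h \<and> (\<lambda>k. \<integral>x. (u k x - w x)\<^sup>2 \<partial>lborel_ivl l) \<longlonglongrightarrow> 0 \<and>
    (\<lambda>k. \<integral>x. (g k x - h x)\<^sup>2 \<partial>lborel_ivl l) \<longlonglongrightarrow> 0"
proof -
  let ?M = "lborel_ivl l"
  have unif: "\<exists>N. \<forall>k\<ge>N. \<forall>m\<ge>N. \<forall>x\<in>{0..l}. (u k x - u m x)\<^sup>2 < e" if e: "0 < e" for e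
  proof -
    obtain N1 where N1: "\<And>k m. N1 \<le> k \<Longrightarrow> N1 \<le> m \<Longrightarrow> (\<integral>x. (u k x - u m x)\<^sup>2 \<partial>?M) < e * l / 4"
      using cu[of "e * l / 4"] e l by auto
    obtain N2 where N2: "\<And>k m. N2 \<le> k \<Longrightarrow> N2 \<le> m \<Longrightarrow> (\<integral>x. (g k x - g m x)\<^sup>2 \<partial>?M) < e / (4 * l)"
      using cg[of "e / (4 * l)"] e l by auto
    have "(u k x - u m x)\<^sup>2 < e" if "max N1 N2 \<le> k" "max N1 N2 \<le> m" "x \<in> {0..l}" for k m x
    proof -
      have "l * (u k x - u m x)\<^sup>2 \<le> 2 * (\<integral>x. (u k x - u m x)\<^sup>2 \<partial>?M) + 2 * l\<^sup>2 * (\<integral>x. (g k x - g m x)\<^sup>2 \<partial>?M)"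
        by (rule H1_sup_bound[OF has_H1_derivative_diff[OF u u] that(3)])
      also have "\<dots> < 2 * (e * l / 4) + 2 * l\<^sup>2 * (e / (4 * l))"
        using N1 N2 that(1,2) l by (intro add_strict_mono mult_strict_left_mono) simp_all
      also have "\<dots> = l * e" using l by (simp add: power2_eq_square)
      finally show ?thesis using l by (simp only: mult_less_cancel_left_pos)
    qed
    then show ?thesis by blast
  qed
  have conv: "(\<lambda>k. u k x) \<longlonglongrightarrow> w x" if x: "x \<in> {0..l}" for x
  proof -
    have "Cauchy (\<lambda>k. u k x)"
    proof (rule CauchyI)
      fix e :: real assume e: "0 < e"
      obtain N where N: "\<And>k m. N \<le> k \<Longrightarrow> N \<le> m \<Longrightarrow> (u k x - u m x)\<^sup>2 < e\<^sup>2"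
        using unif[OF zero_less_power[OF e]] x by blast
      have "norm (u k x - u m x) < e" if "N \<le> k" "N \<le> m" for k m
        using real_sqrt_less_mono[OF N[OF that]] e by simp
      then show "\<exists>N. \<forall>k\<ge>N. \<forall>m\<ge>N. norm (u k x - u m x) < e" by blast
    qed
    then show ?thesis unfolding w_def by (simp only: Cauchy_convergent_iff convergent_LIMSEQ_iff)
  qed
  obtain h where h: "square_integrable ?M h" "(\<lambda>k. \<integral>x. (g k x - h x)\<^sup>2 \<partial>?M) \<longlonglongrightarrow> 0"
    by (rule square_integrable_complete[OF finite_measure_interval has_H1_derivativeD(1)[OF u] cg])
  have wh: "has_H1_derivative l w h" by (rule H1_limit[OF u h conv])
  have "(\<lambda>k. \<integral>x. (u k x - w x)\<^sup>2 \<partial>?M) \<longlonglongrightarrow> 0"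
  proof (rule LIMSEQ_I)
    fix e :: real assume e: "0 < e"
    have "0 < e / (2 * l)" using e l by simp
    then obtain N where N: "\<And>k m x. N \<le> k \<Longrightarrow> N \<le> m \<Longrightarrow> x \<in> {0..l} \<Longrightarrow> (u k x - u m x)\<^sup>2 < e / (2 * l)"
      using unif[of "e / (2 * l)"] by blast
    have "norm ((\<integral>x. (u k x - w x)\<^sup>2 \<partial>?M) - 0) < e" if k: "N \<le> k" for k
    proof -
      have le: "(u k x - w x)\<^sup>2 \<le> e / (2 * l)" if x: "x \<in> {0..l}" for x
      proof (rule LIMSEQ_le_const2)
        show "(\<lambda>m. (u k x - u m x)\<^sup>2) \<longlonglongrightarrow> (u k x - w x)\<^sup>2"
          by (rule tendsto_power[OF tendsto_diff[OF tendsto_const conv[OF x]]])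
        show "\<exists>M. \<forall>m\<ge>M. (u k x - u m x)\<^sup>2 \<le> e / (2 * l)"
        proof (intro exI[of _ N] allI impI)
          fix m assume "N \<le> m"
          then show "(u k x - u m x)\<^sup>2 \<le> e / (2 * l)" by (rule less_imp_le[OF N[OF k _ x]])
        qed
      qed
      have "integrable ?M (\<lambda>x. (u k x - w x)\<^sup>2)"
        using square_integrable_continuous[OF H1_continuous[OF has_H1_derivative_diff[OF u[of k] wh]]]
        unfolding square_integrable_def by (rule conjunct2)
      then have "(\<integral>x. (u k x - w x)\<^sup>2 \<partial>?M) \<le> (\<integral>x. e / (2 * l) \<partial>?M)"
        by (rule integral_mono[OF _ finite_measure.integrable_const[OF finite_measure_interval] le])
          (simp only: space_lborel_ivl)
      also have "\<dots> = e / (2 * l) * l" using l by (intro integral_const_interval) simp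
      also have "\<dots> < e" using l e by simp
      finally have "(\<integral>x. (u k x - w x)\<^sup>2 \<partial>?M) < e" .
      moreover have "0 \<le> (\<integral>x. (u k x - w x)\<^sup>2 \<partial>?M)"
        by (rule Bochner_Integration.integral_nonneg) (rule zero_le_power2)
      ultimately show ?thesis unfolding real_norm_def by linarith
    qed
    then show "\<exists>N. \<forall>k\<ge>N. norm ((\<integral>x. (u k x - w x)\<^sup>2 \<partial>?M) - 0) < e"
      by (intro exI[of _ N] allI impI)
  qed
  from wh this h(2) show ?thesis by (intro exI[of _ h] conjI)
qed


section \<open>The form domain of a metric graph\<close>

lemma L2_inner_eq:
  "L2_inner G len u w = (\<Sum>e\<in>arcs G. \<integral>x. u e x * w e x \<partial>lborel_ivl (len e))"
  unfolding L2_inner_def set_integral_interval ..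

lemma L2_iff: "w \<in> L2 G len \<longleftrightarrow> (\<forall>e\<in>arcs G. square_integrable (lborel_ivl (len e)) (w e))"
  by (simp add: L2_def L2_interval_iff)

lemma L2_inner_sym: "L2_inner G len u w = L2_inner G len w u"
  unfolding L2_inner_eq by (simp only: mult.commute)

lemma nonneg_form_L2: "nonneg_form scale_fun (L2 G len) (L2_inner G len)"
proof
  show "graph_fun.subspace (L2 G len)"
    unfolding graph_fun.subspace_def
    by (simp add: L2_iff scale_fun_def plus_fun_def zero_fun_def square_integrable_add
        square_integrable_scale square_integrable_zero)
  show "L2_inner G len u w = L2_inner G len w u" for u w by (rule L2_inner_sym)
  show "0 \<le> L2_inner G len u u" for u
    unfolding L2_inner_eq by (intro sum_nonneg Bochner_Integration.integral_nonneg) simp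
  fix u v w assume u: "u \<in> L2 G len" and w: "w \<in> L2 G len"
  show "L2_inner G len (scale_fun c u) w = c * L2_inner G len u w" for c
    unfolding L2_inner_eq scale_fun_def by (simp add: mult.assoc sum_distrib_left)
  assume v: "v \<in> L2 G len"
  have "(\<integral>x. (u + v) e x * w e x \<partial>lborel_ivl (len e)) =
      (\<integral>x. u e x * w e x \<partial>lborel_ivl (len e)) + (\<integral>x. v e x * w e x \<partial>lborel_ivl (len e))"
    if e: "e \<in> arcs G" for e
  proof -
    have "integrable (lborel_ivl (len e)) (\<lambda>x. u e x * w e x)"
      "integrable (lborel_ivl (len e)) (\<lambda>x. v e x * w e x)"
      using u v w e unfolding L2_iff by (simp_all add: square_integrable_prod)
    then show ?thesis by (simp add: distrib_right)
  qed
  then show "L2_inner G len (u + v) w = L2_inner G len u w + L2_inner G len v w"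
    unfolding L2_inner_eq sum.distrib[symmetric] by (intro sum.cong refl)
qed

lemma H1_derivative_works:
  "has_H1_derivative l u g \<Longrightarrow> has_H1_derivative l u (H1_derivative l u)"
  unfolding H1_derivative_def by (rule someI[where P = "has_H1_derivative l u"])

lemma form_domainI:
  assumes "\<And>e. e \<in> arcs G \<Longrightarrow> has_H1_derivative (len e) (u e) (g e)"
    and "\<And>e x. \<not> (e \<in> arcs G \<and> x \<in> {0..len e}) \<Longrightarrow> u e x = 0"
    and "has_vertex_values G len u \<phi>" "\<And>v. v \<in> external_vertices G \<Longrightarrow> \<phi> v = 0"
  shows "u \<in> form_domain G len"
proof -
  have "continuous_on_graph G len u"
    unfolding continuous_on_graph_def
    using H1_continuous[OF assms(1)] assms(3) by (intro conjI ballI exI[of _ \<phi>])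
  moreover have "\<forall>e\<in>arcs G. \<exists>g. has_H1_derivative (len e) (u e) g"
    using assms(1) by (intro ballI exI)
  ultimately have "u \<in> H1 G len" unfolding H1_def using assms(2) by simp
  with assms(3,4) show ?thesis unfolding form_domain_def by auto
qed

lemma form_domainD:
  assumes "u \<in> form_domain G len"
  shows "e \<in> arcs G \<Longrightarrow> has_H1_derivative (len e) (u e) (H1_derivative (len e) (u e))"
    and "\<not> (e \<in> arcs G \<and> x \<in> {0..len e}) \<Longrightarrow> u e x = 0"
    and "\<exists>\<phi>. has_vertex_values G len u \<phi> \<and> (\<forall>v\<in>external_vertices G. \<phi> v = 0)"
proof -
  have u: "u \<in> H1 G len" using assms unfolding form_domain_def by blast
  show "has_H1_derivative (len e) (u e) (H1_derivative (len e) (u e))" if "e \<in> arcs G"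
  proof -
    obtain g where "has_H1_derivative (len e) (u e) g" using u \<open>e \<in> arcs G\<close> unfolding H1_def by blast
    then show ?thesis by (rule H1_derivative_works)
  qed
  show "u e x = 0" if "\<not> (e \<in> arcs G \<and> x \<in> {0..len e})" using u that unfolding H1_def by blast
  show "\<exists>\<phi>. has_vertex_values G len u \<phi> \<and> (\<forall>v\<in>external_vertices G. \<phi> v = 0)"
    using assms unfolding form_domain_def by blast
qed

lemma form_domain_L2: "u \<in> form_domain G len \<Longrightarrow> u \<in> L2 G len"
  unfolding L2_iff
  by (intro ballI square_integrable_continuous H1_continuous[OF form_domainD(1)])

text \<open>
  The energy may be computed with any choice of derivatives.
\<close>

lemma energy_form_eq:
  assumes u: "\<And>e. e \<in> arcs G \<Longrightarrow> has_H1_derivative (len e) (u e) (g e)"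
    and v: "\<And>e. e \<in> arcs G \<Longrightarrow> has_H1_derivative (len e) (v e) (h e)"
  shows "energy_form G len u v = L2_inner G len g h"
  unfolding energy_form_def L2_inner_eq
proof (rule sum.cong[OF refl])
  fix e assume e: "e \<in> arcs G"
  let ?M = "lborel_ivl (len e)"
  let ?u = "H1_derivative (len e) (u e)" and ?v = "H1_derivative (len e) (v e)"
  have u': "has_H1_derivative (len e) (u e) ?u" and v': "has_H1_derivative (len e) (v e) ?v"
    by (rule H1_derivative_works[OF u[OF e]], rule H1_derivative_works[OF v[OF e]])
  show "(\<integral>x. ?u x * ?v x \<partial>?M) = (\<integral>x. g e x * h e x \<partial>?M)"
  proof (rule integral_cong_AE)
    note meas = has_H1_derivativeD(1)[THEN square_integrable_measurable]
    show "(\<lambda>x. ?u x * ?v x) \<in> borel_measurable ?M"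
      by (rule borel_measurable_times[OF meas[OF u'] meas[OF v']])
    show "(\<lambda>x. g e x * h e x) \<in> borel_measurable ?M"
      by (rule borel_measurable_times[OF meas[OF u[OF e]] meas[OF v[OF e]]])
    show "AE x in ?M. ?u x * ?v x = g e x * h e x"
      using H1_derivative_AE_unique[OF u' u[OF e]] H1_derivative_AE_unique[OF v' v[OF e]]
      by eventually_elim simp
  qed
qed

lemma derivative_L2:
  "u \<in> form_domain G len \<Longrightarrow> (\<lambda>e. H1_derivative (len e) (u e)) \<in> L2 G len"
  unfolding L2_iff by (intro ballI has_H1_derivativeD(1)[OF form_domainD(1)])

lemma subspace_form_domain: "graph_fun.subspace (form_domain G len)"
  unfolding graph_fun.subspace_def
proof (intro conjI ballI allI)
  show "0 \<in> form_domain G len"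
  proof (rule form_domainI[where g = "\<lambda>e x. 0" and \<phi> = "\<lambda>v. 0"])
    show "has_H1_derivative (len e) (0 e) (\<lambda>x. 0)" for e
      using has_H1_derivative_affine[of "len e" 0 0] by (simp add: zero_fun_def)
  qed (simp_all add: has_vertex_values_def)
next
  fix u v assume u: "u \<in> form_domain G len" and v: "v \<in> form_domain G len"
  obtain \<phi> where \<phi>: "has_vertex_values G len u \<phi>" "\<forall>v\<in>external_vertices G. \<phi> v = 0"
    using form_domainD(3)[OF u] by blast
  obtain \<psi> where \<psi>: "has_vertex_values G len v \<psi>" "\<forall>v\<in>external_vertices G. \<psi> v = 0"
    using form_domainD(3)[OF v] by blast
  show "u + v \<in> form_domain G len"
  proof (rule form_domainI)
    show "has_H1_derivative (len e) ((u + v) e)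
        (\<lambda>x. H1_derivative (len e) (u e) x + H1_derivative (len e) (v e) x)" if "e \<in> arcs G" for e
      using has_H1_derivative_add[OF form_domainD(1)[OF u that] form_domainD(1)[OF v that]]
      by (simp add: plus_fun_def)
    show "(u + v) e x = 0" if "\<not> (e \<in> arcs G \<and> x \<in> {0..len e})" for e x
      using form_domainD(2)[OF u that] form_domainD(2)[OF v that] by simp
    show "has_vertex_values G len (u + v) (\<lambda>x. \<phi> x + \<psi> x)"
      using \<phi>(1) \<psi>(1) unfolding has_vertex_values_def by simp
    show "\<phi> x + \<psi> x = 0" if "x \<in> external_vertices G" for x using \<phi>(2) \<psi>(2) that by simp
  qed
next
  fix c u assume u: "u \<in> form_domain G len"
  obtain \<phi> where \<phi>: "has_vertex_values G len u \<phi>" "\<forall>v\<in>external_vertices G. \<phi> v = 0"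
    using form_domainD(3)[OF u] by blast
  show "scale_fun c u \<in> form_domain G len"
  proof (rule form_domainI)
    show "has_H1_derivative (len e) (scale_fun c u e) (\<lambda>x. c * H1_derivative (len e) (u e) x)"
      if "e \<in> arcs G" for e
      unfolding scale_fun_def by (rule has_H1_derivative_scale[OF form_domainD(1)[OF u that]])
    show "scale_fun c u e x = 0" if "\<not> (e \<in> arcs G \<and> x \<in> {0..len e})" for e x
      using form_domainD(2)[OF u that] by (simp add: scale_fun_def)
    show "has_vertex_values G len (scale_fun c u) (\<lambda>x. c * \<phi> x)"
      using \<phi>(1) unfolding has_vertex_values_def scale_fun_def by simp
    show "c * \<phi> x = 0" if "x \<in> external_vertices G" for x using \<phi>(2) that by simp
  qed
qed

lemma nonneg_form_inner: "nonneg_form scale_fun (form_domain G len) (L2_inner G len)"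
proof -
  interpret L: nonneg_form scale_fun "L2 G len" "L2_inner G len" by (rule nonneg_form_L2)
  show ?thesis
  proof
    show "graph_fun.subspace (form_domain G len)" by (rule subspace_form_domain)
    show "L2_inner G len u w = L2_inner G len w u" for u w by (rule L2_inner_sym)
    show "0 \<le> L2_inner G len u u" if "u \<in> form_domain G len" for u
      by (rule L.nonneg[OF form_domain_L2[OF that]])
    fix u v w assume u: "u \<in> form_domain G len" and w: "w \<in> form_domain G len"
    show "L2_inner G len (scale_fun c u) w = c * L2_inner G len u w" for c
      by (rule L.scale_left[OF form_domain_L2[OF u] form_domain_L2[OF w]])
    assume v: "v \<in> form_domain G len"
    show "L2_inner G len (u + v) w = L2_inner G len u w + L2_inner G len v w"
      by (rule L.add_left[OF form_domain_L2[OF u] form_domain_L2[OF v] form_domain_L2[OF w]])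
  qed
qed

lemma nonneg_form_energy: "nonneg_form scale_fun (form_domain G len) (energy_form G len)"
proof
  interpret L: nonneg_form scale_fun "L2 G len" "L2_inner G len" by (rule nonneg_form_L2)
  show "graph_fun.subspace (form_domain G len)" by (rule subspace_form_domain)
  show "energy_form G len u w = energy_form G len w u" for u w
    unfolding energy_form_def by (rule L2_inner_sym)
  show "0 \<le> energy_form G len u u" if "u \<in> form_domain G len" for u
    unfolding energy_form_def by (rule L.nonneg[OF derivative_L2[OF that]])
  let ?D = "\<lambda>u e. H1_derivative (len e) (u e)"
  fix u v w assume u: "u \<in> form_domain G len" and w: "w \<in> form_domain G len"
  show "energy_form G len (scale_fun c u) w = c * energy_form G len u w" for c
  proof -
    have "energy_form G len (scale_fun c u) w = L2_inner G len (scale_fun c (?D u)) (?D w)"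
      by (rule energy_form_eq)
        (unfold scale_fun_def, rule has_H1_derivative_scale, rule form_domainD(1)[OF u], assumption,
         rule form_domainD(1)[OF w])
    also have "\<dots> = c * energy_form G len u w"
      unfolding energy_form_def by (rule L.scale_left[OF derivative_L2[OF u] derivative_L2[OF w]])
    finally show ?thesis .
  qed
  assume v: "v \<in> form_domain G len"
  have "energy_form G len (u + v) w = L2_inner G len (?D u + ?D v) (?D w)"
    by (rule energy_form_eq)
      (unfold plus_fun_def, rule has_H1_derivative_add, rule form_domainD(1)[OF u], assumption,
       rule form_domainD(1)[OF v], assumption, rule form_domainD(1)[OF w])
  also have "\<dots> = energy_form G len u w + energy_form G len v w"
    unfolding energy_form_def
    by (rule L.add_left[OF derivative_L2[OF u] derivative_L2[OF v] derivative_L2[OF w]])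
  finally show "energy_form G len (u + v) w = energy_form G len u w + energy_form G len v w" .
qed

lemma L2_inner_self: "L2_inner G len u u = (\<Sum>e\<in>arcs G. \<integral>x. (u e x)\<^sup>2 \<partial>lborel_ivl (len e))"
  unfolding L2_inner_eq by (simp only: power2_eq_square)

lemma edge_le_L2_inner:
  assumes "finite (arcs G)" "e \<in> arcs G"
  shows "(\<integral>x. (u e x)\<^sup>2 \<partial>lborel_ivl (len e)) \<le> L2_inner G len u u"
  unfolding L2_inner_self using assms by (intro member_le_sum) simp_all

lemma energy_self:
  "energy_form G len u u = L2_inner G len (\<lambda>e. H1_derivative (len e) (u e)) (\<lambda>e. H1_derivative (len e) (u e))"
  by (rule energy_form_def)

lemma energy_diff:
  assumes "u \<in> form_domain G len" "v \<in> form_domain G len"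
  shows "energy_form G len (u - v) (u - v) =
    (\<Sum>e\<in>arcs G. \<integral>x. (H1_derivative (len e) (u e) x - H1_derivative (len e) (v e) x)\<^sup>2 \<partial>lborel_ivl (len e))"
proof -
  have "has_H1_derivative (len e) ((u - v) e)
      (\<lambda>x. H1_derivative (len e) (u e) x - H1_derivative (len e) (v e) x)" if "e \<in> arcs G" for e
    using has_H1_derivative_diff[OF form_domainD(1)[OF assms(1) that] form_domainD(1)[OF assms(2) that]]
    by (simp add: fun_diff_def)
  from energy_form_eq[of G len "u - v" "\<lambda>e x. H1_derivative (len e) (u e) x - H1_derivative (len e) (v e) x", OF this this]
  show ?thesis unfolding L2_inner_self .
qed

lemma inner_diff:
  "L2_inner G len (u - v) (u - v) = (\<Sum>e\<in>arcs G. \<integral>x. (u e x - v e x)\<^sup>2 \<partial>lborel_ivl (len e))"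
  unfolding L2_inner_self by (simp add: fun_diff_def)

text \<open>
  Repeated passage to subsequences, one edge at a time.
\<close>

lemma uniform_subsequence:
  fixes v :: "nat \<Rightarrow> 'e \<Rightarrow> real \<Rightarrow> real"
  assumes fin: "finite (arcs G)" and len: "\<And>e. e \<in> arcs G \<Longrightarrow> 0 < len e"
    and v: "\<And>k. v k \<in> form_domain G len"
    and C: "\<And>k. L2_inner G len (v k) (v k) \<le> C" "\<And>k. energy_form G len (v k) (v k) \<le> C"
    and F: "finite F" "F \<subseteq> arcs G"
  shows "\<exists>r::nat \<Rightarrow> nat. strict_mono r \<and> (\<forall>e\<in>F. \<forall>\<epsilon>>0. \<exists>N. \<forall>k\<ge>N. \<forall>m\<ge>N. \<forall>x\<in>{0..len e}.
    \<bar>v (r k) e x - v (r m) e x\<bar> < \<epsilon>)"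
  using F
proof (induction F)
  case empty
  have "strict_mono (\<lambda>n::nat. n)" by (simp add: strict_mono_def)
  then show ?case by blast
next
  case (insert a F)
  then have a: "a \<in> arcs G" and "F \<subseteq> arcs G" by simp_all
  from insert.IH[OF this(2)] obtain r :: "nat \<Rightarrow> nat" where r: "strict_mono r"
    and rF: "\<forall>e\<in>F. \<forall>\<epsilon>>0. \<exists>N. \<forall>k\<ge>N. \<forall>m\<ge>N. \<forall>x\<in>{0..len e}. \<bar>v (r k) e x - v (r m) e x\<bar> < \<epsilon>"
    by (elim exE conjE)
  have "\<exists>s::nat \<Rightarrow> nat. strict_mono s \<and> (\<forall>\<epsilon>>0. \<exists>N. \<forall>k\<ge>N. \<forall>m\<ge>N. \<forall>x\<in>{0..len a}.
      \<bar>v (r (s k)) a x - v (r (s m)) a x\<bar> < \<epsilon>)"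
  proof (rule H1_bounded_subsequence[OF len[OF a]])
    show "has_H1_derivative (len a) (v (r k) a) (H1_derivative (len a) (v (r k) a))" for k
      by (rule form_domainD(1)[OF v a])
    show "(\<integral>x. (v (r k) a x)\<^sup>2 \<partial>lborel_ivl (len a)) \<le> C" for k
      by (rule order_trans[OF edge_le_L2_inner[OF fin a] C(1)])
    show "(\<integral>x. (H1_derivative (len a) (v (r k) a) x)\<^sup>2 \<partial>lborel_ivl (len a)) \<le> C" for k
      using edge_le_L2_inner[OF fin a, where u = "\<lambda>e. H1_derivative (len e) (v (r k) e)" and len = len] C(2)[of "r k"]
      unfolding energy_self by (rule order_trans)
  qed
  then obtain s :: "nat \<Rightarrow> nat" where s: "strict_mono s"
    and sa: "\<forall>\<epsilon>>0. \<exists>N. \<forall>k\<ge>N. \<forall>m\<ge>N. \<forall>x\<in>{0..len a}. \<bar>v (r (s k)) a x - v (r (s m)) a x\<bar> < \<epsilon>"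
    by (elim exE conjE)
  have le_s: "N \<le> s k" if "N \<le> k" for N k
    using that strict_mono_imp_increasing[OF s, of k] by linarith
  have "\<exists>N. \<forall>k\<ge>N. \<forall>m\<ge>N. \<forall>x\<in>{0..len e}. \<bar>v (r (s k)) e x - v (r (s m)) e x\<bar> < \<epsilon>"
    if e: "e \<in> insert a F" and \<epsilon>: "0 < \<epsilon>" for e \<epsilon>
  proof (cases "e = a")
    case True
    then show ?thesis using sa \<epsilon> by simp
  next
    case False
    then have "e \<in> F" using e by simp
    then obtain N where N: "\<forall>k\<ge>N. \<forall>m\<ge>N. \<forall>x\<in>{0..len e}. \<bar>v (r k) e x - v (r m) e x\<bar> < \<epsilon>"
      using rF \<epsilon> by blast
    show ?thesis
    proof (intro exI[of _ N] allI impI ballI)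
      fix k m x assume "N \<le> k" "N \<le> m" "x \<in> {0..len e}"
      then show "\<bar>v (r (s k)) e x - v (r (s m)) e x\<bar> < \<epsilon>" using N le_s by simp
    qed
  qed
  moreover have "strict_mono (\<lambda>k. r (s k))" using r s unfolding strict_mono_def by simp
  ultimately show ?case by (intro exI[of _ "\<lambda>k. r (s k)"] conjI ballI allI impI)
qed

text \<open>
  The form domain embeds compactly into \<open>L\<^sup>2\<close>.
\<close>

lemma Rellich:
  fixes v :: "nat \<Rightarrow> 'e \<Rightarrow> real \<Rightarrow> real"
  assumes fin: "finite (arcs G)" and len: "\<And>e. e \<in> arcs G \<Longrightarrow> 0 < len e"
    and v: "\<And>k. v k \<in> form_domain G len"
    and C: "\<And>k. L2_inner G len (v k) (v k) \<le> C" "\<And>k. energy_form G len (v k) (v k) \<le> C"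
  shows "\<exists>r::nat \<Rightarrow> nat. strict_mono r \<and> (\<forall>\<epsilon>>0. \<exists>N. \<forall>k\<ge>N. \<forall>m\<ge>N.
    L2_inner G len (v (r k) - v (r m)) (v (r k) - v (r m)) < \<epsilon>)"
proof -
  have "\<exists>r::nat \<Rightarrow> nat. strict_mono r \<and> (\<forall>e\<in>arcs G. \<forall>\<epsilon>>0. \<exists>N. \<forall>k\<ge>N. \<forall>m\<ge>N. \<forall>x\<in>{0..len e}.
      \<bar>v (r k) e x - v (r m) e x\<bar> < \<epsilon>)"
    by (rule uniform_subsequence[where v = v and C = C, OF fin len v C fin order_refl])
  then obtain r :: "nat \<Rightarrow> nat" where r: "strict_mono r"
    and rF: "\<forall>e\<in>arcs G. \<forall>\<epsilon>>0. \<exists>N. \<forall>k\<ge>N. \<forall>m\<ge>N. \<forall>x\<in>{0..len e}. \<bar>v (r k) e x - v (r m) e x\<bar> < \<epsilon>"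
    by (elim exE conjE)
  have "\<exists>N. \<forall>k\<ge>N. \<forall>m\<ge>N. L2_inner G len (v (r k) - v (r m)) (v (r k) - v (r m)) < \<epsilon>"
    if \<epsilon>: "0 < \<epsilon>" for \<epsilon>
  proof -
    \<comment> \<open>The summand \<open>1\<close> keeps \<open>L\<close> positive for a graph without edges and makes the final estimate strict.\<close>
    define L where "L = (\<Sum>e\<in>arcs G. len e) + 1"
    have "0 \<le> (\<Sum>e\<in>arcs G. len e)" using len by (intro sum_nonneg) (simp add: less_imp_le)
    then have L: "0 < L" unfolding L_def by linarith
    define \<delta> where "\<delta> = sqrt (\<epsilon> / L)"
    have \<delta>: "0 < \<delta>" "\<delta>\<^sup>2 = \<epsilon> / L" using \<epsilon> L by (simp_all add: \<delta>_def)
    have "\<forall>e\<in>arcs G. \<exists>N. \<forall>k\<ge>N. \<forall>m\<ge>N. \<forall>x\<in>{0..len e}. \<bar>v (r k) e x - v (r m) e x\<bar> < \<delta>"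
      using rF \<delta>(1) by blast
    from bchoice[OF this] obtain N where N: "\<forall>e\<in>arcs G. \<forall>k\<ge>N e. \<forall>m\<ge>N e. \<forall>x\<in>{0..len e}. \<bar>v (r k) e x - v (r m) e x\<bar> < \<delta>" ..
    define K where "K = Max (insert 0 (N ` arcs G))"
    have K: "N e \<le> K" if "e \<in> arcs G" for e
      unfolding K_def using fin that by (intro Max_ge) simp_all
    have "L2_inner G len (v (r k) - v (r m)) (v (r k) - v (r m)) < \<epsilon>" if km: "K \<le> k" "K \<le> m" for k m
    proof -
      have "L2_inner G len (v (r k) - v (r m)) (v (r k) - v (r m)) \<le> (\<Sum>e\<in>arcs G. \<delta>\<^sup>2 * len e)"
        unfolding inner_diff
      proof (rule sum_mono)
        fix e assume e: "e \<in> arcs G"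
        have "square_integrable (lborel_ivl (len e)) (\<lambda>x. v (r k) e x - v (r m) e x)"
          by (rule square_integrable_continuous[OF H1_continuous[OF has_H1_derivative_diff[OF
                  form_domainD(1)[OF v e] form_domainD(1)[OF v e]]]])
        then have int: "integrable (lborel_ivl (len e)) (\<lambda>x. (v (r k) e x - v (r m) e x)\<^sup>2)"
          unfolding square_integrable_def by (rule conjunct2)
        have "(\<integral>x. (v (r k) e x - v (r m) e x)\<^sup>2 \<partial>lborel_ivl (len e)) \<le> (\<integral>x. \<delta>\<^sup>2 \<partial>lborel_ivl (len e))"
        proof (rule integral_mono[OF int finite_measure.integrable_const[OF finite_measure_interval]])
          fix x assume "x \<in> space (lborel_ivl (len e))"
          then have "\<bar>v (r k) e x - v (r m) e x\<bar> < \<delta>"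
            using N e K[OF e] km unfolding space_lborel_ivl by (meson order_trans)
          then have "\<bar>v (r k) e x - v (r m) e x\<bar>\<^sup>2 \<le> \<delta>\<^sup>2" by (intro power_mono) simp_all
          then show "(v (r k) e x - v (r m) e x)\<^sup>2 \<le> \<delta>\<^sup>2" by simp
        qed
        also have "\<dots> = \<delta>\<^sup>2 * len e" using len[OF e] by (intro integral_const_interval) simp
        finally show "(\<integral>x. (v (r k) e x - v (r m) e x)\<^sup>2 \<partial>lborel_ivl (len e)) \<le> \<delta>\<^sup>2 * len e" .
      qed
      also have "\<dots> = \<delta>\<^sup>2 * (L - 1)" by (simp add: L_def sum_distrib_left)
      also have "\<dots> < \<delta>\<^sup>2 * L" using \<delta>(1) by simp
      also have "\<dots> = \<epsilon>" using L \<delta>(2) by simp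
      finally show ?thesis .
    qed
    then show ?thesis by (intro exI[of _ K] allI impI)
  qed
  with r show ?thesis by (intro exI[of _ r] conjI allI impI)
qed

lemma form_domain_complete:
  fixes v :: "nat \<Rightarrow> 'e \<Rightarrow> real \<Rightarrow> real"
  assumes fin: "finite (arcs G)" and len: "\<And>e. e \<in> arcs G \<Longrightarrow> 0 < len e"
    and v: "\<And>k. v k \<in> form_domain G len"
    and ci: "\<And>\<epsilon>. 0 < \<epsilon> \<Longrightarrow> \<exists>N. \<forall>k\<ge>N. \<forall>m\<ge>N. L2_inner G len (v k - v m) (v k - v m) < \<epsilon>"
    and ce: "\<And>\<epsilon>. 0 < \<epsilon> \<Longrightarrow> \<exists>N. \<forall>k\<ge>N. \<forall>m\<ge>N. energy_form G len (v k - v m) (v k - v m) < \<epsilon>"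
  shows "\<exists>w\<in>form_domain G len. (\<lambda>k. L2_inner G len (v k - w) (v k - w)) \<longlonglongrightarrow> 0 \<and>
    (\<lambda>k. energy_form G len (v k - w) (v k - w)) \<longlonglongrightarrow> 0"
proof -
  define w where "w = (\<lambda>e x. lim (\<lambda>k. v k e x))"
  define g where "g = (\<lambda>k e. H1_derivative (len e) (v k e))"
  have g: "has_H1_derivative (len e) (v k e) (g k e)" if "e \<in> arcs G" for k e
    unfolding g_def by (rule form_domainD(1)[OF v that])
  have "\<forall>e\<in>arcs G. \<exists>h. has_H1_derivative (len e) (w e) h \<and>
      (\<lambda>k. \<integral>x. (v k e x - w e x)\<^sup>2 \<partial>lborel_ivl (len e)) \<longlonglongrightarrow> 0 \<and>
      (\<lambda>k. \<integral>x. (g k e x - h x)\<^sup>2 \<partial>lborel_ivl (len e)) \<longlonglongrightarrow> 0"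
  proof
    fix e assume e: "e \<in> arcs G"
    show "\<exists>h. has_H1_derivative (len e) (w e) h \<and>
      (\<lambda>k. \<integral>x. (v k e x - w e x)\<^sup>2 \<partial>lborel_ivl (len e)) \<longlonglongrightarrow> 0 \<and>
      (\<lambda>k. \<integral>x. (g k e x - h x)\<^sup>2 \<partial>lborel_ivl (len e)) \<longlonglongrightarrow> 0"
      unfolding w_def
    proof (rule H1_complete[OF len[OF e] g[OF e]])
      fix \<epsilon> :: real assume \<epsilon>: "0 < \<epsilon>"
      obtain N where N: "\<forall>k\<ge>N. \<forall>m\<ge>N. L2_inner G len (v k - v m) (v k - v m) < \<epsilon>" using ci[OF \<epsilon>] ..
      show "\<exists>N. \<forall>k\<ge>N. \<forall>m\<ge>N. (\<integral>x. (v k e x - v m e x)\<^sup>2 \<partial>lborel_ivl (len e)) < \<epsilon>"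
      proof (intro exI[of _ N] allI impI)
        fix k m assume "N \<le> k" "N \<le> m"
        then have "L2_inner G len (v k - v m) (v k - v m) < \<epsilon>" using N by simp
        with edge_le_L2_inner[OF fin e, where u = "v k - v m" and len = len]
        show "(\<integral>x. (v k e x - v m e x)\<^sup>2 \<partial>lborel_ivl (len e)) < \<epsilon>" by (simp add: fun_diff_def)
      qed
      obtain N where N: "\<forall>k\<ge>N. \<forall>m\<ge>N. energy_form G len (v k - v m) (v k - v m) < \<epsilon>" using ce[OF \<epsilon>] ..
      show "\<exists>N. \<forall>k\<ge>N. \<forall>m\<ge>N. (\<integral>x. (g k e x - g m e x)\<^sup>2 \<partial>lborel_ivl (len e)) < \<epsilon>"
      proof (intro exI[of _ N] allI impI)
        fix k m assume "N \<le> k" "N \<le> m"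
        then have "energy_form G len (v k - v m) (v k - v m) < \<epsilon>" using N by simp
        moreover have "(\<integral>x. (g k e x - g m e x)\<^sup>2 \<partial>lborel_ivl (len e)) \<le> energy_form G len (v k - v m) (v k - v m)"
          unfolding energy_diff[OF v v] g_def using fin e by (intro member_le_sum) simp_all
        ultimately show "(\<integral>x. (g k e x - g m e x)\<^sup>2 \<partial>lborel_ivl (len e)) < \<epsilon>" by linarith
      qed
    qed
  qed
  from bchoice[OF this] obtain h where h: "\<forall>e\<in>arcs G. has_H1_derivative (len e) (w e) (h e) \<and>
      (\<lambda>k. \<integral>x. (v k e x - w e x)\<^sup>2 \<partial>lborel_ivl (len e)) \<longlonglongrightarrow> 0 \<and>
      (\<lambda>k. \<integral>x. (g k e x - h e x)\<^sup>2 \<partial>lborel_ivl (len e)) \<longlonglongrightarrow> 0" ..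
  have wh: "has_H1_derivative (len e) (w e) (h e)" if "e \<in> arcs G" for e using h that by simp
  have "\<forall>k. \<exists>\<phi>. has_vertex_values G len (v k) \<phi> \<and> (\<forall>x\<in>external_vertices G. \<phi> x = 0)"
    by (intro allI form_domainD(3)[OF v])
  from choice[OF this] obtain \<phi> where \<phi>: "\<forall>k. has_vertex_values G len (v k) (\<phi> k) \<and>
      (\<forall>x\<in>external_vertices G. \<phi> k x = 0)" ..
  have wD: "w \<in> form_domain G len"
  proof (rule form_domainI[OF wh])
    show "w e x = 0" if "\<not> (e \<in> arcs G \<and> x \<in> {0..len e})" for e x
    proof -
      have "(\<lambda>k. v k e x) = (\<lambda>k. 0)" using form_domainD(2)[OF v that] by (rule ext)
      then show ?thesis unfolding w_def by simp
    qed
    show "has_vertex_values G len w (\<lambda>x. lim (\<lambda>k. \<phi> k x))"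
      unfolding has_vertex_values_def w_def using \<phi> unfolding has_vertex_values_def by simp
    show "lim (\<lambda>k. \<phi> k x) = 0" if "x \<in> external_vertices G" for x using \<phi> that by simp
  qed
  moreover have "(\<lambda>k. L2_inner G len (v k - w) (v k - w)) \<longlonglongrightarrow> (\<Sum>e\<in>arcs G. 0)"
    unfolding inner_diff using h by (intro tendsto_sum) simp
  moreover have "(\<lambda>k. energy_form G len (v k - w) (v k - w)) \<longlonglongrightarrow> (\<Sum>e\<in>arcs G. 0)"
  proof -
    have "energy_form G len (v k - w) (v k - w) =
        (\<Sum>e\<in>arcs G. \<integral>x. (g k e x - h e x)\<^sup>2 \<partial>lborel_ivl (len e))" for k
    proof -
      have "has_H1_derivative (len e) ((v k - w) e) (\<lambda>x. g k e x - h e x)" if "e \<in> arcs G" for e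
        using has_H1_derivative_diff[OF g[OF that] wh[OF that]] by (simp add: fun_diff_def)
      from energy_form_eq[of G len "v k - w" "\<lambda>e x. g k e x - h e x", OF this this]
      show ?thesis unfolding L2_inner_self .
    qed
    then show ?thesis using h by (simp only:) (intro tendsto_sum, simp)
  qed
  ultimately show ?thesis by (intro bexI[of _ w] conjI) simp_all
qed

lemma compact_form_pair_graph:
  fixes G :: "('v, 'e) pre_digraph"
  assumes fin: "finite (arcs G)" and len: "\<And>e. e \<in> arcs G \<Longrightarrow> 0 < len e"
  shows "compact_form_pair scale_fun (form_domain G len) (L2_inner G len) (energy_form G len)"
proof -
  interpret ip: nonneg_form scale_fun "form_domain G len" "L2_inner G len" by (rule nonneg_form_inner)
  interpret E: nonneg_form scale_fun "form_domain G len" "energy_form G len" by (rule nonneg_form_energy)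
  show ?thesis
  proof
    fix u assume u: "u \<in> form_domain G len" "u \<noteq> 0"
    then obtain e x where ex: "u e x \<noteq> 0" by (auto simp: fun_eq_iff)
    then have e: "e \<in> arcs G" "x \<in> {0..len e}" using form_domainD(2)[OF u(1)] by blast+
    have "0 < (\<integral>x. (u e x)\<^sup>2 \<partial>lborel_ivl (len e))"
      by (rule continuous_integral_square_pos[OF H1_continuous[OF form_domainD(1)[OF u(1) e(1)]] len[OF e(1)] e(2) ex])
    then show "0 < L2_inner G len u u"
      using edge_le_L2_inner[OF fin e(1), where u = u and len = len] by linarith
  next
    fix v :: "nat \<Rightarrow> 'e \<Rightarrow> real \<Rightarrow> real" and C
    assume seq: "\<And>k. v k \<in> form_domain G len" "\<And>k. L2_inner G len (v k) (v k) \<le> C"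
      "\<And>k. energy_form G len (v k) (v k) \<le> C"
    show "\<exists>r::nat \<Rightarrow> nat. strict_mono r \<and> (\<forall>e>0. \<exists>N. \<forall>k\<ge>N. \<forall>l\<ge>N.
        L2_inner G len (v (r k) - v (r l)) (v (r k) - v (r l)) < e)"
      by (rule Rellich[where v = v and C = C, OF fin len seq])
  next
    fix v :: "nat \<Rightarrow> 'e \<Rightarrow> real \<Rightarrow> real"
    assume seq: "\<And>k. v k \<in> form_domain G len"
      "\<And>e. 0 < e \<Longrightarrow> \<exists>N. \<forall>k\<ge>N. \<forall>l\<ge>N. L2_inner G len (v k - v l) (v k - v l) < e"
      "\<And>e. 0 < e \<Longrightarrow> \<exists>N. \<forall>k\<ge>N. \<forall>l\<ge>N. energy_form G len (v k - v l) (v k - v l) < e"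
    show "\<exists>w\<in>form_domain G len. (\<lambda>k. L2_inner G len (v k - w) (v k - w)) \<longlonglongrightarrow> 0 \<and>
        (\<lambda>k. energy_form G len (v k - w) (v k - w)) \<longlonglongrightarrow> 0"
      by (rule form_domain_complete[where v = v, OF fin len seq])
  qed
qed


section \<open>Multiplication by balanced affine functions\<close>

text \<open>
  Multiplication by the function that equals \<open>\<alpha> (tail G e)\<close> at the initial point of the edge \<open>e\<close> and
  has slope \<open>\<gamma> e\<close> along it.
\<close>

definition affine_multiplier ::
  "('v, 'e) pre_digraph \<Rightarrow> ('v \<Rightarrow> real) \<Rightarrow> ('e \<Rightarrow> real) \<Rightarrow> ('e \<Rightarrow> real \<Rightarrow> real) \<Rightarrow> 'e \<Rightarrow> real \<Rightarrow> real"
where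
  "affine_multiplier G \<alpha> \<gamma> u = (\<lambda>e x. (\<alpha> (tail G e) + \<gamma> e * x) * u e x)"

context
  fixes G :: "('v, 'e) pre_digraph" and len :: "'e \<Rightarrow> real" and \<alpha> :: "'v \<Rightarrow> real" and \<gamma> :: "'e \<Rightarrow> real"
  assumes fin: "finite (arcs G)" and len: "\<And>e. e \<in> arcs G \<Longrightarrow> 0 < len e"
    and slope: "\<And>e. e \<in> arcs G \<Longrightarrow> \<alpha> (head G e) - \<alpha> (tail G e) = len e * \<gamma> e"
    and balanced: "\<And>\<phi>. (\<And>v. v \<in> external_vertices G \<Longrightarrow> \<phi> v = 0) \<Longrightarrow>
      (\<Sum>e\<in>arcs G. \<gamma> e * (\<phi> (head G e) - \<phi> (tail G e))) = 0"
begin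

text \<open>
  The multiplication operator for the fixed data, and the family of edgewise derivatives.
\<close>

abbreviation mul where "mul \<equiv> affine_multiplier G \<alpha> \<gamma>"
abbreviation der :: "('e \<Rightarrow> real \<Rightarrow> real) \<Rightarrow> 'e \<Rightarrow> real \<Rightarrow> real" where
  "der u \<equiv> \<lambda>e. H1_derivative (len e) (u e)"

lemma mult_derivative:
  assumes "has_H1_derivative (len e) (u e) g"
  shows "has_H1_derivative (len e) (mul u e) (\<lambda>x. \<gamma> e * u e x + g x * (\<alpha> (tail G e) + \<gamma> e * x))"
  unfolding affine_multiplier_def
  by (rule has_H1_derivative_mult[OF has_H1_derivative_affine assms])

lemma mult_form_domain:
  assumes u: "u \<in> form_domain G len"
  shows "mul u \<in> form_domain G len"
proof -
  obtain \<phi> where \<phi>: "has_vertex_values G len u \<phi>" "\<forall>v\<in>external_vertices G. \<phi> v = 0"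
    using form_domainD(3)[OF u] by blast
  show ?thesis
  proof (rule form_domainI)
    show "has_H1_derivative (len e) (mul u e) (\<lambda>x. \<gamma> e * u e x + der u e x * (\<alpha> (tail G e) + \<gamma> e * x))"
      if "e \<in> arcs G" for e
      by (rule mult_derivative[where u = u, OF form_domainD(1)[OF u that]])
    show "mul u e x = 0" if "\<not> (e \<in> arcs G \<and> x \<in> {0..len e})" for e x
      using form_domainD(2)[OF u that] by (simp add: affine_multiplier_def)
    show "has_vertex_values G len (mul u) (\<lambda>v. \<alpha> v * \<phi> v)"
      unfolding has_vertex_values_def
    proof (intro ballI conjI)
      fix e assume e: "e \<in> arcs G"
      then have "u e 0 = \<phi> (tail G e)" "u e (len e) = \<phi> (head G e)"
        using \<phi>(1) unfolding has_vertex_values_def by simp_all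
      moreover have "\<alpha> (tail G e) + \<gamma> e * len e = \<alpha> (head G e)"
        using slope[OF e] by (simp add: mult.commute)
      ultimately show "mul u e 0 = \<alpha> (tail G e) * \<phi> (tail G e)"
        "mul u e (len e) = \<alpha> (head G e) * \<phi> (head G e)"
        by (simp_all add: affine_multiplier_def)
    qed
    show "\<alpha> v * \<phi> v = 0" if "v \<in> external_vertices G" for v using \<phi>(2) that by simp
  qed
qed

lemma mult_symmetric: "L2_inner G len (mul u) v = L2_inner G len (mul v) u"
  unfolding L2_inner_eq affine_multiplier_def by (simp only: mult.commute mult.left_commute)

text \<open>
  Integration by parts leaves only boundary terms, and these cancel because the product of \<open>u\<close> and \<open>v\<close>
  is continuous on the graph, vanishes at the external vertices, and the slopes are balanced elsewhere.
\<close>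

lemma balanced_boundary_terms:
  assumes u: "u \<in> form_domain G len" and v: "v \<in> form_domain G len"
    and g: "\<And>e. e \<in> arcs G \<Longrightarrow> has_H1_derivative (len e) (u e) (g e)"
    and h: "\<And>e. e \<in> arcs G \<Longrightarrow> has_H1_derivative (len e) (v e) (h e)"
  shows "(\<Sum>e\<in>arcs G. \<gamma> e * (\<integral>x. g e x * v e x + h e x * u e x \<partial>lborel_ivl (len e))) = 0"
proof -
  obtain \<phi> where \<phi>: "has_vertex_values G len u \<phi>" "\<forall>v\<in>external_vertices G. \<phi> v = 0"
    using form_domainD(3)[OF u] by blast
  obtain \<psi> where \<psi>: "has_vertex_values G len v \<psi>"
    using form_domainD(3)[OF v] by blast
  have "(\<integral>x. g e x * v e x + h e x * u e x \<partial>lborel_ivl (len e))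
      = \<phi> (head G e) * \<psi> (head G e) - \<phi> (tail G e) * \<psi> (tail G e)" if e: "e \<in> arcs G" for e
  proof -
    have H: "has_H1_derivative (len e) (\<lambda>x. u e x * v e x) (\<lambda>x. g e x * v e x + h e x * u e x)"
      by (rule has_H1_derivative_mult[OF g[OF e] h[OF e]])
    have "u e (len e) * v e (len e) - u e 0 * v e 0
        = (\<integral>t. indicator {0..len e} t * (g e t * v e t + h e t * u e t) \<partial>lborel_ivl (len e))"
      using has_H1_derivativeD(2)[OF H, of "len e"] len[OF e] by simp
    also have "\<dots> = (\<integral>x. g e x * v e x + h e x * u e x \<partial>lborel_ivl (len e))"
      by (intro Bochner_Integration.integral_cong refl) simp
    finally show ?thesis using \<phi>(1) \<psi> e unfolding has_vertex_values_def by simp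
  qed
  then have "(\<Sum>e\<in>arcs G. \<gamma> e * (\<integral>x. g e x * v e x + h e x * u e x \<partial>lborel_ivl (len e)))
      = (\<Sum>e\<in>arcs G. \<gamma> e * (\<phi> (head G e) * \<psi> (head G e) - \<phi> (tail G e) * \<psi> (tail G e)))"
    by (intro sum.cong refl) simp
  also have "\<dots> = 0" using \<phi>(2) by (intro balanced) simp
  finally show ?thesis .
qed

lemma energy_commutator:
  assumes u: "u \<in> form_domain G len" and v: "v \<in> form_domain G len"
    and g: "\<And>e. e \<in> arcs G \<Longrightarrow> has_H1_derivative (len e) (u e) (g e)"
    and h: "\<And>e. e \<in> arcs G \<Longrightarrow> has_H1_derivative (len e) (v e) (h e)"
  shows "energy_form G len (mul u) v - energy_form G len u (mul v) =
    (\<Sum>e\<in>arcs G. \<gamma> e * (\<integral>x. u e x * h e x - g e x * v e x \<partial>lborel_ivl (len e)))"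
proof -
  let ?l = "\<lambda>e x. \<alpha> (tail G e) + \<gamma> e * x"
  let ?a = "\<lambda>e x. \<gamma> e * u e x + g e x * ?l e x" and ?b = "\<lambda>e x. \<gamma> e * v e x + h e x * ?l e x"
  have A: "energy_form G len (mul u) v = L2_inner G len ?a h"
    by (rule energy_form_eq) (rule mult_derivative[where u = u], rule g, assumption, rule h)
  have B: "energy_form G len u (mul v) = L2_inner G len g ?b"
    by (rule energy_form_eq) (rule g, assumption, rule mult_derivative[where u = v], rule h)
  show ?thesis
    unfolding A B L2_inner_eq sum_subtractf[symmetric]
  proof (rule sum.cong[OF refl])
    fix e assume e: "e \<in> arcs G"
    have "integrable (lborel_ivl (len e)) (\<lambda>x. ?a e x * h e x)"
      by (rule square_integrable_prod[OF has_H1_derivativeD(1)[OF mult_derivative[where u = u, OF g[OF e]]] has_H1_derivativeD(1)[OF h[OF e]]])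
    moreover have "integrable (lborel_ivl (len e)) (\<lambda>x. g e x * ?b e x)"
      by (rule square_integrable_prod[OF has_H1_derivativeD(1)[OF g[OF e]] has_H1_derivativeD(1)[OF mult_derivative[where u = v, OF h[OF e]]]])
    ultimately have "(\<integral>x. ?a e x * h e x \<partial>lborel_ivl (len e)) - (\<integral>x. g e x * ?b e x \<partial>lborel_ivl (len e))
        = (\<integral>x. ?a e x * h e x - g e x * ?b e x \<partial>lborel_ivl (len e))"
      by (rule Bochner_Integration.integral_diff[symmetric])
    also have "\<dots> = (\<integral>x. \<gamma> e * (u e x * h e x - g e x * v e x) \<partial>lborel_ivl (len e))"
      by (intro Bochner_Integration.integral_cong refl) (simp add: algebra_simps)
    also have "\<dots> = \<gamma> e * (\<integral>x. u e x * h e x - g e x * v e x \<partial>lborel_ivl (len e))"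
      by (rule integral_mult_right_zero)
    finally show "(\<integral>x. ?a e x * h e x \<partial>lborel_ivl (len e)) - (\<integral>x. g e x * ?b e x \<partial>lborel_ivl (len e))
        = \<gamma> e * (\<integral>x. u e x * h e x - g e x * v e x \<partial>lborel_ivl (len e))" .
  qed
qed

lemma energy_commutator_balanced:
  assumes u: "u \<in> form_domain G len" and v: "v \<in> form_domain G len"
  shows "energy_form G len (mul u) v - energy_form G len u (mul v) =
    - 2 * L2_inner G len (\<lambda>e x. \<gamma> e * der u e x) v"
proof -
  have "energy_form G len (mul u) v - energy_form G len u (mul v) =
      (\<Sum>e\<in>arcs G. \<gamma> e * (\<integral>x. u e x * der v e x - der u e x * v e x \<partial>lborel_ivl (len e)))"
    by (rule energy_commutator[OF u v form_domainD(1)[OF u] form_domainD(1)[OF v]])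
  also have "\<dots> = (\<Sum>e\<in>arcs G. \<gamma> e * (\<integral>x. der u e x * v e x + der v e x * u e x \<partial>lborel_ivl (len e)))
      + - 2 * L2_inner G len (\<lambda>e x. \<gamma> e * der u e x) v"
    unfolding L2_inner_eq sum_distrib_left sum.distrib[symmetric]
  proof (rule sum.cong[OF refl])
    fix e assume e: "e \<in> arcs G"
    let ?M = "lborel_ivl (len e)"
    have i1: "integrable ?M (\<lambda>x. der u e x * v e x)"
      by (rule square_integrable_prod[OF has_H1_derivativeD(1)[OF form_domainD(1)[OF u e]]
            square_integrable_continuous[OF H1_continuous[OF form_domainD(1)[OF v e]]]])
    have i2: "integrable ?M (\<lambda>x. der v e x * u e x)"
      by (rule square_integrable_prod[OF has_H1_derivativeD(1)[OF form_domainD(1)[OF v e]]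
            square_integrable_continuous[OF H1_continuous[OF form_domainD(1)[OF u e]]]])
    have "(\<integral>x. u e x * der v e x - der u e x * v e x \<partial>?M) = (\<integral>x. der v e x * u e x \<partial>?M) - (\<integral>x. der u e x * v e x \<partial>?M)"
      using i1 i2 by (simp add: mult.commute[of "u e _"])
    moreover have "(\<integral>x. der u e x * v e x + der v e x * u e x \<partial>?M) = (\<integral>x. der u e x * v e x \<partial>?M) + (\<integral>x. der v e x * u e x \<partial>?M)"
      by (rule Bochner_Integration.integral_add[OF i1 i2])
    moreover have "(\<integral>x. \<gamma> e * der u e x * v e x \<partial>?M) = \<gamma> e * (\<integral>x. der u e x * v e x \<partial>?M)"
      unfolding mult.assoc by (rule integral_mult_right_zero)
    moreover have "c * (b - a) = c * (a + b) + - 2 * (c * a)" for a b c :: real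
      by (simp add: algebra_simps)
    ultimately show "\<gamma> e * (\<integral>x. u e x * der v e x - der u e x * v e x \<partial>?M) =
        \<gamma> e * (\<integral>x. der u e x * v e x + der v e x * u e x \<partial>?M) + - 2 * (\<integral>x. \<gamma> e * der u e x * v e x \<partial>?M)"
      by (simp only:)
  qed
  also have "(\<Sum>e\<in>arcs G. \<gamma> e * (\<integral>x. der u e x * v e x + der v e x * u e x \<partial>lborel_ivl (len e))) = 0"
    by (rule balanced_boundary_terms[OF u v form_domainD(1)[OF u] form_domainD(1)[OF v]])
  finally show ?thesis by simp
qed

lemma energy_commutator_self:
  assumes u: "u \<in> form_domain G len"
  shows "energy_form G len (mul u) (mul u) - energy_form G len u (mul (mul u)) =
    (\<Sum>e\<in>arcs G. (\<gamma> e)\<^sup>2 * (\<integral>x. (u e x)\<^sup>2 \<partial>lborel_ivl (len e)))"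
proof -
  have "energy_form G len (mul u) (mul u) - energy_form G len u (mul (mul u)) =
      (\<Sum>e\<in>arcs G. \<gamma> e * (\<integral>x. u e x * (\<gamma> e * u e x + der u e x * (\<alpha> (tail G e) + \<gamma> e * x))
        - der u e x * mul u e x \<partial>lborel_ivl (len e)))"
    by (rule energy_commutator[OF u mult_form_domain[OF u] form_domainD(1)[OF u]
          mult_derivative[where u = u, OF form_domainD(1)[OF u]]])
  also have "\<dots> = (\<Sum>e\<in>arcs G. (\<gamma> e)\<^sup>2 * (\<integral>x. (u e x)\<^sup>2 \<partial>lborel_ivl (len e)))"
  proof (rule sum.cong[OF refl])
    fix e
    have "(\<integral>x. u e x * (\<gamma> e * u e x + der u e x * (\<alpha> (tail G e) + \<gamma> e * x))
        - der u e x * mul u e x \<partial>lborel_ivl (len e)) = (\<integral>x. \<gamma> e * (u e x)\<^sup>2 \<partial>lborel_ivl (len e))"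
      by (intro Bochner_Integration.integral_cong refl)
        (simp add: affine_multiplier_def power2_eq_square algebra_simps)
    then show "\<gamma> e * (\<integral>x. u e x * (\<gamma> e * u e x + der u e x * (\<alpha> (tail G e) + \<gamma> e * x))
        - der u e x * mul u e x \<partial>lborel_ivl (len e)) = (\<gamma> e)\<^sup>2 * (\<integral>x. (u e x)\<^sup>2 \<partial>lborel_ivl (len e))"
      by (simp add: power2_eq_square mult.assoc)
  qed
  finally show ?thesis .
qed

text \<open>
  The functional of \<open>abstract_Yang_inequality\<close> is here twice the inner product with \<open>\<gamma> (u i)'\<close>, so the
  Cauchy-Schwarz inequality bounds it.
\<close>

lemma multiplier_Yang_inequality:
  fixes u :: "nat \<Rightarrow> 'e \<Rightarrow> real \<Rightarrow> real" and lam :: "nat \<Rightarrow> real"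
  assumes I: "finite I"
    and u: "\<And>i. i \<in> I \<Longrightarrow> u i \<in> form_domain G len"
    and on: "\<And>i j. i \<in> I \<Longrightarrow> j \<in> I \<Longrightarrow> L2_inner G len (u i) (u j) = of_bool (i = j)"
    and eig: "\<And>i v. i \<in> I \<Longrightarrow> v \<in> form_domain G len \<Longrightarrow> energy_form G len (u i) v = lam i * L2_inner G len (u i) v"
    and bound: "\<And>v. v \<in> form_domain G len \<Longrightarrow> (\<And>i. i \<in> I \<Longrightarrow> L2_inner G len v (u i) = 0) \<Longrightarrow>
      z * L2_inner G len v v \<le> energy_form G len v v"
    and lt: "\<And>i. i \<in> I \<Longrightarrow> lam i < z"
  shows "(\<Sum>i\<in>I. (z - lam i)\<^sup>2 * (\<Sum>e\<in>arcs G. (\<gamma> e)\<^sup>2 * (\<integral>x. (u i e x)\<^sup>2 \<partial>lborel_ivl (len e))))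
    \<le> 4 * (\<Sum>i\<in>I. (z - lam i) * (\<Sum>e\<in>arcs G. (\<gamma> e)\<^sup>2 * (\<integral>x. (der (u i) e x)\<^sup>2 \<partial>lborel_ivl (len e))))"
proof -
  interpret P: compact_form_pair scale_fun "form_domain G len" "L2_inner G len" "energy_form G len"
    by (rule compact_form_pair_graph[OF fin len])
  interpret L: nonneg_form scale_fun "L2 G len" "L2_inner G len" by (rule nonneg_form_L2)
  define Q where "Q = (\<lambda>i. \<Sum>e\<in>arcs G. (\<gamma> e)\<^sup>2 * (\<integral>x. (der (u i) e x)\<^sup>2 \<partial>lborel_ivl (len e)))"
  have Q: "Q i = L2_inner G len (\<lambda>e x. \<gamma> e * der (u i) e x) (\<lambda>e x. \<gamma> e * der (u i) e x)" for i
    unfolding Q_def L2_inner_self by (simp add: power_mult_distrib)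
  have com: "lam i * L2_inner G len (mul (u i)) v - energy_form G len (mul (u i)) v
      = 2 * L2_inner G len (\<lambda>e x. \<gamma> e * der (u i) e x) v"
    if i: "i \<in> I" and v: "v \<in> form_domain G len" for i v
  proof -
    have "energy_form G len (u i) (mul v) = lam i * L2_inner G len (u i) (mul v)"
      by (rule eig[OF i mult_form_domain[OF v]])
    also have "L2_inner G len (u i) (mul v) = L2_inner G len (mul (u i)) v"
      unfolding L2_inner_sym[of G len "u i" "mul v"] by (rule mult_symmetric)
    finally show ?thesis using energy_commutator_balanced[OF u[OF i] v] by simp
  qed
  have p: "energy_form G len (mul (u i)) (mul (u i)) - lam i * L2_inner G len (mul (u i)) (mul (u i))
      = (\<Sum>e\<in>arcs G. (\<gamma> e)\<^sup>2 * (\<integral>x. (u i e x)\<^sup>2 \<partial>lborel_ivl (len e)))" if i: "i \<in> I" for i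
  proof -
    let ?m = "mul (u i)"
    have "energy_form G len (u i) (mul ?m) = lam i * L2_inner G len (u i) (mul ?m)"
      by (rule eig[OF i mult_form_domain[OF mult_form_domain[OF u[OF i]]]])
    also have "L2_inner G len (u i) (mul ?m) = L2_inner G len ?m ?m"
      unfolding L2_inner_sym[of G len "u i" "mul ?m"] by (rule mult_symmetric)
    finally show ?thesis using energy_commutator_self[OF u[OF i]] by simp
  qed
  have "(\<Sum>i\<in>I. (z - lam i)\<^sup>2 * (energy_form G len (mul (u i)) (mul (u i))
      - lam i * L2_inner G len (mul (u i)) (mul (u i)))) \<le> 4 * (\<Sum>i\<in>I. (z - lam i) * Q i)"
  proof (rule P.abstract_Yang_inequality[OF I])
    show "P.orthonormal I u" unfolding P.orthonormal_def by (intro conjI ballI u on)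
    show "P.eigenvector (lam i) (u i)" if i: "i \<in> I" for i
      unfolding P.eigenvector_def by (intro conjI ballI u[OF i] eig[OF i])
    show "z * L2_inner G len v v \<le> energy_form G len v v"
      if "v \<in> form_domain G len" "\<And>i. i \<in> I \<Longrightarrow> L2_inner G len v (u i) = 0" for v
      using that by (rule bound)
    show "lam i < z" if "i \<in> I" for i using that by (rule lt)
    show "mul (u i) \<in> form_domain G len" if "i \<in> I" for i by (rule mult_form_domain[OF u[OF that]])
    show "L2_inner G len (mul (u i)) (u j) = L2_inner G len (mul (u j)) (u i)" for i j
      by (rule mult_symmetric)
    show "0 \<le> Q i" for i unfolding Q_def by (intro sum_nonneg mult_nonneg_nonneg) simp_all
    show "(lam i * L2_inner G len (mul (u i)) v - energy_form G len (mul (u i)) v)\<^sup>2 \<le> 4 * Q i * L2_inner G len v v"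
      if i: "i \<in> I" and v: "v \<in> form_domain G len" for i v
    proof -
      have "(\<lambda>e x. \<gamma> e * der (u i) e x) \<in> L2 G len"
        unfolding L2_iff
        by (intro ballI square_integrable_scale has_H1_derivativeD(1)[OF form_domainD(1)[OF u[OF i]]])
      from L.Cauchy_Schwarz[OF this form_domain_L2[OF v]]
      have "(L2_inner G len (\<lambda>e x. \<gamma> e * der (u i) e x) v)\<^sup>2 \<le> Q i * L2_inner G len v v" unfolding Q .
      then show ?thesis unfolding com[OF i v] by (simp add: power_mult_distrib)
    qed
  qed
  moreover have "(\<Sum>i\<in>I. (z - lam i)\<^sup>2 * (energy_form G len (mul (u i)) (mul (u i))
      - lam i * L2_inner G len (mul (u i)) (mul (u i)))) =
    (\<Sum>i\<in>I. (z - lam i)\<^sup>2 * (\<Sum>e\<in>arcs G. (\<gamma> e)\<^sup>2 * (\<integral>x. (u i e x)\<^sup>2 \<partial>lborel_ivl (len e))))"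
    by (rule sum.cong[OF refl]) (simp only: p)
  ultimately show ?thesis unfolding Q_def by (simp only:)
qed

end


section \<open>The eigenvalue inequality\<close>

text \<open>
  If \<open>h\<close> changes sign at most once, from plus to minus, and \<open>k\<close> is the last index with \<open>0 \<le> h k\<close>, then
  \<open>g j * h j \<le> g k * h j\<close> for all \<open>j\<close>.
\<close>

lemma weighted_sum_nonpos:
  fixes g h :: "nat \<Rightarrow> real"
  assumes g: "\<And>j. j \<in> {1..n} \<Longrightarrow> 0 \<le> g j" "mono_on {1..n} g"
    and sign: "\<And>i j. i \<in> {1..n} \<Longrightarrow> j \<in> {1..n} \<Longrightarrow> i \<le> j \<Longrightarrow> 0 \<le> h j \<Longrightarrow> 0 \<le> h i"
    and total: "(\<Sum>j=1..n. h j) \<le> 0"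
  shows "(\<Sum>j=1..n. g j * h j) \<le> 0"
proof (cases "\<exists>j\<in>{1..n}. 0 \<le> h j")
  case False
  have "g j * h j \<le> 0" if j: "j \<in> {1..n}" for j
  proof -
    have "h j \<le> 0" using False j linear[of 0 "h j"] by blast
    with g(1)[OF j] show ?thesis by (rule mult_nonneg_nonpos)
  qed
  then show ?thesis by (rule sum_nonpos)
next
  case True
  define k where "k = Max {j \<in> {1..n}. 0 \<le> h j}"
  have "k \<in> {j \<in> {1..n}. 0 \<le> h j}" unfolding k_def using True by (intro Max_in) auto
  then have k: "k \<in> {1..n}" "0 \<le> h k" by simp_all
  have "g j * h j \<le> g k * h j" if j: "j \<in> {1..n}" for j
  proof (cases "j \<le> k")
    case True
    then have "g j \<le> g k" using g(2) j k(1) by (simp add: mono_on_def)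
    moreover have "0 \<le> h j" by (rule sign[OF j k(1) True k(2)])
    ultimately show ?thesis by (rule mult_right_mono)
  next
    case False
    have "h j < 0"
    proof (rule ccontr)
      assume "\<not> h j < 0"
      then have "j \<le> k" unfolding k_def using j by (intro Max_ge) auto
      with False show False by simp
    qed
    moreover have "g k \<le> g j" using g(2) j k(1) False by (simp add: mono_on_def)
    ultimately show ?thesis by (intro mult_right_mono_neg) simp_all
  qed
  then have "(\<Sum>j=1..n. g j * h j) \<le> (\<Sum>j=1..n. g k * h j)" by (rule sum_mono)
  also have "\<dots> = g k * (\<Sum>j=1..n. h j)" by (rule sum_distrib_left[symmetric])
  also have "\<dots> \<le> 0" using g(1)[OF k(1)] total by (rule mult_nonneg_nonpos)
  finally show ?thesis .
qed

lemma eigenspace_eq: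
  fixes G :: "('v, 'e) pre_digraph"
  assumes "form_pair scale_fun (form_domain G len) (L2_inner G len) (energy_form G len)"
  shows "eigenspace G len \<mu> =
    {u. form_pair.eigenvector (form_domain G len) (L2_inner G len) (energy_form G len) \<mu> u}"
proof -
  interpret P: form_pair scale_fun "form_domain G len" "L2_inner G len" "energy_form G len" by fact
  interpret L: nonneg_form scale_fun "L2 G len" "L2_inner G len" by (rule nonneg_form_L2)
  have "(u, scale_fun \<mu> u) \<in> neg_laplacian G len \<longleftrightarrow> P.eigenvector \<mu> u" for u
  proof (cases "u \<in> form_domain G len")
    case True
    have "scale_fun \<mu> u \<in> L2 G len" by (rule form_domain_L2[OF P.ip.D_intros(3)[OF True]])
    moreover have "L2_inner G len (scale_fun \<mu> u) v = \<mu> * L2_inner G len u v"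
      if "v \<in> form_domain G len" for v
      by (rule P.ip.scale_left[OF True that])
    ultimately show ?thesis using True unfolding neg_laplacian_def P.eigenvector_def by simp
  next
    case False
    then show ?thesis unfolding neg_laplacian_def P.eigenvector_def by simp
  qed
  then show ?thesis unfolding eigenspace_def by simp
qed

text \<open>
  The case \<open>f (ev j) = (z - ev j)\<^sup>2\<close>. The inequalities for the two coordinates of the planar map are
  added.
\<close>

lemma tree_Yang_inequality:
  fixes G :: "('v, 'e) pre_digraph"
  assumes T: "compact_metric_tree G len" and ev: "lists_eigenvalues G len ev"
    and z: "z \<in> {ev n <.. ev (n + 1)}"
  shows "(\<Sum>j=1..n. (z - ev j)\<^sup>2) \<le> 4 * (\<Sum>j=1..n. (z - ev j) * ev j)"
proof -
  interpret G: fin_digraph G using T unfolding compact_metric_tree_def by blast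
  have fin: "finite (arcs G)" by (rule G.finite_arcs)
  have len: "0 < len e" if "e \<in> arcs G" for e using T that unfolding compact_metric_tree_def by blast
  interpret P: compact_form_pair scale_fun "form_domain G len" "L2_inner G len" "energy_form G len"
    by (rule compact_form_pair_graph[OF fin len])
  have mono: "ev i \<le> ev j" if "1 \<le> i" "i \<le> j" for i j
    using ev that unfolding lists_eigenvalues_def mono_on_def by simp
  have J: "{j \<in> {1..}. ev j = \<mu>} = {j. 1 \<le> j \<and> ev j = \<mu>}" for \<mu> by auto
  have es: "eigenspace G len \<mu> = {u. P.eigenvector \<mu> u}" for \<mu>
    by (rule eigenspace_eq[OF P.form_pair_axioms])
  have fin_ev: "finite {j \<in> {1..}. ev j = \<mu>}" for \<mu>
    unfolding J using ev unfolding lists_eigenvalues_def by blast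
  have basis: "\<exists>B. finite B \<and> graph_fun.independent B \<and> graph_fun.span B = {u. P.eigenvector \<mu> u} \<and>
      card B = card {j \<in> {1..}. ev j = \<mu>}" for \<mu>
    unfolding J es[symmetric] using ev unfolding lists_eigenvalues_def by blast
  have "\<exists>u. P.orthonormal {1..} u \<and> (\<forall>j\<in>{1..}. P.eigenvector (ev j) (u j)) \<and>
    (\<forall>\<mu> w. P.eigenvector \<mu> w \<longrightarrow> (\<forall>j\<in>{1..}. ev j = \<mu> \<longrightarrow> L2_inner G len w (u j) = 0) \<longrightarrow> w = 0)"
  proof (rule P.orthonormal_eigenvectors[OF fin_ev basis])
    fix u assume "P.orthonormal {1..} u" "\<And>j. j \<in> {1..} \<Longrightarrow> P.eigenvector (ev j) (u j)"
      "\<And>\<mu> w. P.eigenvector \<mu> w \<Longrightarrow> (\<And>j. j \<in> {1..} \<Longrightarrow> ev j = \<mu> \<Longrightarrow> L2_inner G len w (u j) = 0) \<Longrightarrow> w = 0"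
    then show "\<exists>u. P.orthonormal {1..} u \<and> (\<forall>j\<in>{1..}. P.eigenvector (ev j) (u j)) \<and>
    (\<forall>\<mu> w. P.eigenvector \<mu> w \<longrightarrow> (\<forall>j\<in>{1..}. ev j = \<mu> \<longrightarrow> L2_inner G len w (u j) = 0) \<longrightarrow> w = 0)"
      by (intro exI[of _ u] conjI) simp_all
  qed
  then obtain u where ON: "P.orthonormal {1..} u" and eig: "\<forall>j\<in>{1..}. P.eigenvector (ev j) (u j)"
    and maximal: "\<forall>\<mu> w. P.eigenvector \<mu> w \<longrightarrow> (\<forall>j\<in>{1..}. ev j = \<mu> \<longrightarrow> L2_inner G len w (u j) = 0) \<longrightarrow> w = 0"
    by (elim exE conjE)
  let ?I = "{1..n}"
  have ON': "P.orthonormal ?I u" using ON unfolding P.orthonormal_def by simp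
  have eig': "P.eigenvector (ev j) (u j)" if "j \<in> ?I" for j using eig that by simp
  have bound: "z * L2_inner G len v v \<le> energy_form G len v v"
    if v: "v \<in> form_domain G len" "\<And>i. i \<in> ?I \<Longrightarrow> L2_inner G len v (u i) = 0" for v
  proof -
    have "ev (n + 1) * L2_inner G len v v \<le> energy_form G len v v"
    proof (rule P.Rayleigh_lower_bound[OF _ ON' eig' _ v])
      fix \<mu> w assume \<mu>: "\<mu> < ev (n + 1)" and w: "P.eigenvector \<mu> w"
        and orth: "\<And>i. i \<in> ?I \<Longrightarrow> L2_inner G len w (u i) = 0"
      have "L2_inner G len w (u j) = 0" if j: "j \<in> {1..}" "ev j = \<mu>" for j
      proof (rule orth)
        have "\<not> n + 1 \<le> j" using mono[of "n + 1" j] j \<mu> by auto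
        then show "j \<in> ?I" using j(1) by simp
      qed
      then show "w = 0" using maximal w by blast
    qed simp_all
    moreover have "z * L2_inner G len v v \<le> ev (n + 1) * L2_inner G len v v"
      using z P.ip.nonneg[OF v(1)] by (intro mult_right_mono) simp_all
    ultimately show ?thesis by linarith
  qed
  have lt: "ev j < z" if "j \<in> ?I" for j using mono[of j n] that z by simp
  have uD: "u j \<in> form_domain G len" if "j \<in> ?I" for j using ON' that unfolding P.orthonormal_def by blast
  have on: "L2_inner G len (u i) (u j) = of_bool (i = j)" if "i \<in> ?I" "j \<in> ?I" for i j
    using ON' that unfolding P.orthonormal_def by blast
  have eig_form: "energy_form G len (u i) v = ev i * L2_inner G len (u i) v"
    if "i \<in> ?I" "v \<in> form_domain G len" for i v
    using eig'[OF that(1)] that(2) unfolding P.eigenvector_def by blast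
  obtain c :: "'e \<Rightarrow> complex" and q :: "'v \<Rightarrow> complex"
    where cq: "\<forall>e\<in>arcs G. cmod (c e) = 1 \<and> q (head G e) - q (tail G e) = len e * c e"
    and balanced: "\<forall>\<phi>. (\<forall>v\<in>external_vertices G. \<phi> v = 0) \<longrightarrow>
      (\<Sum>e\<in>arcs G. c e * of_real (\<phi> (head G e) - \<phi> (tail G e))) = 0"
    using tree_planar_map[OF T] by (elim exE conjE)
  have c: "cmod (c e) = 1" and q: "q (head G e) - q (tail G e) = len e * c e" if "e \<in> arcs G" for e
    using cq that by simp_all
  define A where "A = (\<lambda>j e. \<integral>x. (u j e x)\<^sup>2 \<partial>lborel_ivl (len e))"
  define B where "B = (\<lambda>j e. \<integral>x. (H1_derivative (len e) (u j e) x)\<^sup>2 \<partial>lborel_ivl (len e))"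
  \<comment> \<open>Here \<open>\<rho>\<close> is the real or the imaginary part.\<close>
  have yang: "(\<Sum>j\<in>?I. (z - ev j)\<^sup>2 * (\<Sum>e\<in>arcs G. (\<rho> (c e))\<^sup>2 * A j e))
      \<le> 4 * (\<Sum>j\<in>?I. (z - ev j) * (\<Sum>e\<in>arcs G. (\<rho> (c e))\<^sup>2 * B j e))"
    if \<rho>: "\<And>x y. \<rho> (x - y) = \<rho> x - \<rho> y" "\<And>I f. \<rho> (sum f I) = (\<Sum>i\<in>I. \<rho> (f (i :: 'e)))"
      "\<And>x r. \<rho> (x * of_real r) = \<rho> x * r" "\<rho> 0 = 0" for \<rho> :: "complex \<Rightarrow> real"
    unfolding A_def B_def
  proof (rule multiplier_Yang_inequality[OF fin len _ _ _ uD on eig_form bound lt])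
    show "\<rho> (q (head G e)) - \<rho> (q (tail G e)) = len e * \<rho> (c e)" if "e \<in> arcs G" for e
    proof -
      have "\<rho> (q (head G e)) - \<rho> (q (tail G e)) = \<rho> (c e * len e)"
        unfolding \<rho>(1)[symmetric] q[OF that] by (simp only: mult.commute)
      then show ?thesis unfolding \<rho>(3) by (simp only: mult.commute)
    qed
    show "(\<Sum>e\<in>arcs G. \<rho> (c e) * (\<phi> (head G e) - \<phi> (tail G e))) = 0"
      if "\<And>v. v \<in> external_vertices G \<Longrightarrow> \<phi> v = 0" for \<phi>
    proof -
      have "(\<Sum>e\<in>arcs G. c e * of_real (\<phi> (head G e) - \<phi> (tail G e))) = 0"
        using balanced that by simp
      from arg_cong[OF this, of \<rho>] show ?thesis by (simp only: \<rho>(2,3,4))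
    qed
  qed simp_all
  have unit: "(Re (c e))\<^sup>2 + (Im (c e))\<^sup>2 = 1" if "e \<in> arcs G" for e
    using cmod_power2[of "c e"] c[OF that] by simp
  have merge: "(\<Sum>e\<in>arcs G. (Re (c e))\<^sup>2 * X e + (Im (c e))\<^sup>2 * X e) = (\<Sum>e\<in>arcs G. X e)" for X
    unfolding distrib_right[symmetric] by (rule sum.cong[OF refl]) (simp add: unit)
  have "(\<Sum>j\<in>?I. (z - ev j)\<^sup>2 * (\<Sum>e\<in>arcs G. (Re (c e))\<^sup>2 * A j e))
      + (\<Sum>j\<in>?I. (z - ev j)\<^sup>2 * (\<Sum>e\<in>arcs G. (Im (c e))\<^sup>2 * A j e))
    \<le> 4 * (\<Sum>j\<in>?I. (z - ev j) * (\<Sum>e\<in>arcs G. (Re (c e))\<^sup>2 * B j e))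
      + 4 * (\<Sum>j\<in>?I. (z - ev j) * (\<Sum>e\<in>arcs G. (Im (c e))\<^sup>2 * B j e))"
    by (rule add_mono; rule yang) simp_all
  then have "(\<Sum>j\<in>?I. (z - ev j)\<^sup>2 * (\<Sum>e\<in>arcs G. A j e)) \<le> 4 * (\<Sum>j\<in>?I. (z - ev j) * (\<Sum>e\<in>arcs G. B j e))"
    unfolding distrib_left[symmetric] sum.distrib[symmetric] merge .
  moreover have "(\<Sum>e\<in>arcs G. A j e) = 1" if "j \<in> ?I" for j
    using on[OF that that] unfolding L2_inner_self A_def by simp
  moreover have "(\<Sum>e\<in>arcs G. B j e) = ev j" if "j \<in> ?I" for j
    using eig_form[OF that uD[OF that]] on[OF that that]
    unfolding energy_self L2_inner_self[of G len "\<lambda>e. H1_derivative (len e) (u j e)"] B_def by simp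
  ultimately show ?thesis by simp
qed

theorem theorem5p2:
  fixes G :: "('v, 'e) pre_digraph" and len :: "'e \<Rightarrow> real"
    and ev :: "nat \<Rightarrow> real" and f :: "real \<Rightarrow> real" and n :: nat and z :: real
  assumes "compact_metric_tree G len"
    and "lists_eigenvalues G len ev"
    and "1 \<le> n"
    and "z \<in> {ev n <.. ev (n + 1)}"
    and "\<forall>x \<in> ev ` {1..n}. 0 < f x"
    and "mono_on {1..n} (\<lambda>j. f (ev j) / (z - ev j)\<^sup>2)"
  shows "(\<Sum>j=1..n. f (ev j)) \<le> 4 * (\<Sum>j=1..n. f (ev j) / (z - ev j) * ev j)"
proof -
  define g where "g = (\<lambda>j. f (ev j) / (z - ev j)\<^sup>2)"
  define h where "h = (\<lambda>j. (z - ev j) * (z - 5 * ev j))"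
  have mono: "ev i \<le> ev j" if "1 \<le> i" "i \<le> j" for i j
    using assms(2) that unfolding lists_eigenvalues_def mono_on_def by simp
  have lt: "ev j < z" if "j \<in> {1..n}" for j using mono[of j n] that assms(4) by simp
  have "(\<Sum>j=1..n. h j) = (\<Sum>j=1..n. (z - ev j)\<^sup>2) - 4 * (\<Sum>j=1..n. (z - ev j) * ev j)"
    unfolding sum_distrib_left sum_subtractf[symmetric] h_def
    by (intro sum.cong refl) (simp add: power2_eq_square algebra_simps)
  then have total: "(\<Sum>j=1..n. h j) \<le> 0"
    using tree_Yang_inequality[OF assms(1,2,4)] by linarith
  have "(\<Sum>j=1..n. g j * h j) \<le> 0"
  proof (rule weighted_sum_nonpos[OF _ _ _ total])
    show "0 \<le> g j" if "j \<in> {1..n}" for j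
    proof -
      have "0 < f (ev j)" using assms(5) that by blast
      then show ?thesis unfolding g_def by simp
    qed
    show "mono_on {1..n} g" using assms(6) unfolding g_def .
    show "0 \<le> h i" if ij: "i \<in> {1..n}" "j \<in> {1..n}" "i \<le> j" "0 \<le> h j" for i j
    proof -
      have "0 \<le> z - 5 * ev j"
        using ij(4) lt[OF ij(2)] unfolding h_def by (simp add: zero_le_mult_iff)
      then have "0 \<le> z - 5 * ev i" using mono[of i j] ij by simp
      then show ?thesis using lt[OF ij(1)] unfolding h_def by simp
    qed
  qed
  moreover have "(\<Sum>j=1..n. g j * h j) =
      (\<Sum>j=1..n. f (ev j)) - 4 * (\<Sum>j=1..n. f (ev j) / (z - ev j) * ev j)"
    unfolding sum_distrib_left sum_subtractf[symmetric]
  proof (intro sum.cong refl)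
    fix j assume "j \<in> {1..n}"
    then have nz: "z - ev j \<noteq> 0" using lt by force
    have "a / d\<^sup>2 * (d\<^sup>2 - 4 * (d * b)) = a - 4 * (a / d * b)" if "d \<noteq> 0" for a b d :: real
      using that by (simp add: right_diff_distrib power2_eq_square)
    from this[OF nz, of "f (ev j)" "ev j"] have "f (ev j) / (z - ev j)\<^sup>2 * ((z - ev j)\<^sup>2 - 4 * ((z - ev j) * ev j))
        = f (ev j) - 4 * (f (ev j) / (z - ev j) * ev j)" .
    moreover have "h j = (z - ev j)\<^sup>2 - 4 * ((z - ev j) * ev j)"
      unfolding h_def by (simp add: power2_eq_square algebra_simps)
    ultimately show "g j * h j = f (ev j) - 4 * (f (ev j) / (z - ev j) * ev j)"
      unfolding g_def by (simp only:)
  qed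
  ultimately show ?thesis by linarith
qed

end
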